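(* Let $p_0$ be a pmf on $\mathbb{N}$ which is convex on $\mathbb{N}$ and supported on $\{0,\dots,S\}$ for some integer $S>0$, and let $X_1,\dots,X_n$ be i.i.d. with pmf $p_0$. Let $(v_n)$ be positive numbers with $v_n\to0$ and $\sqrt n\,v_n\to\infty$, let $\alpha\in(0,1)$, and let $t_{\alpha,n}$ be the conditional $(1-\alpha)$-quantile of $\hat T_n$ given $X_1,\dots,X_n$. Then $$\limsup_{n\to\infty}P\big(n\|p_n-\hat p_n\|^2>t_{\alpha,n}\big)\le\alpha .$$
   Context: $p_n(j)=n^{-1}\sum_{i=1}^n\mathbb{1}_{\{X_i=j\}}$ is the empirical pmf, $S_n=\max\{X_1,\dots,X_n\}$, and $\|q\|^2=\sum_{j\in\mathbb{N}}q(j)^2$. For a sequence or vector $p$ and interior index $k\ge1$, $\Delta p(k)=p(k+1)-2p(k)+p(k-1)$; a pmf $p$ is convex on $\mathbb{N}$ iff $\Delta p(k)\ge0$ for all $k\ge1$. $\hat p_n$ is the (unique) minimizer of $\|p_n-p\|^2$ over all convex pmfs $p$ on $\mathbb{N}$. Conditionally on $X_1,\dots,X_n$, $g_n=(g_n(0),\dots,g_n(S_n+1))$ is a centered Gaussian vector in $\mathbb{R}^{S_n+2}$ with covariance entries $\mathbb{1}_{\{i=j\}}p_n(i)-p_n(i)p_n(j)$, $i,j=0,\dots,S_n+1$. $\mathcal K_n$ is the set of all $g\in\mathbb{R}^{S_n+2}$ with $\Delta g(x)\ge0$ for all $x\in\{1,\dots,S_n\}$ such that $\Delta\hat p_n(x)\le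 v_n$; $\hat g_n$ is the unique minimizer of $\sum_{k=0}^{S_n+1}(g(k)-g_n(k))^2$ over $g\in\mathcal K_n$, and $\hat T_n=\sum_{k=0}^{S_n+1}(\hat g_n(k)-g_n(k))^2$. *)

theory Defs
  imports "HOL-Probability.Probability"
begin

(* second difference  \<Delta>p(k) = p(k+1) - 2 p(k) + p(k-1), used for k \<ge> 1 *)
definition delta2 :: "(nat \<Rightarrow> real) \<Rightarrow> nat \<Rightarrow> real" where
  "delta2 p k = p (k + 1) - 2 * p k + p (k - 1)"

definition convex_pmf_fun :: "(nat \<Rightarrow> real) \<Rightarrow> bool" where
  "convex_pmf_fun p \<longleftrightarrow> (\<forall>j. 0 \<le> p j) \<and> p sums 1 \<and> (\<forall>k\<ge>1. 0 \<le> delta2 p k)"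

definition sqnorm :: "(nat \<Rightarrow> real) \<Rightarrow> real" where
  "sqnorm q = (\<Sum>j. (q j)\<^sup>2)"

(* empirical pmf of the sample X_0,...,X_{n-1} (xs i = X_{i+1}) *)
definition emp_pmf :: "nat \<Rightarrow> (nat \<Rightarrow> nat) \<Rightarrow> nat \<Rightarrow> real" where
  "emp_pmf n xs j = real (card {i. i < n \<and> xs i = j}) / real n"

definition sample_max :: "nat \<Rightarrow> (nat \<Rightarrow> nat) \<Rightarrow> nat" where
  "sample_max n xs = Max (xs ` {..<n})"

definition convex_lse :: "nat \<Rightarrow> (nat \<Rightarrow> nat) \<Rightarrow> nat \<Rightarrow> real" where
  "convex_lse n xs = (THE p. convex_pmf_fun p \<and>
      (\<forall>q. convex_pmf_fun q \<longrightarrow>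
          sqnorm (\<lambda>j. emp_pmf n xs j - p j) \<le> sqnorm (\<lambda>j. emp_pmf n xs j - q j)))"

(* the cone K_n, vectors of R^{S_n+2} represented as functions vanishing beyond S_n+1 *)
definition cone_K :: "(nat \<Rightarrow> real) \<Rightarrow> nat \<Rightarrow> (nat \<Rightarrow> nat) \<Rightarrow> (nat \<Rightarrow> real) set" where
  "cone_K v n xs = {g. (\<forall>k > sample_max n xs + 1. g k = 0) \<and>
      (\<forall>x\<in>{1..sample_max n xs}. delta2 (convex_lse n xs) x \<le> v n \<longrightarrow> 0 \<le> delta2 g x)}"

definition sqdist_fin :: "nat \<Rightarrow> (nat \<Rightarrow> real) \<Rightarrow> (nat \<Rightarrow> real) \<Rightarrow> real" where
  "sqdist_fin m g h = (\<Sum>k=0..m. (g k - h k)\<^sup>2)"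

definition proj_K :: "(nat \<Rightarrow> real) \<Rightarrow> nat \<Rightarrow> (nat \<Rightarrow> nat) \<Rightarrow> (nat \<Rightarrow> real) \<Rightarrow> (nat \<Rightarrow> real)" where
  "proj_K v n xs gn = (THE g. g \<in> cone_K v n xs \<and>
      (\<forall>h\<in>cone_K v n xs. sqdist_fin (sample_max n xs + 1) g gn
                           \<le> sqdist_fin (sample_max n xs + 1) h gn))"

definition T_hat :: "(nat \<Rightarrow> real) \<Rightarrow> nat \<Rightarrow> (nat \<Rightarrow> nat) \<Rightarrow> (nat \<Rightarrow> real) \<Rightarrow> real" where
  "T_hat v n xs gn = sqdist_fin (sample_max n xs + 1) (proj_K v n xs gn) gn"

definition gaussian_vec :: "'a measure \<Rightarrow> ('a \<Rightarrow> nat \<Rightarrow> real) \<Rightarrow> nat \<Rightarrow> (nat \<Rightarrow> nat \<Rightarrow> real) \<Rightarrow> bool" where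
  "gaussian_vec M g m C \<longleftrightarrow>
     (\<forall>i\<le>m. (\<lambda>\<omega>. g \<omega> i) \<in> borel_measurable M) \<and>
     (\<forall>c :: nat \<Rightarrow> real.
        let V = (\<Sum>i=0..m. \<Sum>j=0..m. c i * c j * C i j) in
        (V = 0 \<longrightarrow> (AE \<omega> in M. (\<Sum>i=0..m. c i * g \<omega> i) = 0)) \<and>
        (V \<noteq> 0 \<longrightarrow> distributed M lborel (\<lambda>\<omega>. \<Sum>i=0..m. c i * g \<omega> i)
                        (\<lambda>x. ennreal (normal_density 0 (sqrt V) x))))"

definition cov_n :: "nat \<Rightarrow> (nat \<Rightarrow> nat) \<Rightarrow> nat \<Rightarrow> nat \<Rightarrow> real" where
  "cov_n n xs i j = (if i = j then emp_pmf n xs i else 0) - emp_pmf n xs i * emp_pmf n xs j"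

definition quantile :: "'a measure \<Rightarrow> ('a \<Rightarrow> real) \<Rightarrow> real \<Rightarrow> real" where
  "quantile M Y \<beta> = Inf {t. \<beta> \<le> measure M {\<omega> \<in> space M. Y \<omega> \<le> t}}"

end

theory Submission
  imports Defs "HOL-Real_Asymp.Real_Asymp"
begin

text \<open>Let \<open>s\<close> be the largest point of the support of \<open>p\<^sub>0\<close>, \<open>Z\<close> the set of \<open>x \<in> {1..s}\<close> with
  \<open>\<Delta>p\<^sub>0(x) = 0\<close>, \<open>K\<close> the cone of \<open>g \<in> \<real>\<^sup>s\<^sup>+\<^sup>2\<close> with \<open>\<Delta>g \<ge> 0\<close> on \<open>Z\<close>, and \<open>W\<^sub>n = \<surd>n (p\<^sub>n - p\<^sub>0)\<close>.
  Only one-sided comparisons are needed, and they hold with probability tending to 1: the convex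
  competitor \<open>p\<^sub>0 + n\<^sup>-\<^sup>1\<^sup>/\<^sup>2 \<Pi>\<^sub>K W\<^sub>n\<close> shows that the statistic is at most \<open>dist(W\<^sub>n, K)\<^sup>2\<close>, and
  \<open>\<surd>n v\<^sub>n \<rightarrow> \<infinity>\<close> forces \<open>\<K>\<^sub>n \<subseteq> K\<close>, so that the bootstrap variable is at least \<open>dist(g\<^sub>n, K)\<^sup>2\<close>.
  Both \<open>W\<^sub>n\<close> and \<open>g\<^sub>n\<close> converge in law to the multinomial Gaussian vector \<open>X\<close>; as their second moments
  are bounded, this follows from the convergence of characteristic functions, because a Lipschitz
  function is approximated by a trigonometric sum up to \<open>\<epsilon> (1 + |x|\<^sup>2)\<close>.  Finally \<open>dist(X, K)\<close>
  has no atom in \<open>(0, \<infinity>)\<close>, since \<open>X\<close> has an independent Gaussian component in a direction interior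
  to \<open>K\<close>; if its upper quantile is 0, one uses instead that \<open>X\<close> does not charge the hyperplanes
  \<open>\<Delta>g(x) = 0\<close>, \<open>x \<in> Z\<close>.\<close>

subsection \<open>Approximation of Lipschitz functions by trigonometric sums\<close>

text \<open>The law of the bootstrap vector depends on the sample, so its convergence is not stated
  along n: it is stated along the filter of pairs (n, sample) whose empirical pmf approaches
  \<open>p0\<close>. This yields one radius \<delta> valid for all n, and for the bootstrap the
  randomness of the sample is then handled by Chebyshev's inequality alone. For that reason the
  convergence lemmas below allow an arbitrary filter.

  What they deliver in the end is an upper bound for probabilities of closed sets {a \<le> f}. This
  shapes the final case distinction, because dist(X, K) may have an atom at 0. If its upper quantile
  is positive, a level a > 0 slightly below it is compared with both the bootstrap and the
  statistic. If P(dist(X, K) > 0) \<le> \<alpha>, the critical value is only known to be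
  nonnegative, and rejection implies dist(\<open>W\<^sub>n\<close>, K) > 0, an open event. It is
  enlarged to the closed event that some \<open>\<Delta>W\<^sub>n(x)\<close>, x in Z, is at most 0;
  under X the two differ by a null set.\<close>

inductive trig_fun :: "nat \<Rightarrow> ((nat \<Rightarrow> real) \<Rightarrow> real) \<Rightarrow> bool" for m where
  cos: "trig_fun m (\<lambda>x. cos ((\<Sum>i\<le>m. c i * x i) + b))"
| add: "trig_fun m f \<Longrightarrow> trig_fun m g \<Longrightarrow> trig_fun m (\<lambda>x. f x + g x)"
| scale: "trig_fun m f \<Longrightarrow> trig_fun m (\<lambda>x. a * f x)"

lemma trig_fun_const: "trig_fun m (\<lambda>x. a)"
  using scale[OF cos[of m "\<lambda>_. 0" 0], of a] by simp

lemma trig_fun_sin_coord: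
  assumes "i \<le> m"
  shows "trig_fun m (\<lambda>x. sin (a * x i))"
proof -
  have "trig_fun m (\<lambda>x. cos ((\<Sum>j\<le>m. (if j = i then a else 0) * x j) + (- (pi / 2))))"
    by (rule cos)
  moreover have "(\<Sum>j\<le>m. (if j = i then a else 0) * x j) = a * x i" for x :: "nat \<Rightarrow> real"
    using assms by (simp add: if_distrib[of "\<lambda>t. t * _"] cong: if_cong)
  moreover have "cos (t - pi / 2) = sin t" for t :: real
    by (simp add: cos_diff)
  ultimately show ?thesis
    by simp
qed

text \<open>The product-to-sum formula for two cosines makes the span of the generators an algebra,
  as Stone-Weierstrass requires. The inner induction treats the second factor.\<close>

lemma trig_fun_mult:
  assumes "trig_fun m f" "trig_fun m g"
  shows "trig_fun m (\<lambda>x. f x * g x)"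
  using assms
proof (induction arbitrary: g)
  case (cos c b)
  from cos show ?case
  proof induction
    case (cos c' b')
    have "trig_fun m (\<lambda>x. (1/2) * (cos ((\<Sum>i\<le>m. (c i - c' i) * x i) + (b - b'))
                          + cos ((\<Sum>i\<le>m. (c i + c' i) * x i) + (b + b'))))"
      by (intro trig_fun.intros)
    moreover have "cos ((\<Sum>i\<le>m. c i * x i) + b) * cos ((\<Sum>i\<le>m. c' i * x i) + b')
       = (1/2) * (cos ((\<Sum>i\<le>m. (c i - c' i) * x i) + (b - b'))
                          + cos ((\<Sum>i\<le>m. (c i + c' i) * x i) + (b + b')))" for x
      by (simp add: cos_times_cos left_diff_distrib distrib_right sum.distrib sum_subtractf add_diff_add diff_diff_eq add.assoc add.left_commute)
    ultimately show ?case by presburger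
  next
    case (add f g)
    from trig_fun.add[OF add.IH] show ?case by (simp add: algebra_simps)
  next
    case (scale f a)
    from trig_fun.scale[OF scale.IH] show ?case by (simp add: algebra_simps)
  qed
next
  case (add f1 f2)
  from trig_fun.add[OF add.IH(1)[OF add.prems] add.IH(2)[OF add.prems]] show ?case
    by (simp add: algebra_simps)
next
  case (scale f a)
  from trig_fun.scale[OF scale.IH[OF scale.prems]] show ?case by (simp add: algebra_simps)
qed

lemma trig_fun_bounded:
  assumes "trig_fun m f"
  shows "\<exists>B. \<forall>x. \<bar>f x\<bar> \<le> B"
  using assms
proof induction
  case (cos c b)
  then show ?case by (intro exI[of _ 1]) simp
next
  case (add f g)
  then obtain B C where "\<And>x. \<bar>f x\<bar> \<le> B" "\<And>x. \<bar>g x\<bar> \<le> C" by blast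
  then show ?case
    by (intro exI[of _ "B + C"]) (meson abs_triangle_ineq add_mono order_trans)
next
  case (scale f a)
  then obtain B where "\<And>x. \<bar>f x\<bar> \<le> B" by blast
  then show ?case
    by (intro exI[of _ "\<bar>a\<bar> * B"]) (simp add: abs_mult mult_left_mono)
qed

lemma trig_fun_measurable:
  assumes "trig_fun m f" "\<And>i. i \<le> m \<Longrightarrow> (\<lambda>\<omega>. Y \<omega> i) \<in> borel_measurable N"
  shows "(\<lambda>\<omega>. f (Y \<omega>)) \<in> borel_measurable N"
  using assms(1) by induction (use assms(2) in \<open>measurable, auto\<close>)

lemma trig_fun_integrable:
  assumes "prob_space N" "trig_fun m f" "\<And>i. i \<le> m \<Longrightarrow> (\<lambda>\<omega>. Y \<omega> i) \<in> borel_measurable N"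
  shows "integrable N (\<lambda>\<omega>. f (Y \<omega>))"
proof -
  interpret prob_space N by fact
  obtain B where B: "\<And>x. \<bar>f x\<bar> \<le> B" using trig_fun_bounded[OF assms(2)] by blast
  show ?thesis
    by (rule integrable_const_bound[where B=B]) (use B trig_fun_measurable[OF assms(2,3)] in auto)
qed

text \<open>The hypothesis \<open>lim\<close> is convergence of characteristic functions in real
  form: letting the phase \<open>b\<close> range over all reals covers the real and the imaginary
  part.\<close>

lemma tendsto_expectation_trig_fun:
  assumes N: "eventually (\<lambda>i. prob_space (N i) \<and> (\<forall>k\<le>m. (\<lambda>\<omega>. Y i \<omega> k) \<in> borel_measurable (N i))) F"
    and P: "prob_space P" "\<And>k. k \<le> m \<Longrightarrow> (\<lambda>\<omega>. X \<omega> k) \<in> borel_measurable P"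
    and lim: "\<And>c b. ((\<lambda>i. \<integral>\<omega>. cos ((\<Sum>k\<le>m. c k * Y i \<omega> k) + b) \<partial>N i) \<longlongrightarrow>
                (\<integral>\<omega>. cos ((\<Sum>k\<le>m. c k * X \<omega> k) + b) \<partial>P)) F"
    and f: "trig_fun m f"
  shows "((\<lambda>i. \<integral>\<omega>. f (Y i \<omega>) \<partial>N i) \<longlongrightarrow> (\<integral>\<omega>. f (X \<omega>) \<partial>P)) F"
  using f
proof induction
  case (cos c b)
  show ?case by (rule lim)
next
  case (add f g)
  have "eventually (\<lambda>i. (\<integral>\<omega>. f (Y i \<omega>) \<partial>N i) + (\<integral>\<omega>. g (Y i \<omega>) \<partial>N i) =
        (\<integral>\<omega>. f (Y i \<omega>) + g (Y i \<omega>) \<partial>N i)) F"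
    using N
  proof eventually_elim
    case (elim i)
    then show ?case
      using trig_fun_integrable[OF _ add.hyps(1), of "N i" "Y i"]
        trig_fun_integrable[OF _ add.hyps(2), of "N i" "Y i"]
      by (subst Bochner_Integration.integral_add) auto
  qed
  moreover have "(\<integral>\<omega>. f (X \<omega>) + g (X \<omega>) \<partial>P) = (\<integral>\<omega>. f (X \<omega>) \<partial>P) + (\<integral>\<omega>. g (X \<omega>) \<partial>P)"
    using trig_fun_integrable[OF P(1) add.hyps(1) P(2)] trig_fun_integrable[OF P(1) add.hyps(2) P(2)]
    by (subst Bochner_Integration.integral_add) auto
  ultimately show ?case
    using Lim_transform_eventually[OF tendsto_add[OF add.IH]] by simp
next
  case (scale f a)
  show ?case
    using tendsto_mult_left[OF scale.IH, of a] by simp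
qed

text \<open>Points of R^(m+1) are represented by functions on \<open>nat\<close> of which only the
  coordinates up to \<open>m\<close> count: the bound forces \<open>f\<close> to ignore all
  others.\<close>

definition coord_lipschitz :: "nat \<Rightarrow> real \<Rightarrow> ((nat \<Rightarrow> real) \<Rightarrow> real) \<Rightarrow> bool" where
  "coord_lipschitz m L f \<longleftrightarrow> 0 \<le> L \<and> (\<forall>x y. \<bar>f x - f y\<bar> \<le> L * (\<Sum>i\<le>m. \<bar>x i - y i\<bar>))"

lemma coord_lipschitz_continuous:
  assumes "coord_lipschitz m L f"
  shows "continuous_on UNIV f"
proof -
  have "(f \<longlongrightarrow> f x) (at x)" for x
  proof -
    have "((\<lambda>y. L * (\<Sum>i\<le>m. \<bar>y i - x i\<bar>)) \<longlongrightarrow> L * (\<Sum>i\<le>m. \<bar>x i - x i\<bar>)) (at x)"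
    proof (intro tendsto_intros)
      fix i
      show "((\<lambda>y. y i) \<longlongrightarrow> x i) (at x)"
        using continuous_on_product_coordinates[of i] by (auto simp: continuous_on_def)
    qed
    then have "((\<lambda>y. L * (\<Sum>i\<le>m. \<bar>y i - x i\<bar>)) \<longlongrightarrow> 0) (at x)"
      by simp
    then have "((\<lambda>y. f y - f x) \<longlongrightarrow> 0) (at x)"
      by (rule Lim_null_comparison[rotated])
        (use assms in \<open>auto simp: coord_lipschitz_def intro!: always_eventually\<close>)
    then show ?thesis by (rule LIM_zero_cancel)
  qed
  then show ?thesis by (auto simp: continuous_on_def)
qed

lemma coord_lipschitz_cong:
  assumes "coord_lipschitz m L f" "\<And>i. i \<le> m \<Longrightarrow> x i = y i"
  shows "f x = f y"
proof -
  have "\<bar>f x - f y\<bar> \<le> L * (\<Sum>i\<le>m. \<bar>x i - y i\<bar>)"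
    using assms(1) by (auto simp: coord_lipschitz_def)
  also have "(\<Sum>i\<le>m. \<bar>x i - y i\<bar>) = 0" using assms(2) by (intro sum.neutral) auto
  finally show ?thesis by simp
qed

lemma coord_lipschitz_measurable:
  assumes "coord_lipschitz m L f" "\<And>i. i \<le> m \<Longrightarrow> (\<lambda>\<omega>. Y \<omega> i) \<in> borel_measurable N"
  shows "(\<lambda>\<omega>. f (Y \<omega>)) \<in> borel_measurable N"
proof -
  \<comment> \<open>Nothing is known about the coordinates of \<open>Y\<close> beyond
    \<open>m\<close>; setting them to 0 makes the whole function measurable and leaves the value of
    \<open>f\<close> unchanged.\<close>
  let ?Y = "\<lambda>\<omega> i. if i \<le> m then Y \<omega> i else 0"
  have "?Y \<in> borel_measurable N"
  proof (rule measurable_coordinatewise_then_product)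
    show "(\<lambda>\<omega>. ?Y \<omega> i) \<in> borel_measurable N" for i
      using assms(2)[of i] by (cases "i \<le> m") auto
  qed
  moreover have "f \<in> borel_measurable borel"
    using coord_lipschitz_continuous[OF assms(1)] by (rule borel_measurable_continuous_onI)
  ultimately have "(\<lambda>\<omega>. f (?Y \<omega>)) \<in> borel_measurable N"
    by (rule measurable_compose)
  moreover have "f (?Y \<omega>) = f (Y \<omega>)" for \<omega>
    by (rule coord_lipschitz_cong[OF assms(1)]) simp
  ultimately show ?thesis by simp
qed

lemma coord_lipschitz_uminus:
  "coord_lipschitz m L f \<Longrightarrow> coord_lipschitz m L (\<lambda>x. - f x)"
  unfolding coord_lipschitz_def by (simp add: abs_minus_commute)

text \<open>Tychonoff. Coordinates beyond \<open>m\<close> are pinned to 0 so that the first ones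
  alone separate the points of this set.\<close>

lemma compact_cube: "compact {y :: nat \<Rightarrow> real. \<forall>i. \<bar>y i\<bar> \<le> (if i \<le> m then 1 else 0)}"
proof -
  have "compactin (product_topology (\<lambda>i. euclidean :: real topology) UNIV)
     (PiE UNIV (\<lambda>i::nat. {- (if i \<le> m then 1 else 0) .. (if i \<le> m then 1 else 0)}))"
    unfolding compactin_PiE by auto
  also have "PiE UNIV (\<lambda>i::nat. {- (if i \<le> m then 1 else 0) .. (if i \<le> m then 1 else (0::real))}) =
     {y :: nat \<Rightarrow> real. \<forall>i. \<bar>y i\<bar> \<le> (if i \<le> m then 1 else 0)}"
    by (auto simp: PiE_iff abs_le_iff minus_le_iff split: if_splits)
  finally show ?thesis
    by (simp add: euclidean_product_topology)
qed

text \<open>The substitution \<open>x\<^sub>i \<mapsto> R sin (x\<^sub>i / R)\<close> moves a point by at most \<open>x\<^sub>i\<^sup>2 / R\<close> and turns the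
  polynomials supplied by Stone--Weierstrass on a cube into trigonometric sums that are close on
  the whole space.\<close>
lemma coord_lipschitz_trig_approx:
  assumes f: "coord_lipschitz m L f" and "0 < \<epsilon>"
  shows "\<exists>T. trig_fun m T \<and> (\<forall>x. \<bar>f x - T x\<bar> \<le> \<epsilon> * (1 + (\<Sum>i\<le>m. (x i)\<^sup>2)))"
proof -
  have L: "0 \<le> L" using f by (simp add: coord_lipschitz_def)
  \<comment> \<open>Replacing x by its sine substitute costs at most \<open>L / R\<close> times the
    sum of squares; the \<open>+ 1\<close> keeps \<open>R\<close> positive for
    \<open>L = 0\<close>.\<close>
  define R where "R = (L + 1) / \<epsilon>"
  have R: "R > 0" "L / R \<le> \<epsilon>"
    using L \<open>0 < \<epsilon>\<close> by (auto simp: R_def field_simps)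
  define K where "K = {y :: nat \<Rightarrow> real. \<forall>i. \<bar>y i\<bar> \<le> (if i \<le> m then 1 else 0)}"
  define s where "s x i = (if i \<le> m then sin (x i / R) else 0)" for x i
  define \<A> where "\<A> = {g :: (nat \<Rightarrow> real) \<Rightarrow> real. continuous_on K g \<and> trig_fun m (\<lambda>x. g (s x))}"
  interpret function_ring_on \<A> K
  proof
    show "compact K" unfolding K_def by (rule compact_cube)
    show "\<exists>f\<in>\<A>. f x \<noteq> f y" if xy: "x \<in> K" "y \<in> K" "x \<noteq> y" for x y
    proof -
      obtain i where i: "x i \<noteq> y i" using xy(3) by auto
      have "i \<le> m" using xy(1,2) i unfolding K_def by (metis (mono_tags, lifting) abs_le_zero_iff mem_Collect_eq)
      have "(\<lambda>z. z i) \<in> \<A>"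
        using trig_fun_sin_coord[OF \<open>i \<le> m\<close>, of "1 / R"] \<open>i \<le> m\<close>
        by (auto simp: \<A>_def s_def intro: continuous_on_subset[OF continuous_on_product_coordinates])
      then show ?thesis using i by (intro bexI[of _ "\<lambda>z. z i"])
    qed
  qed (auto simp: \<A>_def intro!: continuous_intros trig_fun.add trig_fun_mult trig_fun_const)
  have "continuous_on K (\<lambda>y. f (\<lambda>i. R * y i))"
    by (intro continuous_on_compose2[OF coord_lipschitz_continuous[OF f]]
        continuous_on_coordinatewise_then_product continuous_intros
        continuous_on_subset[OF continuous_on_product_coordinates]) auto
  from Stone_Weierstrass_basic[OF this \<open>0 < \<epsilon>\<close>] obtain g
    where g: "g \<in> \<A>" "\<And>y. y \<in> K \<Longrightarrow> \<bar>f (\<lambda>i. R * y i) - g y\<bar> < \<epsilon>" by auto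
  have sin_diff: "\<bar>t - R * sin (t / R)\<bar> \<le> t\<^sup>2 / R" for t
  proof -
    have "\<bar>sin (t / R) - t / R\<bar> \<le> inverse (fact 2) * \<bar>t / R\<bar> ^ 2"
      using Maclaurin_sin_bound[of "t / R" 2] by (simp add: numeral_2_eq_2 sin_coeff_def)
    also have "\<dots> \<le> (t / R)\<^sup>2" unfolding power2_abs by (rule mult_left_le_one_le) auto
    finally have "R * \<bar>sin (t / R) - t / R\<bar> \<le> R * (t / R)\<^sup>2" using R by simp
    moreover have "t - R * sin (t / R) = R * (t / R - sin (t / R))"
      using R(1) by (simp add: right_diff_distrib)
    then have "\<bar>t - R * sin (t / R)\<bar> = R * \<bar>sin (t / R) - t / R\<bar>"
      using R(1) by (simp add: abs_mult abs_minus_commute)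
    ultimately show ?thesis using R(1) by (simp add: power2_eq_square)
  qed
  have "\<bar>f x - g (s x)\<bar> \<le> \<epsilon> * (1 + (\<Sum>i\<le>m. (x i)\<^sup>2))" for x
  proof -
    have "s x \<in> K" by (simp add: K_def s_def)
    then have 1: "\<bar>f (\<lambda>i. R * s x i) - g (s x)\<bar> \<le> \<epsilon>" using g(2) by (simp add: less_imp_le)
    have "\<bar>f x - f (\<lambda>i. R * s x i)\<bar> \<le> L * (\<Sum>i\<le>m. \<bar>x i - R * s x i\<bar>)"
      using f by (auto simp: coord_lipschitz_def)
    also have "\<dots> \<le> L * (\<Sum>i\<le>m. (x i)\<^sup>2 / R)"
      by (intro mult_left_mono sum_mono L) (use sin_diff in \<open>auto simp: s_def\<close>)
    also have "\<dots> = L / R * (\<Sum>i\<le>m. (x i)\<^sup>2)" by (simp flip: sum_divide_distrib)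
    also have "\<dots> \<le> \<epsilon> * (\<Sum>i\<le>m. (x i)\<^sup>2)"
      by (intro mult_right_mono R sum_nonneg) auto
    finally show ?thesis using 1 by (simp add: algebra_simps)
  qed
  then show ?thesis using g(1) by (auto simp: \<A>_def)
qed

subsection \<open>Portmanteau inequality along a filter\<close>

text \<open>Since the pointwise error grows only quadratically, second moments control its
  expectation and take the place of a tightness argument.\<close>

lemma expectation_trig_fun_approx:
  assumes "prob_space N"
    and Y: "\<And>k. k \<le> m \<Longrightarrow> (\<lambda>\<omega>. Y \<omega> k) \<in> borel_measurable N"
           "\<And>k. k \<le> m \<Longrightarrow> integrable N (\<lambda>\<omega>. (Y \<omega> k)\<^sup>2)"
    and f: "integrable N (\<lambda>\<omega>. f (Y \<omega>))" and T: "trig_fun m T"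
    and approx: "\<And>x. \<bar>f x - T x\<bar> \<le> \<epsilon> * (1 + (\<Sum>k\<le>m. (x k)\<^sup>2))"
  shows "\<bar>(\<integral>\<omega>. f (Y \<omega>) \<partial>N) - (\<integral>\<omega>. T (Y \<omega>) \<partial>N)\<bar> \<le> \<epsilon> * (1 + (\<Sum>k\<le>m. \<integral>\<omega>. (Y \<omega> k)\<^sup>2 \<partial>N))"
proof -
  interpret prob_space N by fact
  have T': "integrable N (\<lambda>\<omega>. T (Y \<omega>))"
    by (rule trig_fun_integrable[OF assms(1) T]) (rule Y)
  have int: "integrable N (\<lambda>\<omega>. \<epsilon> * (1 + (\<Sum>k\<le>m. (Y \<omega> k)\<^sup>2)))"
    by (intro integrable_mult_right Bochner_Integration.integrable_add Bochner_Integration.integrable_sum) (use Y in auto)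
  have "\<bar>(\<integral>\<omega>. f (Y \<omega>) \<partial>N) - (\<integral>\<omega>. T (Y \<omega>) \<partial>N)\<bar> = \<bar>\<integral>\<omega>. f (Y \<omega>) - T (Y \<omega>) \<partial>N\<bar>"
    using f T' by simp
  also have "\<dots> \<le> (\<integral>\<omega>. \<bar>f (Y \<omega>) - T (Y \<omega>)\<bar> \<partial>N)"
    by (rule integral_abs_bound)
  also have "\<dots> \<le> (\<integral>\<omega>. \<epsilon> * (1 + (\<Sum>k\<le>m. (Y \<omega> k)\<^sup>2)) \<partial>N)"
    by (rule integral_mono) (use f T' int approx in auto)
  also have "\<dots> = \<epsilon> * (1 + (\<Sum>k\<le>m. \<integral>\<omega>. (Y \<omega> k)\<^sup>2 \<partial>N))"
    using Y by (subst integral_mult_right_zero, subst Bochner_Integration.integral_add)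
      (auto simp: prob_space)
  finally show ?thesis .
qed

text \<open>Continuity from above: the closed sets {a - e \<le> \<phi>} decrease to {a \<le> \<phi>}
  as e tends to 0.\<close>

lemma (in prob_space) prob_superlevel_right_approx:
  fixes \<phi> :: "'a \<Rightarrow> real"
  assumes [measurable]: "\<phi> \<in> borel_measurable M" and "0 < \<eta>"
  shows "\<exists>e>0. prob {\<omega> \<in> space M. a - e \<le> \<phi> \<omega>} \<le> prob {\<omega> \<in> space M. a \<le> \<phi> \<omega>} + \<eta>"
proof -
  define A where "A n = {\<omega> \<in> space M. a - inverse (real (Suc n)) \<le> \<phi> \<omega>}" for n
  have "(\<lambda>n. prob (A n)) \<longlonglongrightarrow> prob (\<Inter>n. A n)"
  proof (rule finite_Lim_measure_decseq)
    show "range A \<subseteq> events" by (auto simp: A_def)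
    show "decseq A"
    proof (intro decseq_SucI subsetI)
      fix n x assume x: "x \<in> A (Suc n)"
      then have "a - inverse (real (Suc (Suc n))) \<le> \<phi> x" by (simp add: A_def)
      moreover have "inverse (real (Suc (Suc n))) \<le> inverse (real (Suc n))"
        by (intro le_imp_inverse_le) auto
      ultimately have "a - inverse (real (Suc n)) \<le> \<phi> x" by linarith
      with x show "x \<in> A n" by (simp add: A_def del: of_nat_Suc)
    qed
  qed
  also have "(\<Inter>n. A n) = {\<omega> \<in> space M. a \<le> \<phi> \<omega>}"
  proof safe
    fix \<omega> assume \<omega>: "\<omega> \<in> (\<Inter>n. A n)"
    show "a \<le> \<phi> \<omega>"
    proof (rule LIMSEQ_le_const2)
      have "(\<lambda>n. a - inverse (real (Suc n))) \<longlonglongrightarrow> a - 0"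
        by (intro tendsto_intros LIMSEQ_inverse_real_of_nat)
      then show "(\<lambda>n. a - inverse (real (Suc n))) \<longlonglongrightarrow> a" by simp
      show "\<exists>N. \<forall>n\<ge>N. a - inverse (real (Suc n)) \<le> \<phi> \<omega>"
        using \<omega> by (auto simp: A_def simp del: of_nat_Suc)
    qed
    show "\<omega> \<in> space M" using \<omega> by (auto simp: A_def)
  next
    fix \<omega> n assume "\<omega> \<in> space M" "a \<le> \<phi> \<omega>"
    then show "\<omega> \<in> A n" by (auto simp: A_def simp del: of_nat_Suc intro: order_trans[of _ a])
  qed
  finally have "eventually (\<lambda>n. prob (A n) < prob {\<omega> \<in> space M. a \<le> \<phi> \<omega>} + \<eta>) sequentially"
    using \<open>0 < \<eta>\<close> by (intro order_tendstoD) auto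
  then obtain n where "prob (A n) < prob {\<omega> \<in> space M. a \<le> \<phi> \<omega>} + \<eta>"
    by (auto simp: eventually_sequentially)
  then show ?thesis
    by (intro exI[of _ "inverse (real (Suc n))"]) (simp add: A_def)
qed

text \<open>A Lipschitz ramp \<open>f\<close> lies between the indicators of {a \<le> \<psi>} and {a
  - e \<le> \<psi>} and is approximated by a trigonometric sum \<open>T\<close>. The error \<eta> is
  split into quarters: enlarging the set, approximating \<open>f\<close> under \<open>P\<close>,
  approximating it under \<open>N i\<close>, and convergence of the expectations of
  \<open>T\<close>.\<close>

lemma eventually_prob_superlevel_le:
  assumes N: "eventually (\<lambda>i. prob_space (N i) \<and>
      (\<forall>k\<le>m. (\<lambda>\<omega>. Y i \<omega> k) \<in> borel_measurable (N i) \<and>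
             integrable (N i) (\<lambda>\<omega>. (Y i \<omega> k)\<^sup>2) \<and> (\<integral>\<omega>. (Y i \<omega> k)\<^sup>2 \<partial>N i) \<le> C)) F"
    and P: "prob_space P" "\<And>k. k \<le> m \<Longrightarrow> (\<lambda>\<omega>. X \<omega> k) \<in> borel_measurable P"
      "\<And>k. k \<le> m \<Longrightarrow> integrable P (\<lambda>\<omega>. (X \<omega> k)\<^sup>2)"
    and lim: "\<And>c b. ((\<lambda>i. \<integral>\<omega>. cos ((\<Sum>k\<le>m. c k * Y i \<omega> k) + b) \<partial>N i) \<longlongrightarrow>
                (\<integral>\<omega>. cos ((\<Sum>k\<le>m. c k * X \<omega> k) + b) \<partial>P)) F"
    and \<psi>: "coord_lipschitz m L \<psi>" and "0 < \<eta>"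
  shows "eventually (\<lambda>i. measure (N i) {\<omega> \<in> space (N i). a \<le> \<psi> (Y i \<omega>)} \<le>
             measure P {\<omega> \<in> space P. a \<le> \<psi> (X \<omega>)} + \<eta>) F"
proof -
  interpret P: prob_space P by fact
  have \<psi>X [measurable]: "(\<lambda>\<omega>. \<psi> (X \<omega>)) \<in> borel_measurable P"
    by (rule coord_lipschitz_measurable[OF \<psi>]) (rule P)
  obtain e where e: "e > 0" "P.prob {\<omega> \<in> space P. a - e \<le> \<psi> (X \<omega>)} \<le>
      P.prob {\<omega> \<in> space P. a \<le> \<psi> (X \<omega>)} + \<eta> / 4"
    using P.prob_superlevel_right_approx[OF \<psi>X, of "\<eta> / 4" a] \<open>0 < \<eta>\<close> by auto
  define f where "f x = max 0 (min 1 ((\<psi> x - a) / e + 1))" for x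
  have f: "coord_lipschitz m (L / e) f"
    unfolding coord_lipschitz_def
  proof (intro conjI allI)
    show "0 \<le> L / e" using \<psi> e by (simp add: coord_lipschitz_def)
    fix x y
    have "\<bar>f x - f y\<bar> \<le> \<bar>(\<psi> x - a) / e - (\<psi> y - a) / e\<bar>"
      unfolding f_def by linarith
    also have "\<dots> = \<bar>\<psi> x - \<psi> y\<bar> / e" using e(1) by (simp flip: diff_divide_distrib)
    also have "\<dots> \<le> L * (\<Sum>i\<le>m. \<bar>x i - y i\<bar>) / e"
      using \<psi> e(1) by (intro divide_right_mono) (auto simp: coord_lipschitz_def)
    finally show "\<bar>f x - f y\<bar> \<le> L / e * (\<Sum>i\<le>m. \<bar>x i - y i\<bar>)" by simp
  qed
  have f01: "0 \<le> f x" "f x \<le> 1" for x by (auto simp: f_def)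
  have f_hi: "f x \<le> indicator {y. a - e \<le> \<psi> y} x" for x
    using e(1) f01(2)[of x] by (auto simp: f_def indicator_def field_simps)
  have f_lo: "indicator {y. a \<le> \<psi> y} x \<le> f x" for x
    using e(1) by (auto simp: f_def indicator_def field_simps)
  \<comment> \<open>\<open>D\<close> dominates 1 plus the sum of the second moments under
    \<open>P\<close> and under each relevant \<open>N i\<close>; the absolute value keeps it
    positive whatever the sign of \<open>C\<close>.\<close>
  define D where "D = 1 + \<bar>real (Suc m) * C\<bar> + (\<Sum>k\<le>m. \<integral>\<omega>. (X \<omega> k)\<^sup>2 \<partial>P)"
  have Xnn: "0 \<le> (\<Sum>k\<le>m. \<integral>\<omega>. (X \<omega> k)\<^sup>2 \<partial>P)" by (intro sum_nonneg) auto
  have D: "D > 0" using Xnn by (simp add: D_def)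
  define \<epsilon> where "\<epsilon> = \<eta> / (4 * D)"
  have \<epsilon>: "\<epsilon> > 0" "\<epsilon> * D = \<eta> / 4" using D \<open>0 < \<eta>\<close> by (auto simp: \<epsilon>_def)
  obtain T where T: "trig_fun m T" "\<And>x. \<bar>f x - T x\<bar> \<le> \<epsilon> * (1 + (\<Sum>k\<le>m. (x k)\<^sup>2))"
    using coord_lipschitz_trig_approx[OF f \<epsilon>(1)] by auto
  have fi: "integrable Q (\<lambda>\<omega>. f (Z \<omega>))" 
    if "prob_space Q" "\<And>k. k \<le> m \<Longrightarrow> (\<lambda>\<omega>. Z \<omega> k) \<in> borel_measurable Q" for Q and Z :: "'z \<Rightarrow> nat \<Rightarrow> real"
  proof -
    interpret Q: prob_space Q by fact
    show ?thesis
      by (rule Q.integrable_const_bound[where B=1]) 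
        (use f01 coord_lipschitz_measurable[OF f that(2)] in auto)
  qed
  note fiP = fi[OF P(1), of X, OF P(2)]
  have EX: "\<bar>(\<integral>\<omega>. f (X \<omega>) \<partial>P) - (\<integral>\<omega>. T (X \<omega>) \<partial>P)\<bar> \<le> \<eta> / 4"
  proof -
    have "\<bar>(\<integral>\<omega>. f (X \<omega>) \<partial>P) - (\<integral>\<omega>. T (X \<omega>) \<partial>P)\<bar> \<le> \<epsilon> * (1 + (\<Sum>k\<le>m. \<integral>\<omega>. (X \<omega> k)\<^sup>2 \<partial>P))"
      by (rule expectation_trig_fun_approx) (use P T fiP in auto)
    also have "\<dots> \<le> \<epsilon> * D" by (intro mult_left_mono) (use \<epsilon> in \<open>auto simp: D_def\<close>)
    finally show ?thesis using \<epsilon> by simp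
  qed
  have "(\<integral>\<omega>. f (X \<omega>) \<partial>P) \<le> (\<integral>\<omega>. indicator {\<omega> \<in> space P. a - e \<le> \<psi> (X \<omega>)} \<omega> \<partial>P)"
  proof (rule integral_mono)
    show "integrable P (indicat_real {\<omega> \<in> space P. a - e \<le> \<psi> (X \<omega>)})"
      by (rule P.integrable_const_bound[where B=1]) auto
  qed (use fiP f_hi in \<open>auto simp: indicator_def split: if_splits\<close>)
  then have hi: "(\<integral>\<omega>. f (X \<omega>) \<partial>P) \<le> P.prob {\<omega> \<in> space P. a - e \<le> \<psi> (X \<omega>)}" by simp
  have "((\<lambda>i. \<integral>\<omega>. T (Y i \<omega>) \<partial>N i) \<longlongrightarrow> (\<integral>\<omega>. T (X \<omega>) \<partial>P)) F"
    by (rule tendsto_expectation_trig_fun[OF _ P(1,2) lim T(1)])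
      (use N in \<open>auto elim: eventually_mono\<close>)
  then have "eventually (\<lambda>i. (\<integral>\<omega>. T (Y i \<omega>) \<partial>N i) < (\<integral>\<omega>. T (X \<omega>) \<partial>P) + \<eta> / 4) F"
    using \<open>0 < \<eta>\<close> by (intro order_tendstoD) auto
  with N show ?thesis
  proof eventually_elim
    case (elim i)
    then interpret Ni: prob_space "N i" by blast
    have Yi: "(\<lambda>\<omega>. Y i \<omega> k) \<in> borel_measurable (N i)" "integrable (N i) (\<lambda>\<omega>. (Y i \<omega> k)\<^sup>2)"
      "(\<integral>\<omega>. (Y i \<omega> k)\<^sup>2 \<partial>N i) \<le> C" if "k \<le> m" for k using elim(1) that by auto
    have [measurable]: "(\<lambda>\<omega>. \<psi> (Y i \<omega>)) \<in> borel_measurable (N i)"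
      by (rule coord_lipschitz_measurable[OF \<psi>]) (rule Yi)
    have fiN: "integrable (N i) (\<lambda>\<omega>. f (Y i \<omega>))"
      by (rule fi) (use Yi Ni.prob_space_axioms in auto)
    have "(\<integral>\<omega>. indicator {\<omega> \<in> space (N i). a \<le> \<psi> (Y i \<omega>)} \<omega> \<partial>N i) \<le> (\<integral>\<omega>. f (Y i \<omega>) \<partial>N i)"
    proof (rule integral_mono)
      show "integrable (N i) (indicat_real {\<omega> \<in> space (N i). a \<le> \<psi> (Y i \<omega>)})"
        by (rule Ni.integrable_const_bound[where B=1]) auto
    qed (use fiN f_lo f01 in \<open>auto simp: indicator_def split: if_splits\<close>)
    then have lo: "Ni.prob {\<omega> \<in> space (N i). a \<le> \<psi> (Y i \<omega>)} \<le> (\<integral>\<omega>. f (Y i \<omega>) \<partial>N i)" by simp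
    have "\<bar>(\<integral>\<omega>. f (Y i \<omega>) \<partial>N i) - (\<integral>\<omega>. T (Y i \<omega>) \<partial>N i)\<bar>
        \<le> \<epsilon> * (1 + (\<Sum>k\<le>m. \<integral>\<omega>. (Y i \<omega> k)\<^sup>2 \<partial>N i))"
      by (rule expectation_trig_fun_approx) (use Yi T fiN Ni.prob_space_axioms in auto)
    also have "\<dots> \<le> \<epsilon> * (1 + (\<Sum>k\<le>m. C))"
      by (intro mult_left_mono add_left_mono sum_mono Yi) (use \<epsilon> in auto)
    also have "\<dots> \<le> \<epsilon> * D" by (intro mult_left_mono) (use \<epsilon> Xnn in \<open>auto simp: D_def\<close>)
    finally have "\<bar>(\<integral>\<omega>. f (Y i \<omega>) \<partial>N i) - (\<integral>\<omega>. T (Y i \<omega>) \<partial>N i)\<bar> \<le> \<eta> / 4" using \<epsilon> by simp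
    then show ?case using EX hi lo elim(2) e(2) by linarith
  qed
qed

subsection \<open>Gaussian vectors\<close>

lemma expectation_cos_std_normal:
  "(\<integral>x. cos (b + t * x) \<partial>std_normal_distribution) = cos b * exp (- t\<^sup>2 / 2)"
proof -
  interpret real_distribution std_normal_distribution by (rule real_dist_normal_dist)
  have i1: "integrable std_normal_distribution (\<lambda>x. cos (t * x))"
    by (rule integrable_const_bound[where B=1]) auto
  have i2: "integrable std_normal_distribution (\<lambda>x. sin (t * x))"
    by (rule integrable_const_bound[where B=1]) auto
  have i: "integrable std_normal_distribution (\<lambda>x. iexp (t * x))"
    by (rule integrable_const_bound[where B=1]) auto
  have ch: "(CLINT x|std_normal_distribution. iexp (t * x)) = complex_of_real (exp (- (t\<^sup>2) / 2))"
    using fun_cong[OF char_std_normal_distribution, of t] by (simp only: char_def)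
  have "(\<integral>x. cos (t * x) \<partial>std_normal_distribution) = Re (CLINT x|std_normal_distribution. iexp (t * x))"
    using integral_Re[OF i] by (simp add: Re_exp)
  then have c: "(\<integral>x. cos (t * x) \<partial>std_normal_distribution) = exp (- t\<^sup>2 / 2)"
    unfolding ch by simp
  have "(\<integral>x. sin (t * x) \<partial>std_normal_distribution) = Im (CLINT x|std_normal_distribution. iexp (t * x))"
    using integral_Im[OF i] by (simp add: Im_exp)
  then have s: "(\<integral>x. sin (t * x) \<partial>std_normal_distribution) = 0"
    unfolding ch by simp
  have "(\<integral>x. cos (b + t * x) \<partial>std_normal_distribution) =
     (\<integral>x. cos b * cos (t * x) - sin b * sin (t * x) \<partial>std_normal_distribution)"
    by (simp add: cos_add)
  also have "\<dots> = cos b * exp (- t\<^sup>2 / 2)"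
    using i1 i2 by (subst Bochner_Integration.integral_diff) (auto simp: c s)
  finally show ?thesis .
qed

lemma std_normal_square:
  "integrable std_normal_distribution (\<lambda>x. x\<^sup>2)" "(\<integral>x. x\<^sup>2 \<partial>std_normal_distribution) = 1"
proof -
  have *: "has_bochner_integral lborel (\<lambda>x. std_normal_density x * x\<^sup>2) 1"
    using std_normal_moment_even[of 1] by (simp add: fact_2)
  show "integrable std_normal_distribution (\<lambda>x. x\<^sup>2)" "(\<integral>x. x\<^sup>2 \<partial>std_normal_distribution) = 1"
    using * by (auto simp: integrable_density integral_density has_bochner_integral_iff)
qed

lemma centered_normal_cos_and_square:
  assumes "prob_space M" and Y [measurable]: "Y \<in> borel_measurable M" and "0 \<le> V"
    and V0: "V = 0 \<Longrightarrow> AE \<omega> in M. Y \<omega> = 0"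
    and Vpos: "V \<noteq> 0 \<Longrightarrow> distributed M lborel Y (\<lambda>x. ennreal (normal_density 0 (sqrt V) x))"
  shows "(\<integral>\<omega>. cos (Y \<omega> + b) \<partial>M) = cos b * exp (- V / 2)"
    and "integrable M (\<lambda>\<omega>. (Y \<omega>)\<^sup>2)" and "(\<integral>\<omega>. (Y \<omega>)\<^sup>2 \<partial>M) = V"
proof -
  interpret prob_space M by fact
  have "(\<integral>\<omega>. cos (Y \<omega> + b) \<partial>M) = cos b * exp (- V / 2) \<and>
      integrable M (\<lambda>\<omega>. (Y \<omega>)\<^sup>2) \<and> (\<integral>\<omega>. (Y \<omega>)\<^sup>2 \<partial>M) = V"
  proof (cases "V = 0")
    case True
    note ae = V0[OF True]
    have "(\<integral>\<omega>. cos (Y \<omega> + b) \<partial>M) = (\<integral>\<omega>. cos b \<partial>M)"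
      by (rule integral_cong_AE) (use ae in auto)
    moreover have "integrable M (\<lambda>\<omega>. (Y \<omega>)\<^sup>2) \<longleftrightarrow> integrable M (\<lambda>\<omega>. 0 :: real)"
      by (rule integrable_cong_AE) (use ae in auto)
    moreover have "(\<integral>\<omega>. (Y \<omega>)\<^sup>2 \<partial>M) = (\<integral>\<omega>. 0 \<partial>M)"
      by (rule integral_cong_AE) (use ae in auto)
    ultimately show ?thesis by (simp add: True prob_space)
  next
    case False
    define \<sigma> where "\<sigma> = sqrt V"
    have \<sigma>: "\<sigma> > 0" "\<sigma>\<^sup>2 = V" using False \<open>0 \<le> V\<close> by (auto simp: \<sigma>_def)
    have "distributed M lborel (\<lambda>\<omega>. (Y \<omega> - 0) / \<sigma>) (\<lambda>x. ennreal (std_normal_density x))"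
      using Vpos[OF False] \<sigma>(1) normal_standard_normal_convert[of \<sigma> Y 0] by (simp add: \<sigma>_def)
    then have d: "distr M lborel (\<lambda>\<omega>. Y \<omega> / \<sigma>) = std_normal_distribution"
      by (simp add: distributed_distr_eq_density)
    have [measurable]: "(\<lambda>\<omega>. Y \<omega> / \<sigma>) \<in> measurable M lborel" by simp
    have "(\<integral>x. cos (b + \<sigma> * x) \<partial>std_normal_distribution) = (\<integral>\<omega>. cos (b + \<sigma> * (Y \<omega> / \<sigma>)) \<partial>M)"
      unfolding d[symmetric] by (subst integral_distr) auto
    then have 1: "(\<integral>\<omega>. cos (Y \<omega> + b) \<partial>M) = cos b * exp (- V / 2)"
      using \<sigma> by (simp add: expectation_cos_std_normal add.commute)
    have "integrable M (\<lambda>\<omega>. (Y \<omega> / \<sigma>)\<^sup>2)"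
      using std_normal_square(1) unfolding d[symmetric] by (subst (asm) integrable_distr_eq) auto
    then have "integrable M (\<lambda>\<omega>. \<sigma>\<^sup>2 * (Y \<omega> / \<sigma>)\<^sup>2)" by (rule integrable_mult_right)
    then have 2: "integrable M (\<lambda>\<omega>. (Y \<omega>)\<^sup>2)"
      using \<sigma>(1) by (simp add: power_divide)
    have "(\<integral>\<omega>. (Y \<omega> / \<sigma>)\<^sup>2 \<partial>M) = 1"
      using std_normal_square(2) unfolding d[symmetric] by (subst (asm) integral_distr) auto
    then have "(\<integral>\<omega>. (Y \<omega>)\<^sup>2 \<partial>M) = V"
      using \<sigma> by (simp add: power_divide)
    with 1 2 show ?thesis by simp
  qed
  then show "(\<integral>\<omega>. cos (Y \<omega> + b) \<partial>M) = cos b * exp (- V / 2)"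
    "integrable M (\<lambda>\<omega>. (Y \<omega>)\<^sup>2)" "(\<integral>\<omega>. (Y \<omega>)\<^sup>2 \<partial>M) = V" by auto
qed

text \<open>The law of x + \<xi> a with x of law \<open>N\<close> and \<xi> an independent standard
  normal variable. Iterated, it builds Gaussian laws; applied last, it leaves a component along
  \<open>a\<close> that can be integrated out alone, which shows that sets are null.\<close>

definition gauss_shift :: "(nat \<Rightarrow> real) measure \<Rightarrow> (nat \<Rightarrow> real) \<Rightarrow> (nat \<Rightarrow> real) measure" where
  "gauss_shift N a = distr (N \<Otimes>\<^sub>M std_normal_distribution) borel (\<lambda>(x, \<xi>) k. x k + \<xi> * a k)"

lemma gauss_shift_measurable:
  fixes N :: "(nat \<Rightarrow> real) measure"
  assumes [measurable_cong]: "sets N = sets borel"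
  shows "(\<lambda>(x, \<xi>) k. x k + \<xi> * a k) \<in> borel_measurable (N \<Otimes>\<^sub>M std_normal_distribution)"
proof (rule measurable_coordinatewise_then_product)
  fix k
  have [measurable]: "(\<lambda>x. x k) \<in> borel_measurable N"
    using measurable_product_coordinates[of k] assms by (simp cong: measurable_cong_sets)
  show "(\<lambda>z. (case z of (x, \<xi>) \<Rightarrow> \<lambda>k. x k + \<xi> * a k) k) \<in> borel_measurable (N \<Otimes>\<^sub>M std_normal_distribution)"
    by (simp add: case_prod_beta)
qed

context
  fixes N :: "(nat \<Rightarrow> real) measure"
  assumes N: "prob_space N" "sets N = sets borel"
begin

interpretation N: prob_space N by (rule N)
interpretation S: real_distribution std_normal_distribution by (rule real_dist_normal_dist)
interpretation P: pair_prob_space N std_normal_distribution ..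

lemma coord_measurable_borel_fun: "(\<lambda>x. x k) \<in> borel_measurable N"
  using measurable_product_coordinates[of k] N(2) by (simp cong: measurable_cong_sets)

lemma prob_space_gauss_shift: "prob_space (gauss_shift N a)"
  unfolding gauss_shift_def by (rule P.prob_space_distr[OF gauss_shift_measurable[OF N(2)]])

lemma sets_gauss_shift: "sets (gauss_shift N a) = sets borel"
  by (simp add: gauss_shift_def)

lemma gauss_shift_square_integrable:
  assumes "\<And>k. integrable N (\<lambda>x. (x k)\<^sup>2)"
  shows "integrable (gauss_shift N a) (\<lambda>x. (x k)\<^sup>2)"
proof -
  note [measurable] = coord_measurable_borel_fun
  have U: "emeasure std_normal_distribution UNIV = 1"
    using S.emeasure_space_1 by simp
  have 1: "integrable (N \<Otimes>\<^sub>M std_normal_distribution) (\<lambda>z. (fst z k)\<^sup>2)"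
    using assms[of k]
    by (subst integrable_iff_bounded) (auto simp: integrable_iff_bounded S.nn_integral_fst[symmetric] U)
  have 2: "integrable (N \<Otimes>\<^sub>M std_normal_distribution) (\<lambda>z. (snd z)\<^sup>2)"
    using std_normal_square(1)
    by (subst integrable_iff_bounded) (auto simp: integrable_iff_bounded P.nn_integral_snd[symmetric] N.emeasure_space_1)
  have "integrable (N \<Otimes>\<^sub>M std_normal_distribution) (\<lambda>z. (fst z k + snd z * a k)\<^sup>2)"
  proof (rule Bochner_Integration.integrable_bound)
    show "integrable (N \<Otimes>\<^sub>M std_normal_distribution) (\<lambda>z. 2 * (fst z k)\<^sup>2 + 2 * (a k)\<^sup>2 * (snd z)\<^sup>2)"
      using 1 2 by auto
    have "(x + \<xi> * t)\<^sup>2 \<le> 2 * x\<^sup>2 + 2 * t\<^sup>2 * \<xi>\<^sup>2" for x \<xi> t :: real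
      using zero_le_power2[of "x - \<xi> * t"] by (simp add: power2_eq_square algebra_simps)
    then show "AE z in N \<Otimes>\<^sub>M std_normal_distribution. norm ((fst z k + snd z * a k)\<^sup>2) \<le>
       norm (2 * (fst z k)\<^sup>2 + 2 * (a k)\<^sup>2 * (snd z)\<^sup>2)"
      by (intro AE_I2) (auto intro: order_trans)
  qed auto
  then show ?thesis
    unfolding gauss_shift_def
    by (subst integrable_distr_eq[OF gauss_shift_measurable[OF N(2)]])
      (auto simp: case_prod_beta intro!: borel_measurable_power measurable_product_coordinates)
qed

text \<open>By Fubini, fixing \<xi> turns the shift into a change of phase. The assumed form
  \<open>cos b * E\<close> says that the characteristic function of \<open>N\<close> at
  \<open>c\<close> is the real number \<open>E\<close>.\<close>

lemma gauss_shift_cos: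
  assumes cos: "\<And>b. (\<integral>x. cos ((\<Sum>k\<le>m. c k * x k) + b) \<partial>N) = cos b * E"
  shows "(\<integral>x. cos ((\<Sum>k\<le>m. c k * x k) + b) \<partial>gauss_shift N a) =
     cos b * (E * exp (- (\<Sum>k\<le>m. c k * a k)\<^sup>2 / 2))"
proof -
  note [measurable] = coord_measurable_borel_fun
  let ?t = "\<Sum>k\<le>m. c k * a k"
  have [measurable]: "(\<lambda>x. cos ((\<Sum>k\<le>m. c k * x k) + b)) \<in> borel_measurable (borel :: (nat \<Rightarrow> real) measure)"
    by (measurable; rule measurable_product_coordinates)
  have "(\<integral>x. cos ((\<Sum>k\<le>m. c k * x k) + b) \<partial>gauss_shift N a) =
    (\<integral>z. cos ((\<Sum>k\<le>m. c k * fst z k) + (b + ?t * snd z)) \<partial>(N \<Otimes>\<^sub>M std_normal_distribution))"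
    unfolding gauss_shift_def
    by (subst integral_distr[OF gauss_shift_measurable[OF N(2)]])
      (auto simp: case_prod_beta sum.distrib algebra_simps sum_distrib_left intro!: Bochner_Integration.integral_cong)
  also have "\<dots> = (\<integral>\<xi>. \<integral>x. cos ((\<Sum>k\<le>m. c k * x k) + (b + ?t * \<xi>)) \<partial>N \<partial>std_normal_distribution)"
  proof -
    have "integrable (N \<Otimes>\<^sub>M std_normal_distribution)
       (\<lambda>(x, \<xi>). cos ((\<Sum>k\<le>m. c k * x k) + (b + ?t * \<xi>)))"
      by (rule P.integrable_const_bound[where B=1]) (auto simp: case_prod_beta)
    from P.integral_snd[OF this] show ?thesis by (simp add: case_prod_beta')
  qed
  also have "\<dots> = (\<integral>\<xi>. cos (b + ?t * \<xi>) * E \<partial>std_normal_distribution)"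
    by (simp add: cos)
  also have "\<dots> = cos b * (E * exp (- ?t\<^sup>2 / 2))"
    by (simp add: expectation_cos_std_normal)
  finally show ?thesis .
qed

text \<open>Every line in direction \<open>a\<close> meets \<open>B\<close> for finitely many
  parameters only, a null set for the normal density, so Fubini applies.\<close>

lemma gauss_shift_null:
  assumes B: "B \<in> sets borel" and fin: "\<And>x. finite {\<xi>. (\<lambda>k. x k + \<xi> * a k) \<in> B}"
  shows "measure (gauss_shift N a) B = 0"
proof -
  let ?h = "\<lambda>(x, \<xi>) k. x k + \<xi> * a k"
  let ?Z = "?h -` B \<inter> space (N \<Otimes>\<^sub>M std_normal_distribution)"
  have Z: "?Z \<in> sets (N \<Otimes>\<^sub>M std_normal_distribution)"
    using gauss_shift_measurable[OF N(2)] B by (rule measurable_sets)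
  have "emeasure (gauss_shift N a) B = emeasure (N \<Otimes>\<^sub>M std_normal_distribution) ?Z"
    unfolding gauss_shift_def by (rule emeasure_distr[OF gauss_shift_measurable[OF N(2)] B])
  also have "\<dots> = (\<integral>\<^sup>+x. emeasure std_normal_distribution (Pair x -` ?Z) \<partial>N)"
    by (rule S.emeasure_pair_measure_alt[OF Z])
  also have "\<dots> = (\<integral>\<^sup>+x. 0 \<partial>N)"
  proof (rule nn_integral_cong)
    fix x
    have f: "finite (Pair x -` ?Z)"
      by (rule finite_subset[OF _ fin[of x]]) auto
    then have "Pair x -` ?Z \<in> null_sets lborel"
      by (rule finite_imp_null_set_lborel)
    then show "emeasure std_normal_distribution (Pair x -` ?Z) = 0"
      by (subst emeasure_density) (auto intro!: nn_integral_null_set simp: null_sets_def)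
  qed
  finally show ?thesis by (simp add: measure_def)
qed

end

text \<open>Starting from the unit mass at 0, each \<open>gauss_shift\<close> adds one square to the
  variance: the vectors \<open>a j\<close> are the columns of a square root of the covariance
  matrix.\<close>

lemma gaussian_measure_exists:
  fixes a :: "nat \<Rightarrow> nat \<Rightarrow> real"
  shows "\<exists>N :: (nat \<Rightarrow> real) measure. prob_space N \<and> sets N = sets borel \<and>
    (\<forall>k. integrable N (\<lambda>x. (x k)\<^sup>2)) \<and>
    (\<forall>c b. (\<integral>x. cos ((\<Sum>k\<le>m. c k * x k) + b) \<partial>N) =
       cos b * exp (- (\<Sum>j<d. (\<Sum>k\<le>m. c k * a j k)\<^sup>2) / 2))"
proof (induction d)
  case 0
  have "prob_space (return borel (\<lambda>_. 0 :: real) :: (nat \<Rightarrow> real) measure)"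
    by (rule prob_space_return) simp
  then interpret R: prob_space "return borel (\<lambda>_. 0 :: real) :: (nat \<Rightarrow> real) measure" .
  note [measurable] = measurable_product_coordinates
  have "integrable (return borel (\<lambda>_. 0 :: real) :: (nat \<Rightarrow> real) measure) (\<lambda>x. (x k)\<^sup>2)" for k
    by (rule R.integrable_const_bound[where B=0]) (auto simp: AE_return)
  then show ?case
    by (intro exI[of _ "return borel (\<lambda>_. 0)"])
      (auto simp: integral_return R.prob_space_axioms)
next
  case (Suc d)
  then obtain N :: "(nat \<Rightarrow> real) measure" where N: "prob_space N" "sets N = sets borel"
    "\<And>k. integrable N (\<lambda>x. (x k)\<^sup>2)"
    "\<And>c b. (\<integral>x. cos ((\<Sum>k\<le>m. c k * x k) + b) \<partial>N) =
       cos b * exp (- (\<Sum>j<d. (\<Sum>k\<le>m. c k * a j k)\<^sup>2) / 2)" by blast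
  show ?case
    by (intro exI[of _ "gauss_shift N (a d)"] conjI allI prob_space_gauss_shift N sets_gauss_shift
      gauss_shift_square_integrable)
      (subst gauss_shift_cos[OF N(1,2,4)], simp flip: exp_add add: add_divide_distrib)
qed

subsection \<open>Central limit theorem for the empirical frequencies\<close>

lemma sum_emp_pmf:
  "(\<Sum>k\<le>m. c k * emp_pmf n xs k) = (\<Sum>i<n. if xs i \<le> m then c (xs i) else 0) / real n"
proof -
  have card: "real (card {i. i < n \<and> xs i = k}) = (\<Sum>i<n. if xs i = k then 1 else 0)" for k
  proof -
    have "{i. i < n \<and> xs i = k} = {i \<in> {..<n}. xs i = k}" by auto
    then show ?thesis by (simp flip: sum.inter_filter)
  qed
  have "(\<Sum>k\<le>m. c k * emp_pmf n xs k) = (\<Sum>k\<le>m. \<Sum>i<n. if xs i = k then c k else 0) / real n"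
    by (simp add: emp_pmf_def card sum_divide_distrib sum_distrib_left if_distrib[of "\<lambda>t. _ * t"] cong: if_cong)
  also have "(\<Sum>k\<le>m. \<Sum>i<n. if xs i = k then c k else 0) = (\<Sum>i<n. \<Sum>k\<le>m. if xs i = k then c k else 0)"
    by (rule sum.swap)
  also have "\<dots> = (\<Sum>i<n. if xs i \<le> m then c (xs i) else 0)"
    by (intro sum.cong) (auto simp: sum.delta')
  finally show ?thesis .
qed

text \<open>A linear functional of the scaled empirical pmf is a normalized i.i.d. sum, so that the
  one-dimensional limit theorem covers the vector (Cramer-Wold).\<close>

lemma sum_scaled_emp_pmf:
  assumes "n > 0"
  shows "(\<Sum>k\<le>m. c k * (sqrt (real n) * (emp_pmf n xs k - q k))) =
    1 / sqrt (real n) * (\<Sum>i<n. (if xs i \<le> m then c (xs i) else 0) - (\<Sum>k\<le>m. c k * q k))"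
proof -
  let ?A = "\<Sum>i<n. (if xs i \<le> m then c (xs i) else 0)" and ?q = "\<Sum>k\<le>m. c k * q k"
  have "(\<Sum>k\<le>m. c k * (sqrt (real n) * (emp_pmf n xs k - q k))) =
      sqrt (real n) * ((\<Sum>k\<le>m. c k * emp_pmf n xs k) - ?q)"
    by (simp add: algebra_simps sum_subtractf sum_distrib_left)
  also have "\<dots> = sqrt (real n) * (?A / real n - ?q)" by (simp add: sum_emp_pmf)
  also have "\<dots> = (?A - real n * ?q) / sqrt (real n)"
  proof -
    have "r * (A / (r * r) - q) = (A - r * r * q) / r" if "r > 0" for r A q :: real
      using that by (simp add: field_simps)
    from this[of "sqrt (real n)" ?A ?q] show ?thesis using assms by simp
  qed
  finally show ?thesis by (simp add: sum_subtractf)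
qed

section \<open>The scalar central limit theorem for finitely supported laws\<close>

context
  fixes p :: "nat pmf" and h :: "nat \<Rightarrow> real"
  assumes fin: "finite (set_pmf p)" and mean: "measure_pmf.expectation p h = 0"
begin

abbreviation (input) "Pn n \<equiv> measure_pmf (Pi_pmf {..<n} (0::nat) (\<lambda>_::nat. p))"

lemma integrable_Pi_pmf_finite: "integrable (Pn n) (f :: _ \<Rightarrow> real)"
proof (rule integrable_measure_pmf_finite)
  show "finite (set_pmf (Pi_pmf {..<n} 0 (\<lambda>_. p)))"
    using fin by (simp add: set_Pi_pmf finite_PiE_dflt)
qed

lemma integral_Pi_pmf_coord:
  fixes f :: "nat \<Rightarrow> 'b::{banach, second_countable_topology}"
  assumes "i < n"
  shows "(\<integral>xs. f (xs i) \<partial>Pn n) = measure_pmf.expectation p f"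
proof -
  have "(\<integral>xs. f (xs i) \<partial>Pn n) = measure_pmf.expectation (map_pmf (\<lambda>xs. xs i) (Pi_pmf {..<n} 0 (\<lambda>_. p))) f"
    by simp
  also have "map_pmf (\<lambda>xs. xs i) (Pi_pmf {..<n} 0 (\<lambda>_. p)) = p"
    using assms by (subst Pi_pmf_component) auto
  finally show ?thesis .
qed

lemma indep_vars_Pi_pmf_coord:
  "prob_space.indep_vars (Pn n) (\<lambda>_. borel) (\<lambda>i xs. h (xs i)) {..<n}"
  by (rule prob_space.indep_vars_compose2[OF measure_pmf.prob_space_axioms indep_vars_Pi_pmf]) auto

lemma expectation_sum_square_Pi_pmf:
  "(\<integral>xs. (\<Sum>i<n. h (xs i))\<^sup>2 \<partial>Pn n) = real n * measure_pmf.expectation p (\<lambda>x. (h x)\<^sup>2)"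
proof -
  have E: "(\<integral>xs. h (xs i) * h (xs j) \<partial>Pn n) =
     (if i = j then measure_pmf.expectation p (\<lambda>x. (h x)\<^sup>2) else 0)" if "i < n" "j < n" for i j
  proof (cases "i = j")
    case True
    then show ?thesis using integral_Pi_pmf_coord[OF that(1), of "\<lambda>x. (h x)\<^sup>2"] by (simp add: power2_eq_square)
  next
    case False
    have "(\<integral>xs. (\<Prod>l\<in>{i, j}. h (xs l)) \<partial>Pn n) = (\<Prod>l\<in>{i, j}. \<integral>xs. h (xs l) \<partial>Pn n)"
      by (rule prob_space.indep_vars_lebesgue_integral[OF measure_pmf.prob_space_axioms])
        (use that in \<open>auto intro: integrable_Pi_pmf_finite
           prob_space.indep_vars_subset[OF measure_pmf.prob_space_axioms indep_vars_Pi_pmf_coord]\<close>)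
    then show ?thesis using False that by (simp add: integral_Pi_pmf_coord[of _ n h] mean)
  qed
  have "(\<integral>xs. (\<Sum>i<n. h (xs i))\<^sup>2 \<partial>Pn n) = (\<integral>xs. (\<Sum>i<n. \<Sum>j<n. h (xs i) * h (xs j)) \<partial>Pn n)"
    by (simp add: power2_eq_square sum_product)
  also have "\<dots> = (\<Sum>i<n. \<Sum>j<n. \<integral>xs. h (xs i) * h (xs j) \<partial>Pn n)"
    by (simp add: Bochner_Integration.integral_sum integrable_Pi_pmf_finite)
  also have "\<dots> = (\<Sum>i<n. \<Sum>j<n. if i = j then measure_pmf.expectation p (\<lambda>x. (h x)\<^sup>2) else 0)"
    by (intro sum.cong refl E) auto
  finally show ?thesis by simp
qed

text \<open>The sample space changes with n, so the characteristic functions of the row sums are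
  estimated directly. Finite support provides a third absolute moment \<open>C\<close>: each factor
  differs from 1 - V / (2 n) by at most C n^(-3/2), and n factors contribute
  \<open>C / sqrt n\<close>.\<close>

lemma tendsto_expectation_cos_sum_Pi_pmf:
  "(\<lambda>n. \<integral>xs. cos (1 / sqrt (real n) * (\<Sum>i<n. h (xs i)) + b) \<partial>Pn n) \<longlonglongrightarrow>
     cos b * exp (- measure_pmf.expectation p (\<lambda>x. (h x)\<^sup>2) / 2)"
proof -
  define V where "V = measure_pmf.expectation p (\<lambda>x. (h x)\<^sup>2)"
  define C where "C = measure_pmf.expectation p (\<lambda>x. \<bar>h x\<bar> ^ 3)"
  define \<psi> where "\<psi> = char (distr (measure_pmf p) borel h)"
  have V: "V \<ge> 0" by (simp add: V_def)
  have pint: "integrable (measure_pmf p) f" for f :: "nat \<Rightarrow> real"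
    by (rule integrable_measure_pmf_finite[OF fin])
  have \<psi>1: "cmod (\<psi> t) \<le> 1" for t
    unfolding \<psi>_def
    by (rule real_distribution.cmod_char_le_1, rule prob_space.real_distribution_distr)
      (auto simp: measure_pmf.prob_space_axioms)
  have approx: "cmod (\<psi> t - complex_of_real (1 - t\<^sup>2 * V / 2)) \<le> \<bar>t\<bar> ^ 3 * C" for t
  proof -
    have "cmod (\<psi> t - complex_of_real (1 - t\<^sup>2 * V / 2)) \<le>
        (t\<^sup>2 / 6) * measure_pmf.expectation p (\<lambda>x. min (6 * (h x)\<^sup>2) (\<bar>t\<bar> * \<bar>h x\<bar> ^ 3))"
      using prob_space.char_approx3'[OF measure_pmf.prob_space_axioms, of h p V "distr (measure_pmf p) borel h" t]
      by (simp add: pint mean V_def \<psi>_def)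
    also have "\<dots> \<le> t\<^sup>2 * (\<bar>t\<bar> * C)"
    proof (intro mult_mono)
      have "measure_pmf.expectation p (\<lambda>x. min (6 * (h x)\<^sup>2) (\<bar>t\<bar> * \<bar>h x\<bar> ^ 3)) \<le>
         measure_pmf.expectation p (\<lambda>x. \<bar>t\<bar> * \<bar>h x\<bar> ^ 3)"
        by (intro integral_mono pint) auto
      then show "measure_pmf.expectation p (\<lambda>x. min (6 * (h x)\<^sup>2) (\<bar>t\<bar> * \<bar>h x\<bar> ^ 3)) \<le> \<bar>t\<bar> * C"
        by (simp add: C_def)
    qed auto
    also have "\<dots> = \<bar>t\<bar> ^ 3 * C" by (simp add: power3_eq_cube power2_eq_square abs_mult_self_eq)
    finally show ?thesis .
  qed
  define \<phi> where "\<phi> n = (CLINT xs|Pn n. iexp (1 / sqrt (real n) * (\<Sum>i<n. h (xs i))))" for n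
  have \<phi>: "\<phi> n = \<psi> (1 / sqrt (real n)) ^ n" for n
  proof -
    have "\<phi> n = char (distr (Pn n) borel (\<lambda>xs. \<Sum>i<n. h (xs i))) (1 / sqrt (real n))"
      unfolding \<phi>_def char_def by (subst integral_distr) auto
    also have "\<dots> = (\<Prod>i<n. char (distr (Pn n) borel (\<lambda>xs. h (xs i))) (1 / sqrt (real n)))"
      by (rule prob_space.char_distr_sum[OF measure_pmf.prob_space_axioms indep_vars_Pi_pmf_coord])
    also have "\<dots> = (\<Prod>i<n. \<psi> (1 / sqrt (real n)))"
    proof (rule prod.cong)
      fix i assume "i \<in> {..<n}"
      then have i: "i < n" by simp
      show "char (distr (Pn n) borel (\<lambda>xs. h (xs i))) (1 / sqrt (real n)) = \<psi> (1 / sqrt (real n))"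
        unfolding \<psi>_def char_def
        using integral_Pi_pmf_coord[OF i, of "\<lambda>x. iexp (1 / sqrt (real n) * h x)"]
        by (subst integral_distr, simp, simp, subst integral_distr) auto
    qed simp
    finally show ?thesis by simp
  qed
  have lim1: "(\<lambda>n. \<phi> n - complex_of_real ((1 + (- V / 2) / real n) ^ n)) \<longlonglongrightarrow> 0"
  proof (rule Lim_null_comparison)
    show "(\<lambda>n. C * (1 / sqrt (real n))) \<longlonglongrightarrow> 0"
      by real_asymp
    show "eventually (\<lambda>n. norm (\<phi> n - complex_of_real ((1 + (- V / 2) / real n) ^ n)) \<le>
        C * (1 / sqrt (real n))) sequentially"
      \<comment> \<open>\<open>n > V\<close> makes 1 - V / (2 n) a number of modulus at most 1, as
        the comparison of n-th powers requires.\<close>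
      using eventually_gt_at_top[of "nat \<lceil>V\<rceil>"]
    proof eventually_elim
      case (elim n)
      then have n: "real n > V" "n > 0" using V by linarith+
      let ?w = "complex_of_real (1 + (- V / 2) / real n)"
      have "norm (\<phi> n - complex_of_real ((1 + (- V / 2) / real n) ^ n)) =
          norm (\<psi> (1 / sqrt (real n)) ^ n - ?w ^ n)" by (simp add: \<phi>)
      also have "\<dots> \<le> real n * norm (\<psi> (1 / sqrt (real n)) - ?w)"
      proof (rule norm_power_diff)
        have "\<bar>1 + (- V / 2) / real n\<bar> \<le> 1" using n V by (simp add: field_simps abs_le_iff)
        then show "norm ?w \<le> 1" by (simp only: norm_of_real)
      qed (rule \<psi>1)
      also have "?w = complex_of_real (1 - (1 / sqrt (real n))\<^sup>2 * V / 2)"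
        using n by (simp add: power_divide)
      also have "real n * norm (\<psi> (1 / sqrt (real n)) - \<dots>) \<le> real n * (\<bar>1 / sqrt (real n)\<bar> ^ 3 * C)"
        by (intro mult_left_mono approx) auto
      also have "\<dots> = C * (1 / sqrt (real n))"
        using n by (simp add: power3_eq_cube field_simps)
      finally show ?case .
    qed
  qed
  have "(\<lambda>n. complex_of_real ((1 + (- V / 2) / real n) ^ n)) \<longlonglongrightarrow> complex_of_real (exp (- V / 2))"
    by (intro tendsto_of_real tendsto_exp_limit_sequentially)
  from tendsto_add[OF lim1 this] have "\<phi> \<longlonglongrightarrow> complex_of_real (exp (- V / 2))" by simp
  then have "(\<lambda>n. Re (iexp b * \<phi> n)) \<longlonglongrightarrow> Re (iexp b * complex_of_real (exp (- V / 2)))"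
    by (intro tendsto_intros)
  moreover have "Re (iexp b * complex_of_real (exp (- V / 2))) = cos b * exp (- V / 2)"
    by (simp add: Re_exp)
  moreover have "Re (iexp b * \<phi> n) = (\<integral>xs. cos (1 / sqrt (real n) * (\<Sum>i<n. h (xs i)) + b) \<partial>Pn n)" for n
  proof -
    have i: "integrable (Pn n) (\<lambda>xs. iexp b * iexp (1 / sqrt (real n) * (\<Sum>i<n. h (xs i))))"
      by (rule measure_pmf.integrable_const_bound[where B=1]) (auto simp: norm_mult)
    have "iexp b * \<phi> n = (CLINT xs|Pn n. iexp b * iexp (1 / sqrt (real n) * (\<Sum>i<n. h (xs i))))"
      by (simp add: \<phi>_def)
    then have "Re (iexp b * \<phi> n) = (\<integral>xs. Re (iexp b * iexp (1 / sqrt (real n) * (\<Sum>i<n. h (xs i)))) \<partial>Pn n)"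
      using integral_Re[OF i] by simp
    also have "\<dots> = (\<integral>xs. cos (1 / sqrt (real n) * (\<Sum>i<n. h (xs i)) + b) \<partial>Pn n)"
      by (intro Bochner_Integration.integral_cong refl) (simp add: Re_exp Im_exp cos_add)
    finally show ?thesis .
  qed
  ultimately show ?thesis by (simp add: V_def)
qed

end

lemma pmf_expectation_atMost:
  fixes p :: "nat pmf" and f :: "nat \<Rightarrow> real"
  assumes "set_pmf p \<subseteq> {..m}"
  shows "measure_pmf.expectation p f = (\<Sum>k\<le>m. pmf p k * f k)"
  using assms by (subst integral_measure_pmf[of "{..m}"]) auto

lemma tendsto_expectation_cos_emp_pmf:
  assumes "set_pmf p \<subseteq> {..m}"
  shows "(\<lambda>n. \<integral>xs. cos ((\<Sum>k\<le>m. c k * (sqrt (real n) * (emp_pmf n xs k - pmf p k))) + b)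
       \<partial>measure_pmf (Pi_pmf {..<n} 0 (\<lambda>_. p))) \<longlonglongrightarrow>
     cos b * exp (- (\<Sum>k\<le>m. pmf p k * (c k - (\<Sum>j\<le>m. c j * pmf p j))\<^sup>2) / 2)"
proof -
  define h where "h x = (if x \<le> m then c x else 0) - (\<Sum>j\<le>m. c j * pmf p j)" for x
  have fin: "finite (set_pmf p)" using assms finite_subset by blast
  have sum1: "(\<Sum>k\<le>m. pmf p k) = 1"
    using pmf_expectation_atMost[OF assms, of "\<lambda>_. 1"] by simp
  have mean: "measure_pmf.expectation p h = 0"
    using sum1
    by (simp add: pmf_expectation_atMost[OF assms] h_def right_diff_distrib sum_subtractf mult.commute
        flip: sum_distrib_right)
  have var: "measure_pmf.expectation p (\<lambda>x. (h x)\<^sup>2) = (\<Sum>k\<le>m. pmf p k * (c k - (\<Sum>j\<le>m. c j * pmf p j))\<^sup>2)"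
    by (simp add: pmf_expectation_atMost[OF assms] h_def)
  show ?thesis
    using tendsto_expectation_cos_sum_Pi_pmf[OF fin mean, of b] unfolding var
    by (rule Lim_transform_eventually)
      (use eventually_gt_at_top[of 0] in eventually_elim, simp add: sum_scaled_emp_pmf h_def)
qed

text \<open>The expectation is the variance of an indicator. Being free of n, the bound serves both
  as the moment condition of the portmanteau inequality and in Chebyshev's inequality.\<close>

lemma expectation_scaled_emp_pmf_square:
  assumes "finite (set_pmf p)" "n > 0"
  shows "(\<integral>xs. (sqrt (real n) * (emp_pmf n xs k - pmf p k))\<^sup>2 \<partial>measure_pmf (Pi_pmf {..<n} 0 (\<lambda>_. p))) \<le> 1"
proof -
  define h where "h x = (if x = k then 1 else 0) - pmf p k" for x
  have "measure_pmf.expectation p (\<lambda>x. if x = k then 1 else 0) = pmf p k"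
    by (subst integral_measure_pmf[of "{k}"]) (auto split: if_splits)
  then have mean: "measure_pmf.expectation p h = 0"
    unfolding h_def by (subst Bochner_Integration.integral_diff) (auto intro: integrable_measure_pmf_finite assms)
  have h1: "(h x)\<^sup>2 \<le> 1" for x
    using pmf_le_1[of p k] pmf_nonneg[of p k] by (auto simp: h_def abs_square_le_1)
  have "(\<Sum>i\<le>k. (if i = k then 1 else 0) * (sqrt (real n) * (emp_pmf n xs i - pmf p i))) = 
      1 / sqrt (real n) * (\<Sum>i<n. h (xs i))" for xs
    using sum_scaled_emp_pmf[OF assms(2), of "\<lambda>i. if i = k then 1 else 0" xs "pmf p" k]
    by (simp add: h_def if_distrib[of "\<lambda>t. t * _"] cong: if_cong) (intro disjI2 sum.cong, auto)
  then have "sqrt (real n) * (emp_pmf n xs k - pmf p k) = 1 / sqrt (real n) * (\<Sum>i<n. h (xs i))" for xs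
    by (simp add: if_distrib[of "\<lambda>t. t * _"] cong: if_cong)
  then have "(\<integral>xs. (sqrt (real n) * (emp_pmf n xs k - pmf p k))\<^sup>2 \<partial>measure_pmf (Pi_pmf {..<n} 0 (\<lambda>_. p))) =
    1 / real n * (\<integral>xs. (\<Sum>i<n. h (xs i))\<^sup>2 \<partial>measure_pmf (Pi_pmf {..<n} 0 (\<lambda>_. p)))"
    by (simp add: power_divide)
  also have "\<dots> = measure_pmf.expectation p (\<lambda>x. (h x)\<^sup>2)"
    using assms by (simp add: expectation_sum_square_Pi_pmf[OF assms(1) mean])
  also have "\<dots> \<le> measure_pmf.expectation p (\<lambda>_. 1)"
    by (intro integral_mono integrable_measure_pmf_finite assms h1)
  finally show ?thesis by simp
qed

lemma prob_emp_pmf_deviation: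
  assumes fin: "finite (set_pmf p)" and "n > 0" "0 < \<epsilon>"
  shows "measure_pmf.prob (Pi_pmf {..<n} 0 (\<lambda>_. p)) {xs. \<epsilon> \<le> (\<Sum>k\<le>m. (emp_pmf n xs k - pmf p k)\<^sup>2)}
    \<le> real (Suc m) / (real n * \<epsilon>)"
proof -
  let ?P = "measure_pmf (Pi_pmf {..<n} 0 (\<lambda>_. p))"
  let ?D = "\<lambda>xs. \<Sum>k\<le>m. (sqrt (real n) * (emp_pmf n xs k - pmf p k))\<^sup>2"
  have int: "integrable ?P f" for f :: "_ \<Rightarrow> real"
    by (rule integrable_measure_pmf_finite) (use fin in \<open>simp add: set_Pi_pmf finite_PiE_dflt\<close>)
  have D: "?D xs = real n * (\<Sum>k\<le>m. (emp_pmf n xs k - pmf p k)\<^sup>2)" for xs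
    by (simp add: power_mult_distrib sum_distrib_left)
  have "measure_pmf.prob (Pi_pmf {..<n} 0 (\<lambda>_. p)) {xs \<in> space ?P. real n * \<epsilon> \<le> ?D xs} \<le> (\<integral>xs. ?D xs \<partial>?P) / (real n * \<epsilon>)"
    by (rule integral_Markov_inequality_measure[where A="{}"]) (use assms int in \<open>auto intro!: sum_nonneg\<close>)
  also have "(\<integral>xs. ?D xs \<partial>?P) = (\<Sum>k\<le>m. \<integral>xs. (sqrt (real n) * (emp_pmf n xs k - pmf p k))\<^sup>2 \<partial>?P)"
    by (intro Bochner_Integration.integral_sum int)
  also have "(\<Sum>k\<le>m. \<integral>xs. (sqrt (real n) * (emp_pmf n xs k - pmf p k))\<^sup>2 \<partial>?P) / (real n * \<epsilon>)
      \<le> (\<Sum>k\<le>m. 1) / (real n * \<epsilon>)"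
    by (intro divide_right_mono sum_mono expectation_scaled_emp_pmf_square) (use assms in auto)
  finally show ?thesis using assms by (simp add: D)
qed

subsection \<open>Existence of the least squares projections\<close>

text \<open>The parallelogram identity, with all coordinates but \<open>k\<close> dropped on the
  left. It yields the Cauchy property of minimizing sequences as well as uniqueness of
  minimizers.\<close>

lemma sqnorm_midpoint:
  fixes f g h :: "nat \<Rightarrow> real"
  assumes f: "summable (\<lambda>k. (h k - f k)\<^sup>2)" and g: "summable (\<lambda>k. (h k - g k)\<^sup>2)"
    and fg: "summable (\<lambda>k. (h k - (f k + g k) / 2)\<^sup>2)"
  shows "((f k - g k) / 2)\<^sup>2 \<le> (sqnorm (\<lambda>k. h k - f k) + sqnorm (\<lambda>k. h k - g k)) / 2
            - sqnorm (\<lambda>k. h k - (f k + g k) / 2)"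
proof -
  have eq: "((f k - g k) / 2)\<^sup>2 = ((h k - f k)\<^sup>2 + (h k - g k)\<^sup>2) / 2 - (h k - (f k + g k) / 2)\<^sup>2" for k
    by (simp add: power2_eq_square field_simps)
  have s: "summable (\<lambda>k. ((h k - f k)\<^sup>2 + (h k - g k)\<^sup>2) / 2)"
    using f g by (intro summable_divide summable_add)
  have "summable (\<lambda>k. ((f k - g k) / 2)\<^sup>2)"
    unfolding eq using s fg by (rule summable_diff)
  then have "((f k - g k) / 2)\<^sup>2 \<le> (\<Sum>k. ((f k - g k) / 2)\<^sup>2)"
    using sum_le_suminf[of "\<lambda>k. ((f k - g k) / 2)\<^sup>2" "{k}"] by simp
  also have "\<dots> = (\<Sum>k. ((h k - f k)\<^sup>2 + (h k - g k)\<^sup>2) / 2) - (\<Sum>k. (h k - (f k + g k) / 2)\<^sup>2)"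
    unfolding eq using s fg by (rule suminf_diff[symmetric])
  also have "(\<Sum>k. ((h k - f k)\<^sup>2 + (h k - g k)\<^sup>2) / 2) = ((\<Sum>k. (h k - f k)\<^sup>2) + (\<Sum>k. (h k - g k)\<^sup>2)) / 2"
    using f g by (simp add: suminf_add suminf_divide summable_add)
  finally show ?thesis by (simp add: sqnorm_def)
qed

lemma sqnorm_nonneg: "summable (\<lambda>k. (f k)\<^sup>2) \<Longrightarrow> 0 \<le> sqnorm f"
  by (simp add: sqnorm_def suminf_nonneg)

text \<open>Near-minimizers are close to each other by the parallelogram identity, so every
  coordinate converges; bounds on partial sums pass to the limit as in Fatou's lemma.
  \<open>A\<close> is not assumed closed, so the limit is not claimed to lie in \<open>A\<close>;
  the approximating sequence is returned so that membership can be examined case by case.\<close>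

lemma minimizing_sequence_limit:
  fixes A :: "(nat \<Rightarrow> real) set"
  assumes "A \<noteq> {}"
    and mid: "\<And>f g. f \<in> A \<Longrightarrow> g \<in> A \<Longrightarrow> (\<lambda>k. (f k + g k) / 2) \<in> A"
    and sm: "\<And>f. f \<in> A \<Longrightarrow> summable (\<lambda>k. (h k - f k)\<^sup>2)"
  shows "\<exists>q p. (\<forall>i::nat. q i \<in> A) \<and> (\<forall>k. (\<lambda>i. q i k) \<longlonglongrightarrow> p k) \<and> summable (\<lambda>k. (h k - p k)\<^sup>2) \<and>
    (\<forall>f\<in>A. sqnorm (\<lambda>k. h k - p k) \<le> sqnorm (\<lambda>k. h k - f k))"
proof -
  define S where "S f = sqnorm (\<lambda>k. h k - f k)" for f
  define d where "d = (INF f\<in>A. S f)"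
  have bdd: "bdd_below (S ` A)"
    using sm by (intro bdd_belowI[of _ 0]) (auto simp: S_def intro: sqnorm_nonneg)
  have d: "d \<le> S f" if "f \<in> A" for f
    unfolding d_def using bdd that by (rule cINF_lower)
  have "\<exists>f\<in>A. S f < d + inverse (real (Suc i))" for i
    using cINF_less_iff[OF \<open>A \<noteq> {}\<close> bdd, of "d + inverse (real (Suc i))"]
    by (simp add: d_def del: of_nat_Suc)
  then obtain q where q: "\<And>i. q i \<in> A" "\<And>i. S (q i) < d + inverse (real (Suc i))" by metis
  have dist: "(q i k - q j k)\<^sup>2 \<le> 2 * inverse (real (Suc i)) + 2 * inverse (real (Suc j))" for i j k
  proof -
    have "((q i k - q j k) / 2)\<^sup>2 \<le> (S (q i) + S (q j)) / 2 - S (\<lambda>k. (q i k + q j k) / 2)"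
      unfolding S_def by (intro sqnorm_midpoint sm mid q)
    also have "\<dots> \<le> (S (q i) + S (q j)) / 2 - d"
      using d[OF mid[OF q(1) q(1)], of i j] by simp
    finally have "(q i k - q j k)\<^sup>2 / 4 \<le> (S (q i) + S (q j)) / 2 - d" by (simp add: power_divide)
    moreover have "X \<le> 2 * e + 2 * e'" if "X / 4 \<le> (a + b) / 2 - d" "a < d + e" "b < d + e'"
      for X a b e e' :: real
      using that by (simp add: field_simps)
    ultimately show ?thesis using q(2) by blast
  qed
  have "Cauchy (\<lambda>i. q i k)" for k
  proof (rule CauchyI)
    fix e :: real assume "0 < e"
    then obtain N where "inverse (real (Suc N)) < e\<^sup>2 / 4"
      using reals_Archimedean[of "e\<^sup>2 / 4"] by auto
    then have N: "4 * inverse (real (Suc N)) < e\<^sup>2" by simp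
    have "norm (q i k - q j k) < e" if "i \<ge> N" "j \<ge> N" for i j
    proof -
      have "inverse (real (Suc i)) \<le> inverse (real (Suc N))" "inverse (real (Suc j)) \<le> inverse (real (Suc N))"
        using that by (auto intro!: le_imp_inverse_le)
      then have "(q i k - q j k)\<^sup>2 < e\<^sup>2" using dist[of i k j] N by linarith
      then show ?thesis using \<open>0 < e\<close> by (metis abs_less_iff abs_of_pos power2_less_imp_less less_eq_real_def real_norm_def power2_abs)
    qed
    then show "\<exists>M. \<forall>m\<ge>M. \<forall>n\<ge>M. norm (q m k - q n k) < e" by blast
  qed
  then have "\<exists>l. (\<lambda>i. q i k) \<longlonglongrightarrow> l" for k
    using Cauchy_convergent convergent_def by blast
  then obtain p where p: "\<And>k. (\<lambda>i. q i k) \<longlonglongrightarrow> p k" by metis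
  have part: "(\<Sum>k<K. (h k - p k)\<^sup>2) \<le> d" for K
  proof (rule LIMSEQ_le)
    show "(\<lambda>i. \<Sum>k<K. (h k - q i k)\<^sup>2) \<longlonglongrightarrow> (\<Sum>k<K. (h k - p k)\<^sup>2)"
      by (intro tendsto_intros p)
    have "(\<lambda>i. d + inverse (real (Suc i))) \<longlonglongrightarrow> d + 0"
      by (intro tendsto_intros LIMSEQ_inverse_real_of_nat)
    then show "(\<lambda>i. d + inverse (real (Suc i))) \<longlonglongrightarrow> d" by simp
    have "(\<Sum>k<K. (h k - q i k)\<^sup>2) \<le> S (q i)" for i
      unfolding S_def sqnorm_def by (intro sum_le_suminf sm q) auto
    then show "\<exists>N. \<forall>i\<ge>N. (\<Sum>k<K. (h k - q i k)\<^sup>2) \<le> d + inverse (real (Suc i))"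
      using q(2) by (meson less_imp_le order_trans)
  qed
  have sp: "summable (\<lambda>k. (h k - p k)\<^sup>2)"
    by (rule summableI_nonneg_bounded[OF _ part]) auto
  have "sqnorm (\<lambda>k. h k - p k) \<le> d"
    unfolding sqnorm_def by (rule suminf_le_const[OF sp part])
  then have "\<forall>f\<in>A. sqnorm (\<lambda>k. h k - p k) \<le> sqnorm (\<lambda>k. h k - f k)"
    using d unfolding S_def by (meson order_trans)
  then show ?thesis using q(1) p sp by blast
qed

lemma sqnorm_minimizer_unique:
  assumes mid: "\<And>f g. f \<in> A \<Longrightarrow> g \<in> A \<Longrightarrow> (\<lambda>k. (f k + g k) / 2) \<in> A"
    and sm: "\<And>f. f \<in> A \<Longrightarrow> summable (\<lambda>k. (h k - f k)\<^sup>2)"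
    and f: "f \<in> A" "\<And>f'. f' \<in> A \<Longrightarrow> sqnorm (\<lambda>k. h k - f k) \<le> sqnorm (\<lambda>k. h k - f' k)"
    and g: "g \<in> A" "\<And>f'. f' \<in> A \<Longrightarrow> sqnorm (\<lambda>k. h k - g k) \<le> sqnorm (\<lambda>k. h k - f' k)"
  shows "f = g"
proof
  fix k
  have "((f k - g k) / 2)\<^sup>2 \<le> (sqnorm (\<lambda>k. h k - f k) + sqnorm (\<lambda>k. h k - g k)) / 2
            - sqnorm (\<lambda>k. h k - (f k + g k) / 2)"
    by (intro sqnorm_midpoint sm mid f g)
  also have "\<dots> \<le> 0"
    using f(2)[OF mid[OF f(1) g(1)]] g(2)[OF mid[OF f(1) g(1)]] by simp
  finally show "f k = g k" by simp
qed

lemma delta2_tendsto: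
  assumes "\<And>k. (\<lambda>i. q i k) \<longlonglongrightarrow> p k"
  shows "(\<lambda>i. delta2 (q i) k) \<longlonglongrightarrow> delta2 p k"
  unfolding delta2_def by (intro tendsto_intros assms)

lemma convex_pmf_fun_midpoint:
  assumes "convex_pmf_fun f" "convex_pmf_fun g"
  shows "convex_pmf_fun (\<lambda>k. (f k + g k) / 2)"
  unfolding convex_pmf_fun_def
proof (intro conjI allI impI)
  show "0 \<le> (f j + g j) / 2" for j using assms by (simp add: convex_pmf_fun_def)
  have "(\<lambda>k. (f k + g k) / 2) sums ((1 + 1) / 2)"
    using assms by (intro sums_divide sums_add) (auto simp: convex_pmf_fun_def)
  then show "(\<lambda>k. (f k + g k) / 2) sums 1" by simp
  fix k :: nat assume "1 \<le> k"
  then have "0 \<le> delta2 f k" "0 \<le> delta2 g k" using assms by (auto simp: convex_pmf_fun_def)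
  then show "0 \<le> delta2 (\<lambda>k. (f k + g k) / 2) k" by (simp add: delta2_def field_simps)
qed

lemma convex_pmf_fun_summable_diff_square:
  assumes "convex_pmf_fun q" and h: "\<And>k. k > N \<Longrightarrow> h k = 0"
  shows "summable (\<lambda>k. (h k - q k)\<^sup>2)"
proof -
  have q: "summable q" "\<And>k. 0 \<le> q k" "suminf q = 1"
    using assms(1) by (auto simp: convex_pmf_fun_def sums_iff)
  have q1: "q k \<le> 1" for k
    using sum_le_suminf[OF q(1), of "{k}"] q by simp
  have "summable (\<lambda>k. (q k)\<^sup>2)"
    by (rule summable_comparison_test'[OF q(1), of 0])
      (use q q1 in \<open>auto simp: power2_eq_square intro: mult_left_le_one_le\<close>)
  then show ?thesis
    by (rule summable_cong[THEN iffD1, rotated])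
      (use eventually_gt_at_top[of N] in eventually_elim, simp add: h)
qed

text \<open>The convex probability mass functions are not closed under pointwise limits, because mass
  may escape to infinity.  If the limit \<open>p\<close> of a minimizing sequence had mass below 1, then adding
  the missing mass as a multiple of the triangular function \<open>k \<mapsto> L - k\<close> (truncated at 0) for large
  \<open>L\<close> would strictly improve on \<open>p\<close>.\<close>
lemma convex_projection_ex1:
  fixes h :: "nat \<Rightarrow> real"
  assumes h0: "\<And>k. 0 \<le> h k" and hN: "\<And>k. k > N \<Longrightarrow> h k = 0" and h1: "(\<Sum>k\<le>N. h k) = 1"
  shows "\<exists>!p. convex_pmf_fun p \<and>
     (\<forall>q. convex_pmf_fun q \<longrightarrow> sqnorm (\<lambda>j. h j - p j) \<le> sqnorm (\<lambda>j. h j - q j))"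
proof -
  let ?A = "Collect convex_pmf_fun"
  have mid: "(\<lambda>k. (f k + g k) / 2) \<in> ?A" if "f \<in> ?A" "g \<in> ?A" for f g
    using that convex_pmf_fun_midpoint by simp
  have sm: "summable (\<lambda>k. (h k - f k)\<^sup>2)" if "f \<in> ?A" for f
    using that convex_pmf_fun_summable_diff_square[of f N h] hN by simp
  have "convex_pmf_fun (\<lambda>k. if k = 0 then 1 else 0)"
    using sums_single[of 0 "\<lambda>_. 1 :: real"] by (auto simp: convex_pmf_fun_def delta2_def eq_commute[of 0])
  then have ne: "?A \<noteq> {}" by auto
  obtain q p where q: "\<And>i::nat. q i \<in> ?A" and p: "\<And>k. (\<lambda>i. q i k) \<longlonglongrightarrow> p k"
    and sp: "summable (\<lambda>k. (h k - p k)\<^sup>2)"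
    and min: "\<And>f. f \<in> ?A \<Longrightarrow> sqnorm (\<lambda>k. h k - p k) \<le> sqnorm (\<lambda>k. h k - f k)"
    using minimizing_sequence_limit[of ?A h, OF ne mid sm] by blast
  have q': "0 \<le> q i k" "q i sums 1" "1 \<le> k \<Longrightarrow> 0 \<le> delta2 (q i) k" for i k
    using q[of i] by (auto simp: convex_pmf_fun_def)
  have p0: "0 \<le> p k" for k
    by (rule LIMSEQ_le_const[OF p]) (use q' in auto)
  have pd: "0 \<le> delta2 p k" if "1 \<le> k" for k
    by (rule LIMSEQ_le_const[OF delta2_tendsto[OF p]]) (use q'(3)[OF that] in auto)
  have part: "(\<Sum>k<K. p k) \<le> 1" for K
  proof (rule LIMSEQ_le_const2)
    show "(\<lambda>i. \<Sum>k<K. q i k) \<longlonglongrightarrow> (\<Sum>k<K. p k)" by (intro tendsto_intros p)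
    show "\<exists>N. \<forall>i\<ge>N. (\<Sum>k<K. q i k) \<le> 1"
      using sum_le_suminf[of "q _" "{..<K}"] q' by (auto simp: sums_iff)
  qed
  have sump: "summable p" by (rule summableI_nonneg_bounded[OF p0 part])
  define m where "m = suminf p"
  have pm: "p sums m" using sump by (simp add: m_def sums_iff)
  have m1: "m \<le> 1" unfolding m_def by (rule suminf_le_const[OF sump part])
  have m0: "m = 1"
  proof (rule ccontr)
    assume "m \<noteq> 1"
    with m1 have m: "m < 1" by simp
    obtain L where L: "real L > (2 * real N) / (1 - m)" "L > N"
    proof -
      obtain L0 :: nat where "real L0 > (2 * real N) / (1 - m)" using reals_Archimedean2 by blast
      then show ?thesis by (intro that[of "max L0 (Suc N)"]) auto
    qed
    define t where "t k = real (L - k)" for k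
    have t: "0 \<le> t k" "t k \<le> real L" for k by (auto simp: t_def)
    have tL: "k \<ge> L \<Longrightarrow> t k = 0" for k by (auto simp: t_def)
    define s where "s = (\<Sum>k<L. t k)"
    have "t 0 \<le> s" unfolding s_def using L by (intro member_le_sum) (auto simp: t)
    then have s: "s > 0" using L by (simp add: t_def)
    define c where "c = (1 - m) / s"
    have c: "c > 0" "c * s = 1 - m" using s m by (auto simp: c_def)
    have "t sums s" unfolding s_def by (rule sums_finite) (auto simp: tL)
    then have "(\<lambda>k. p k + c * t k) sums (m + c * s)" by (intro sums_add sums_mult pm)
    then have sums1: "(\<lambda>k. p k + c * t k) sums 1" by (simp add: c)
    have tconv: "0 \<le> delta2 t k" if "1 \<le> k" for k
    proof -
      have "2 * (L - k) \<le> (L - (k + 1)) + (L - (k - 1))" using that by arith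
      then have "real (2 * (L - k)) \<le> real ((L - (k + 1)) + (L - (k - 1)))" by (rule of_nat_mono)
      then show ?thesis by (simp add: delta2_def t_def)
    qed
    have "0 \<le> delta2 (\<lambda>k. p k + c * t k) k" if "1 \<le> k" for k
    proof -
      have "delta2 (\<lambda>k. p k + c * t k) k = delta2 p k + c * delta2 t k" by (simp add: delta2_def algebra_simps)
      then show ?thesis using pd[OF that] tconv[OF that] c by simp
    qed
    then have qc: "convex_pmf_fun (\<lambda>k. p k + c * t k)"
      using sums1 p0 t c by (auto simp: convex_pmf_fun_def)
    \<comment> \<open>Optimality of \<open>p\<close> against \<open>p + c * t\<close> gives 2 <r, t>
      \<le> c |t|^2 \<le> L (1 - m), because t \<le> L and c s = 1 - m. On the other side <r, t>
      \<ge> L - N - m L, because \<open>h\<close> has mass 1 on \<open>{..N}\<close>. Together they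
      bound L (1 - m) by 2 N, against the choice of \<open>L\<close>.\<close>
    define r where "r k = h k - p k" for k
    have "(\<lambda>k. (r k - c * t k)\<^sup>2 - (r k)\<^sup>2) sums (\<Sum>k<L. (r k - c * t k)\<^sup>2 - (r k)\<^sup>2)"
      by (rule sums_finite) (auto simp: tL)
    moreover have "summable (\<lambda>k. (r k - c * t k)\<^sup>2)"
      using sm[of "\<lambda>k. p k + c * t k"] qc by (simp add: r_def diff_diff_eq)
    ultimately have "(\<Sum>k<L. (r k - c * t k)\<^sup>2 - (r k)\<^sup>2) = (\<Sum>k. (r k - c * t k)\<^sup>2) - (\<Sum>k. (r k)\<^sup>2)"
      using sp suminf_diff[of "\<lambda>k. (r k - c * t k)\<^sup>2" "\<lambda>k. (r k)\<^sup>2"] by (simp add: r_def sums_iff)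
    also have "\<dots> \<ge> 0"
      using min[of "\<lambda>k. p k + c * t k"] qc by (simp add: r_def sqnorm_def diff_diff_eq)
    finally have "0 \<le> (\<Sum>k<L. c\<^sup>2 * (t k)\<^sup>2 - 2 * c * (r k * t k))"
      by (simp add: power2_eq_square algebra_simps)
    also have "\<dots> = c * (c * (\<Sum>k<L. (t k)\<^sup>2) - 2 * (\<Sum>k<L. r k * t k))"
      by (simp add: sum_subtractf sum_distrib_left power2_eq_square right_diff_distrib mult.assoc mult.left_commute)
    finally have "2 * (\<Sum>k<L. r k * t k) \<le> c * (\<Sum>k<L. (t k)\<^sup>2)"
      using c by (simp add: zero_le_mult_iff)
    also have "\<dots> \<le> c * (\<Sum>k<L. real L * t k)"
      by (intro mult_left_mono sum_mono) (use c t in \<open>auto simp: power2_eq_square intro: mult_right_mono\<close>)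
    also have "\<dots> = real L * (1 - m)" using c by (simp add: s_def flip: sum_distrib_left)
    finally have le: "2 * (\<Sum>k<L. r k * t k) \<le> real L * (1 - m)" .
    have "(\<Sum>k<L. p k * t k) \<le> (\<Sum>k<L. p k * real L)"
      by (intro sum_mono mult_left_mono t p0)
    also have "\<dots> = (\<Sum>k<L. p k) * real L" by (simp add: sum_distrib_right)
    also have "\<dots> \<le> m * real L"
      unfolding m_def by (intro mult_right_mono sum_le_suminf sump) (auto simp: p0)
    finally have pt: "(\<Sum>k<L. p k * t k) \<le> m * real L" .
    have "real L - real N = (\<Sum>k\<le>N. h k) * (real L - real N)" by (simp add: h1)
    also have "\<dots> = (\<Sum>k\<le>N. h k * (real L - real N))" by (simp add: sum_distrib_right)
    also have "\<dots> \<le> (\<Sum>k\<le>N. h k * t k)"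
      by (intro sum_mono mult_left_mono h0) (use L in \<open>auto simp: t_def of_nat_diff\<close>)
    also have "\<dots> = (\<Sum>k<L. h k * t k)"
      using L by (intro sum.mono_neutral_left) (auto simp: hN)
    finally have "real L - real N - m * real L \<le> (\<Sum>k<L. r k * t k)"
      using pt by (simp add: r_def left_diff_distrib sum_subtractf)
    then have "real L * (1 - m) \<le> 2 * real N" using le by (simp add: algebra_simps)
    then show False using L(1) m by (simp add: field_simps)
  qed
  have "p \<in> ?A" using p0 pd pm m0 by (simp add: convex_pmf_fun_def)
  show ?thesis
  proof (rule ex1I[of _ p])
    show "convex_pmf_fun p \<and> (\<forall>q. convex_pmf_fun q \<longrightarrow> sqnorm (\<lambda>j. h j - p j) \<le> sqnorm (\<lambda>j. h j - q j))"
      using \<open>p \<in> ?A\<close> min by simp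
    fix p' assume "convex_pmf_fun p' \<and>
       (\<forall>q. convex_pmf_fun q \<longrightarrow> sqnorm (\<lambda>j. h j - p' j) \<le> sqnorm (\<lambda>j. h j - q j))"
    then show "p' = p"
      by (intro sqnorm_minimizer_unique[of ?A h]) (use mid sm \<open>p \<in> ?A\<close> min in auto)
  qed
qed

section \<open>The empirical pmf and its convex projection\<close>

lemma emp_pmf_nonneg: "0 \<le> emp_pmf n xs k"
  by (simp add: emp_pmf_def)

lemma emp_pmf_beyond_sample_max:
  assumes "k > sample_max n xs"
  shows "emp_pmf n xs k = 0"
proof -
  have "{i. i < n \<and> xs i = k} = {}"
    using assms Max_ge[of "xs ` {..<n}"] by (fastforce simp: sample_max_def not_le[symmetric])
  then show ?thesis by (simp only: emp_pmf_def card.empty)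
qed

lemma sum_emp_pmf_eq_1:
  assumes "n > 0" "\<And>i. i < n \<Longrightarrow> xs i \<le> N"
  shows "(\<Sum>k\<le>N. emp_pmf n xs k) = 1"
proof -
  have "(\<Sum>k\<le>N. card {i. i < n \<and> xs i = k}) = card (\<Union>k\<le>N. {i. i < n \<and> xs i = k})"
    by (subst card_UN_disjoint) auto
  also have "(\<Union>k\<le>N. {i. i < n \<and> xs i = k}) = {..<n}" using assms(2) by auto
  finally show ?thesis using assms(1)
    by (simp add: emp_pmf_def flip: sum_divide_distrib of_nat_sum)
qed

lemma convex_lse_properties:
  assumes "n > 0"
  shows "convex_pmf_fun (convex_lse n xs)"
    and "convex_pmf_fun q \<Longrightarrow> sqnorm (\<lambda>j. emp_pmf n xs j - convex_lse n xs j) \<le> sqnorm (\<lambda>j. emp_pmf n xs j - q j)"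
proof -
  have "xs i \<le> sample_max n xs" if "i < n" for i
    using that by (auto simp: sample_max_def)
  then have "\<exists>!p. convex_pmf_fun p \<and>
     (\<forall>q. convex_pmf_fun q \<longrightarrow> sqnorm (\<lambda>j. emp_pmf n xs j - p j) \<le> sqnorm (\<lambda>j. emp_pmf n xs j - q j))"
    by (intro convex_projection_ex1[of _ "sample_max n xs"] emp_pmf_nonneg emp_pmf_beyond_sample_max
        sum_emp_pmf_eq_1 assms)
  from theI'[OF this] show "convex_pmf_fun (convex_lse n xs)"
    "convex_pmf_fun q \<Longrightarrow> sqnorm (\<lambda>j. emp_pmf n xs j - convex_lse n xs j) \<le> sqnorm (\<lambda>j. emp_pmf n xs j - q j)"
    by (auto simp: convex_lse_def)
qed

subsection \<open>Distance to the cone\<close>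

text \<open>\<open>Z\<close> is left free so that the limiting cone and the data-dependent cone
  \<open>cone_K\<close> are instances of one family.\<close>

definition delta2_cone :: "nat set \<Rightarrow> nat \<Rightarrow> (nat \<Rightarrow> real) set" where
  "delta2_cone Z m = {g. (\<forall>k>m. g k = 0) \<and> (\<forall>x\<in>Z. 0 \<le> delta2 g x)}"

text \<open>The distance rather than its square, which \<open>T_hat\<close> uses: the distance is
  Lipschitz, as the portmanteau inequality requires.\<close>

definition cone_dist :: "nat set \<Rightarrow> nat \<Rightarrow> (nat \<Rightarrow> real) \<Rightarrow> real" where
  "cone_dist Z m w = (INF g\<in>delta2_cone Z m. L2_set (\<lambda>k. g k - w k) {..m})"

lemma sqdist_fin_eq_L2_set: "sqdist_fin m g w = (L2_set (\<lambda>k. g k - w k) {..m})\<^sup>2"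
  by (simp add: sqdist_fin_def L2_set_def sum_nonneg atLeast0AtMost)

lemma delta2_add: "delta2 (\<lambda>k. f k + g k) x = delta2 f x + delta2 g x"
  by (simp add: delta2_def)

lemma delta2_scale: "delta2 (\<lambda>k. a * f k) x = a * delta2 f x"
  by (simp add: delta2_def algebra_simps)

lemma delta2_cone_combine:
  assumes "f \<in> delta2_cone Z m" "g \<in> delta2_cone Z m" "0 \<le> a" "0 \<le> b"
  shows "(\<lambda>k. a * f k + b * g k) \<in> delta2_cone Z m"
  using assms by (auto simp: delta2_cone_def delta2_add delta2_scale)

lemma zero_in_delta2_cone: "(\<lambda>_. 0) \<in> delta2_cone Z m"
  by (simp add: delta2_cone_def delta2_def)

lemma delta2_cone_projection_ex1:
  "\<exists>!g. g \<in> delta2_cone Z m \<and> (\<forall>h\<in>delta2_cone Z m. sqdist_fin m g w \<le> sqdist_fin m h w)"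
proof -
  let ?A = "delta2_cone Z m"
  \<comment> \<open>Truncating \<open>w\<close> turns the finite sum into \<open>sqnorm\<close>.
    Unlike the convex pmfs, the cone is closed under pointwise limits, so the limit of a minimizing
    sequence lies in it.\<close>
  let ?w = "\<lambda>k. if k \<le> m then w k else 0"
  have sums: "(\<lambda>k. (?w k - g k)\<^sup>2) sums sqdist_fin m g w" if "g \<in> ?A" for g
  proof -
    have "(\<lambda>k. (?w k - g k)\<^sup>2) sums (\<Sum>k\<in>{0..m}. (?w k - g k)\<^sup>2)"
      by (rule sums_finite) (use that in \<open>auto simp: delta2_cone_def\<close>)
    also have "(\<Sum>k\<in>{0..m}. (?w k - g k)\<^sup>2) = sqdist_fin m g w"
      unfolding sqdist_fin_def by (intro sum.cong) (auto simp: power2_commute)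
    finally show ?thesis .
  qed
  then have sq: "sqnorm (\<lambda>k. ?w k - g k) = sqdist_fin m g w" if "g \<in> ?A" for g
    using that by (simp add: sqnorm_def sums_iff)
  have sm: "summable (\<lambda>k. (?w k - g k)\<^sup>2)" if "g \<in> ?A" for g
    using sums[OF that] by (rule sums_summable)
  have mid: "(\<lambda>k. (f k + g k) / 2) \<in> ?A" if "f \<in> ?A" "g \<in> ?A" for f g
    using delta2_cone_combine[OF that, of "1/2" "1/2"] by (simp add: add_divide_distrib)
  have ne: "?A \<noteq> {}" using zero_in_delta2_cone by auto
  obtain q p where q: "\<And>i::nat. q i \<in> ?A" and p: "\<And>k. (\<lambda>i. q i k) \<longlonglongrightarrow> p k"
    and min: "\<And>f. f \<in> ?A \<Longrightarrow> sqnorm (\<lambda>k. ?w k - p k) \<le> sqnorm (\<lambda>k. ?w k - f k)"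
    using minimizing_sequence_limit[of ?A ?w, OF ne mid sm] by blast
  have "p k = 0" if "k > m" for k
    using p[of k] q that by (simp add: delta2_cone_def LIMSEQ_const_iff)
  moreover have "0 \<le> delta2 p x" if "x \<in> Z" for x
    by (rule LIMSEQ_le_const[OF delta2_tendsto[OF p]]) (use q that in \<open>auto simp: delta2_cone_def\<close>)
  ultimately have pA: "p \<in> ?A" by (simp add: delta2_cone_def)
  show ?thesis
  proof (rule ex1I[of _ p])
    show "p \<in> ?A \<and> (\<forall>h\<in>?A. sqdist_fin m p w \<le> sqdist_fin m h w)"
      using pA min sq by simp
    fix p' assume "p' \<in> ?A \<and> (\<forall>h\<in>?A. sqdist_fin m p' w \<le> sqdist_fin m h w)"
    then show "p' = p"
      by (intro sqnorm_minimizer_unique[of ?A ?w]) (use mid sm pA min sq in auto)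
  qed
qed

lemma cone_dist_bdd_below: "bdd_below ((\<lambda>g. L2_set (\<lambda>k. g k - w k) {..m}) ` delta2_cone Z m)"
  by (rule bdd_belowI[of _ 0]) auto

lemma cone_dist_le: "g \<in> delta2_cone Z m \<Longrightarrow> cone_dist Z m w \<le> L2_set (\<lambda>k. g k - w k) {..m}"
  unfolding cone_dist_def by (rule cINF_lower[OF cone_dist_bdd_below])

lemma cone_dist_minimizer:
  assumes "g \<in> delta2_cone Z m" "\<And>h. h \<in> delta2_cone Z m \<Longrightarrow> sqdist_fin m g w \<le> sqdist_fin m h w"
  shows "cone_dist Z m w = L2_set (\<lambda>k. g k - w k) {..m}"
proof (rule antisym[OF cone_dist_le[OF assms(1)]])
  show "L2_set (\<lambda>k. g k - w k) {..m} \<le> cone_dist Z m w"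
    unfolding cone_dist_def
  proof (rule cINF_greatest)
    show "delta2_cone Z m \<noteq> {}" using assms(1) by auto
    fix h assume "h \<in> delta2_cone Z m"
    then have "sqdist_fin m g w \<le> sqdist_fin m h w" by (rule assms(2))
    then show "L2_set (\<lambda>k. g k - w k) {..m} \<le> L2_set (\<lambda>k. h k - w k) {..m}"
      unfolding sqdist_fin_eq_L2_set by (rule power2_le_imp_le) (rule L2_set_nonneg)
  qed
qed

lemma cone_dist_attained:
  obtains g where "g \<in> delta2_cone Z m" "cone_dist Z m w = L2_set (\<lambda>k. g k - w k) {..m}"
    "\<And>h. h \<in> delta2_cone Z m \<Longrightarrow> L2_set (\<lambda>k. g k - w k) {..m} \<le> L2_set (\<lambda>k. h k - w k) {..m}"
proof -
  obtain g where g: "g \<in> delta2_cone Z m"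
    "\<And>h. h \<in> delta2_cone Z m \<Longrightarrow> sqdist_fin m g w \<le> sqdist_fin m h w"
    using delta2_cone_projection_ex1 by blast
  show ?thesis
    by (rule that[OF g(1) cone_dist_minimizer[OF g]])
      (use cone_dist_le cone_dist_minimizer[OF g] in \<open>auto simp flip: cone_dist_minimizer[OF g]\<close>)
qed

text \<open>Existence and uniqueness of the projection resolve the definite description in
  \<open>proj_K\<close>; from here on \<open>T_hat\<close> enters only as a squared distance, which
  grows with the constraint set.\<close>

lemma T_hat_eq_cone_dist:
  "T_hat v n xs w = (cone_dist {x\<in>{1..sample_max n xs}. delta2 (convex_lse n xs) x \<le> v n} (sample_max n xs + 1) w)\<^sup>2"
proof -
  let ?Z = "{x\<in>{1..sample_max n xs}. delta2 (convex_lse n xs) x \<le> v n}" and ?m = "sample_max n xs + 1"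
  have K: "cone_K v n xs = delta2_cone ?Z ?m"
    by (auto simp: cone_K_def delta2_cone_def)
  have "proj_K v n xs w \<in> delta2_cone ?Z ?m \<and>
     (\<forall>h\<in>delta2_cone ?Z ?m. sqdist_fin ?m (proj_K v n xs w) w \<le> sqdist_fin ?m h w)"
    unfolding proj_K_def K by (rule theI'[OF delta2_cone_projection_ex1])
  then show ?thesis
    using cone_dist_minimizer[of "proj_K v n xs w" ?Z ?m w] by (simp add: T_hat_def sqdist_fin_eq_L2_set)
qed

lemma cone_dist_nonneg: "0 \<le> cone_dist Z m w"
  by (rule cone_dist_attained[of Z m w]) auto

lemma cone_dist_antimono_cone:
  assumes "Z \<subseteq> Z'"
  shows "cone_dist Z m w \<le> cone_dist Z' m w"
proof -
  obtain g where "g \<in> delta2_cone Z' m" "cone_dist Z' m w = L2_set (\<lambda>k. g k - w k) {..m}"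
    by (rule cone_dist_attained)
  moreover from this(1) have "g \<in> delta2_cone Z m" using assms by (auto simp: delta2_cone_def)
  ultimately show ?thesis using cone_dist_le[of g Z m w] by simp
qed

text \<open>Moving the point changes its distance to the cone by at most the l2 norm, hence the l1
  norm, of the displacement.\<close>

lemma cone_dist_lipschitz: "coord_lipschitz m 1 (cone_dist Z m)"
proof -
  have le: "cone_dist Z m x \<le> cone_dist Z m y + (\<Sum>i\<le>m. \<bar>x i - y i\<bar>)" for x y
  proof -
    obtain g where g: "g \<in> delta2_cone Z m" "cone_dist Z m y = L2_set (\<lambda>k. g k - y k) {..m}"
      by (rule cone_dist_attained)
    have "cone_dist Z m x \<le> L2_set (\<lambda>k. (g k - y k) + (y k - x k)) {..m}"
      using cone_dist_le[OF g(1), of x] by simp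
    also have "\<dots> \<le> L2_set (\<lambda>k. g k - y k) {..m} + L2_set (\<lambda>k. y k - x k) {..m}"
      by (rule L2_set_triangle_ineq)
    also have "L2_set (\<lambda>k. y k - x k) {..m} \<le> (\<Sum>i\<le>m. \<bar>y i - x i\<bar>)"
      by (rule L2_set_le_sum_abs)
    finally show ?thesis by (simp add: g(2) abs_minus_commute)
  qed
  show ?thesis
    unfolding coord_lipschitz_def
  proof (intro conjI allI)
    fix x y
    show "\<bar>cone_dist Z m x - cone_dist Z m y\<bar> \<le> 1 * (\<Sum>i\<le>m. \<bar>x i - y i\<bar>)"
      using le[of x y] le[of y x] by (simp add: abs_minus_commute abs_le_iff)
  qed simp
qed

text \<open>The same combination of the two projections is again in the cone, so the triangle
  inequality applies. The case \<open>b = 0\<close> leads to positive homogeneity.\<close>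

lemma cone_dist_convex:
  assumes "0 \<le> a" "0 \<le> b"
  shows "cone_dist Z m (\<lambda>k. a * x k + b * y k) \<le> a * cone_dist Z m x + b * cone_dist Z m y"
proof -
  obtain f where f: "f \<in> delta2_cone Z m" "cone_dist Z m x = L2_set (\<lambda>k. f k - x k) {..m}"
    by (rule cone_dist_attained)
  obtain g where g: "g \<in> delta2_cone Z m" "cone_dist Z m y = L2_set (\<lambda>k. g k - y k) {..m}"
    by (rule cone_dist_attained)
  have "cone_dist Z m (\<lambda>k. a * x k + b * y k) \<le> L2_set (\<lambda>k. (a * f k + b * g k) - (a * x k + b * y k)) {..m}"
    by (intro cone_dist_le delta2_cone_combine f g assms)
  also have "\<dots> = L2_set (\<lambda>k. a * (f k - x k) + b * (g k - y k)) {..m}"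
    by (intro L2_set_cong) (auto simp: algebra_simps)
  also have "\<dots> \<le> L2_set (\<lambda>k. a * (f k - x k)) {..m} + L2_set (\<lambda>k. b * (g k - y k)) {..m}"
    by (rule L2_set_triangle_ineq)
  also have "\<dots> = a * cone_dist Z m x + b * cone_dist Z m y"
    using assms by (simp add: f(2) g(2) L2_set_right_distrib)
  finally show ?thesis .
qed

lemma cone_dist_scale:
  assumes "0 < r"
  shows "cone_dist Z m (\<lambda>k. r * w k) = r * cone_dist Z m w"
proof (rule antisym)
  show "cone_dist Z m (\<lambda>k. r * w k) \<le> r * cone_dist Z m w"
    using cone_dist_convex[of r 0 Z m w w] assms by simp
  have "cone_dist Z m (\<lambda>k. inverse r * (r * w k)) \<le> inverse r * cone_dist Z m (\<lambda>k. r * w k)"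
    using cone_dist_convex[of "inverse r" 0 Z m "\<lambda>k. r * w k" "\<lambda>k. r * w k"] assms by simp
  then show "r * cone_dist Z m w \<le> cone_dist Z m (\<lambda>k. r * w k)"
    using assms by (simp add: field_simps)
qed

text \<open>The bound on \<open>Z\<close> keeps \<open>x + 1\<close> within \<open>{..m}\<close>, so
  second differences at points of \<open>Z\<close> see only coordinates that the distance
  controls.\<close>

lemma cone_dist_eq_0_iff:
  assumes "Z \<subseteq> {1..<m}"
  shows "cone_dist Z m w = 0 \<longleftrightarrow> (\<forall>x\<in>Z. 0 \<le> delta2 w x)"
proof
  assume 0: "cone_dist Z m w = 0"
  obtain g where g: "g \<in> delta2_cone Z m" "cone_dist Z m w = L2_set (\<lambda>k. g k - w k) {..m}"
    by (rule cone_dist_attained)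
  have "L2_set (\<lambda>k. g k - w k) {..m} = 0" using 0 g(2) by metis
  then have "\<forall>k\<in>{..m}. g k - w k = 0" by (subst (asm) L2_set_eq_0_iff) auto
  then have gw: "g k = w k" if "k \<le> m" for k using that by auto
  have "delta2 w x = delta2 g x" if "x \<in> Z" for x
  proof -
    have "x + 1 \<le> m" using assms that by auto
    then show ?thesis using gw[of "x + 1"] gw[of x] gw[of "x - 1"] by (simp add: delta2_def)
  qed
  then show "\<forall>x\<in>Z. 0 \<le> delta2 w x" using g(1) by (simp add: delta2_cone_def)
next
  assume nn: "\<forall>x\<in>Z. 0 \<le> delta2 w x"
  define g where "g k = (if k \<le> m then w k else 0)" for k
  have "delta2 g x = delta2 w x" if "x \<in> Z" for x
  proof -
    have "x + 1 \<le> m" using assms that by auto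
    then have "x + 1 \<le> m" "x \<le> m" "x - 1 \<le> m" by linarith+
    then show ?thesis by (simp add: delta2_def g_def)
  qed
  with nn have "g \<in> delta2_cone Z m" by (simp add: delta2_cone_def g_def)
  note cone_dist_le[OF this, of w]
  also have "L2_set (\<lambda>k. g k - w k) {..m} = L2_set (\<lambda>k. 0) {..m}"
    by (intro L2_set_cong) (auto simp: g_def)
  finally have "cone_dist Z m w \<le> L2_set (\<lambda>k. 0) {..m}" .
  then show "cone_dist Z m w = 0" using cone_dist_nonneg[of Z m w] by (simp add: L2_set_def)
qed

text \<open>Along a direction interior to the cone, the distance is a convex function that is eventually
  zero, so each positive value is taken at most once.\<close>
lemma finite_cone_dist_level:
  assumes Z: "Z \<subseteq> {1..<m}" and u: "\<And>x. x \<in> Z \<Longrightarrow> 0 < delta2 u x" and "0 < t"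
  shows "finite {\<xi>. cone_dist Z m (\<lambda>k. w k + \<xi> * u k) = t}"
proof -
  define h where "h \<xi> = cone_dist Z m (\<lambda>k. w k + \<xi> * u k)" for \<xi>
  have finZ: "finite Z" using Z finite_subset by blast
  \<comment> \<open>Beyond \<open>\<xi>0\<close> all constraints hold; the sum replaces a maximum
    over \<open>Z\<close> and also covers \<open>Z = {}\<close>.\<close>
  define \<xi>0 where "\<xi>0 = (\<Sum>x\<in>Z. \<bar>delta2 w x\<bar> / delta2 u x)"
  have h0: "h \<xi> = 0" if "\<xi> \<ge> \<xi>0" for \<xi>
    unfolding h_def cone_dist_eq_0_iff[OF Z]
  proof
    fix x assume x: "x \<in> Z"
    have "\<bar>delta2 w x\<bar> / delta2 u x \<le> \<xi>0"
      unfolding \<xi>0_def by (rule member_le_sum[OF x _ finZ]) (use u in \<open>auto intro: divide_nonneg_pos\<close>)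
    with that have "\<bar>delta2 w x\<bar> / delta2 u x \<le> \<xi>" by (rule order_trans[rotated])
    then have "\<bar>delta2 w x\<bar> \<le> \<xi> * delta2 u x" using u[OF x] by (simp add: pos_divide_le_eq)
    then show "0 \<le> delta2 (\<lambda>k. w k + \<xi> * u k) x" by (simp add: delta2_add delta2_scale)
  qed
  have "\<xi>1 = \<xi>2" if "h \<xi>1 = t" "h \<xi>2 = t" for \<xi>1 \<xi>2
  proof -
    have *: False if lt: "a < b" and ab: "h a = t" "h b = t" for a b
    proof -
      have b: "b < \<xi>0" using h0[of b] ab \<open>0 < t\<close> by (cases "b < \<xi>0") auto
      \<comment> \<open>\<open>b\<close> lies strictly between \<open>a\<close> and
        \<open>\<xi>0\<close>, where \<open>h\<close> vanishes; convexity then makes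
        \<open>h b\<close> smaller than \<open>h a\<close>.\<close>
      define l where "l = (\<xi>0 - b) / (\<xi>0 - a)"
      have l: "0 \<le> l" "l < 1" using lt b by (auto simp: l_def field_simps)
      have "l * (\<xi>0 - a) = \<xi>0 - b" using lt b by (simp add: l_def)
      then have b_eq: "b = l * a + (1 - l) * \<xi>0" by (simp add: algebra_simps)
      have "h b = cone_dist Z m (\<lambda>k. l * (w k + a * u k) + (1 - l) * (w k + \<xi>0 * u k))"
        unfolding h_def b_eq by (simp add: algebra_simps)
      also have "\<dots> \<le> l * h a + (1 - l) * h \<xi>0"
        unfolding h_def by (rule cone_dist_convex) (use l in auto)
      also have "\<dots> < t" using l h0[of \<xi>0] ab \<open>0 < t\<close> by simp
      finally show False using ab by simp
    qed
    show ?thesis using *[of \<xi>1 \<xi>2] *[of \<xi>2 \<xi>1] that by (cases \<xi>1 \<xi>2 rule: linorder_cases) auto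
  qed
  then have "is_singleton {\<xi>. h \<xi> = t} \<or> {\<xi>. h \<xi> = t} = {}"
    by (metis (mono_tags, lifting) is_singletonI' mem_Collect_eq)
  then show ?thesis unfolding h_def by (auto simp: is_singleton_def)
qed

text \<open>The competitor is \<open>p + g\<close> with \<open>g\<close> the projection of the perturbation \<open>d\<close> onto the cone.
  Constants lie in the cone, so \<open>g\<close> sums to 0, and \<open>g (s + 1) \<ge> 0\<close> since lifting a negative last entry
  to \<open>d (s + 1) = 0\<close> would stay in the cone and be closer to \<open>d\<close>.\<close>
lemma convex_competitor:
  fixes p d :: "nat \<Rightarrow> real"
  assumes "\<kappa> > 0" and p: "\<And>k. k \<le> s \<Longrightarrow> \<kappa> \<le> p k" "\<And>k. k > s \<Longrightarrow> p k = 0" "p sums 1"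
    and Z: "Z \<subseteq> {1..s}" "\<And>x. x \<in> Z \<Longrightarrow> delta2 p x = 0"
      "\<And>x. x \<in> {1..s} - Z \<Longrightarrow> \<kappa> \<le> delta2 p x"
    and d: "\<And>k. k > s \<Longrightarrow> d k = 0" "(\<Sum>k\<le>s. d k) = 0" "L2_set d {..s+1} \<le> \<kappa> / 8"
  shows "\<exists>q. convex_pmf_fun q \<and> sqnorm (\<lambda>k. p k + d k - q k) = (cone_dist Z (s + 1) d)\<^sup>2"
proof -
  let ?m = "s + 1"
  obtain g where g: "g \<in> delta2_cone Z ?m" "cone_dist Z ?m d = L2_set (\<lambda>k. g k - d k) {..?m}"
    and min: "\<And>h. h \<in> delta2_cone Z ?m \<Longrightarrow> L2_set (\<lambda>k. g k - d k) {..?m} \<le> L2_set (\<lambda>k. h k - d k) {..?m}"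
    by (rule cone_dist_attained[of Z ?m d]) blast
  have g0: "g k = 0" if "k > ?m" for k using g(1) that by (simp add: delta2_cone_def)
  have gZ: "0 \<le> delta2 g x" if "x \<in> Z" for x using g(1) that by (simp add: delta2_cone_def)
  have min': "(\<Sum>k\<le>?m. (g k - d k)\<^sup>2) \<le> (\<Sum>k\<le>?m. (h k - d k)\<^sup>2)" if "h \<in> delta2_cone Z ?m" for h
    using min[OF that] by (simp add: L2_set_def del: sum.atMost_Suc)
  have sumg: "(\<Sum>k\<le>?m. g k) = 0"
  proof -
    \<comment> \<open>Subtracting the mean residual \<open>c\<close> from \<open>g\<close> stays in
      the cone and lowers the squared distance by \<open>\<sigma>^2\<close> over the number of
      coordinates; minimality leaves only \<open>\<sigma> = 0\<close>.\<close>
    define \<sigma> where "\<sigma> = (\<Sum>k\<le>?m. g k - d k)"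
    define c where "c = \<sigma> / real (?m + 1)"
    define h where "h k = (if k \<le> ?m then g k - c else 0)" for k
    have "h \<in> delta2_cone Z ?m"
    proof -
      have "delta2 h x = delta2 g x" if "x \<in> Z" for x
        using Z(1) that by (force simp: h_def delta2_def)
      then show ?thesis using gZ by (auto simp: delta2_cone_def h_def)
    qed
    note min'[OF this]
    also have "(\<Sum>k\<le>?m. (h k - d k)\<^sup>2) = (\<Sum>k\<le>?m. ((g k - d k) - c)\<^sup>2)"
      by (intro sum.cong) (auto simp: h_def algebra_simps)
    also have "\<dots> = (\<Sum>k\<le>?m. (g k - d k)\<^sup>2 - 2 * c * (g k - d k) + c\<^sup>2)"
      by (intro sum.cong) (auto simp: power2_eq_square algebra_simps)
    also have "\<dots> = (\<Sum>k\<le>?m. (g k - d k)\<^sup>2) - 2 * c * \<sigma> + real (?m + 1) * c\<^sup>2"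
    proof -
      have "(\<Sum>k\<le>?m. 2 * c * (g k - d k)) = 2 * c * \<sigma>" by (simp only: \<sigma>_def sum_distrib_left)
      moreover have "(\<Sum>k\<le>?m. c\<^sup>2) = real (?m + 1) * c\<^sup>2" by (simp only: sum_constant card_atMost Suc_eq_plus1)
      ultimately show ?thesis by (simp only: sum.distrib sum_subtractf)
    qed
    also have "\<dots> = (\<Sum>k\<le>?m. (g k - d k)\<^sup>2) - \<sigma>\<^sup>2 / real (?m + 1)"
      by (simp add: c_def power2_eq_square field_simps del: sum.atMost_Suc of_nat_add of_nat_Suc)
    finally have "\<sigma>\<^sup>2 / real (?m + 1) \<le> 0" by linarith
    then have "\<sigma>\<^sup>2 \<le> 0" by (simp add: divide_le_0_iff)
    then have "\<sigma> = 0" by simp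
    then show ?thesis using d by (simp add: \<sigma>_def sum_subtractf)
  qed
  have gm: "0 \<le> g ?m"
  proof (rule ccontr)
    assume neg: "\<not> 0 \<le> g ?m"
    define h where "h = g(?m := 0)"
    have "h \<in> delta2_cone Z ?m"
    proof -
      have "delta2 g x \<le> delta2 h x" if "x \<in> Z" for x
        using Z(1) that neg by (force simp: h_def delta2_def)
      then show ?thesis using gZ g0 by (force simp: delta2_cone_def h_def intro: order_trans)
    qed
    from min'[OF this] have "(\<Sum>k\<le>s. (g k - d k)\<^sup>2) + (g ?m)\<^sup>2 \<le> (\<Sum>k\<le>s. (h k - d k)\<^sup>2) + (h ?m)\<^sup>2"
      using d(1)[of "Suc s"] by simp
    moreover have "(\<Sum>k\<le>s. (h k - d k)\<^sup>2) = (\<Sum>k\<le>s. (g k - d k)\<^sup>2)"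
      by (intro sum.cong) (auto simp: h_def)
    ultimately show False using neg by (simp add: h_def)
  qed
  \<comment> \<open>Since 0 lies in the cone, the norm of \<open>g\<close> is at most twice that of
    \<open>d\<close>. The resulting bound \<kappa> / 4 makes the second differences of
    \<open>g\<close> at most \<kappa>, the slack of the inactive constraints; this fixes the radius
    \<kappa> / 8.\<close>
  have gb: "\<bar>g k\<bar> \<le> \<kappa> / 4" for k
  proof (cases "k \<le> ?m")
    case True
    have "L2_set (\<lambda>k. (g k - d k) + d k) {..?m} \<le> L2_set (\<lambda>k. g k - d k) {..?m} + L2_set d {..?m}"
      by (rule L2_set_triangle_ineq)
    moreover have "L2_set (\<lambda>k. g k - d k) {..?m} \<le> L2_set (\<lambda>k. 0 - d k) {..?m}"
      by (rule min[OF zero_in_delta2_cone])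
    moreover have "L2_set (\<lambda>k. 0 - d k) {..?m} = L2_set d {..?m}" by (simp add: L2_set_def)
    moreover have "\<bar>g k\<bar> \<le> L2_set g {..?m}"
      using member_le_L2_set[of "{..?m}" k "\<lambda>k. \<bar>g k\<bar>"] True by (simp add: L2_set_def)
    ultimately show ?thesis using d(3) by simp
  next
    case False
    then show ?thesis using g0 \<open>\<kappa> > 0\<close> by simp
  qed
  have gd: "\<bar>delta2 g x\<bar> \<le> \<kappa>" for x
    using gb[of "x + 1"] gb[of x] gb[of "x - 1"] unfolding delta2_def by linarith
  define q where "q k = p k + g k" for k
  have "convex_pmf_fun q"
    unfolding convex_pmf_fun_def
  proof (intro conjI allI impI)
    fix k
    consider "k \<le> s" | "k = ?m" | "k > ?m" by linarith
    then show "0 \<le> q k"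
    proof cases
      case 1
      then show ?thesis using p(1)[of k] gb[of k] \<open>\<kappa> > 0\<close> by (simp add: q_def)
    qed (use p(2)[of k] gm g0[of k] in \<open>auto simp: q_def\<close>)
  next
    have "g sums (\<Sum>k\<le>?m. g k)" by (rule sums_finite) (auto simp: g0)
    then have "g sums 0" by (simp only: sumg)
    from sums_add[OF p(3) this] show "q sums 1" by (simp add: q_def[abs_def])
  next
    fix x :: nat assume x: "1 \<le> x"
    have split: "delta2 q x = delta2 p x + delta2 g x" unfolding q_def by (rule delta2_add)
    \<comment> \<open>At \<open>s + 1\<close> the slack is the mass \<open>p s\<close>; at
      \<open>s + 2\<close> the second difference is \<open>g (s + 1)\<close> itself, whose sign was
      secured above.\<close>
    consider "x \<in> Z" | "x \<in> {1..s} - Z" | "x = s + 1" | "x = s + 2" | "x > s + 2" using x by force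
    then show "0 \<le> delta2 q x"
    proof cases
      case 1
      then show ?thesis using Z(2) gZ by (simp add: split)
    next
      case 2
      then show ?thesis using Z(3)[of x] gd[of x] by (simp add: split)
    next
      case 3
      then have "delta2 p x = p s" using p(2) by (simp add: delta2_def)
      then show ?thesis using p(1)[of s] gd[of x] by (simp add: split)
    next
      case 4
      then have "delta2 q x = g ?m" using p(2) g0 by (simp add: delta2_def q_def)
      then show ?thesis using gm by simp
    next
      case 5
      then have "delta2 q x = 0" using p(2) g0 by (simp add: delta2_def q_def)
      then show ?thesis by simp
    qed
  qed
  moreover have "sqnorm (\<lambda>k. p k + d k - q k) = (cone_dist Z ?m d)\<^sup>2"
  proof -
    have "(\<lambda>k. (p k + d k - q k)\<^sup>2) sums (\<Sum>k\<le>?m. (p k + d k - q k)\<^sup>2)"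
      by (rule sums_finite) (auto simp: q_def g0 d(1))
    also have "(\<Sum>k\<le>?m. (p k + d k - q k)\<^sup>2) = (\<Sum>k\<le>?m. (g k - d k)\<^sup>2)"
      by (intro sum.cong) (auto simp: q_def power2_commute)
    also have "\<dots> = (cone_dist Z ?m d)\<^sup>2"
      unfolding g(2) L2_set_def by (simp add: sum_nonneg del: sum.atMost_Suc)
    finally show ?thesis by (simp add: sqnorm_def sums_iff)
  qed
  ultimately show ?thesis by blast
qed

text \<open>By minimality the estimator is at least as close to the empirical pmf as
  \<open>p\<close> is, so estimator and \<open>p\<close> differ by at most v / 4 in each coordinate.
  The weights 1, 2, 1 of a second difference turn this into v, whence the 8.\<close>

lemma delta2_le_of_close:
  assumes p: "convex_pmf_fun p" and n: "n > 0" and x: "delta2 p x = 0"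
    and close: "sqnorm (\<lambda>k. emp_pmf n xs k - p k) \<le> (v / 8)\<^sup>2" "0 < v"
  shows "delta2 (convex_lse n xs) x \<le> v"
proof -
  let ?e = "emp_pmf n xs" and ?l = "convex_lse n xs"
  have bound: "\<bar>?e k - f k\<bar> \<le> v / 8" if f: "convex_pmf_fun f" "sqnorm (\<lambda>k. ?e k - f k) \<le> (v / 8)\<^sup>2" for f k
  proof -
    have "summable (\<lambda>k. (?e k - f k)\<^sup>2)"
      by (rule convex_pmf_fun_summable_diff_square[OF f(1), of "sample_max n xs"])
        (rule emp_pmf_beyond_sample_max)
    then have "(?e k - f k)\<^sup>2 \<le> sqnorm (\<lambda>k. ?e k - f k)"
      using sum_le_suminf[of "\<lambda>k. (?e k - f k)\<^sup>2" "{k}"] by (simp add: sqnorm_def)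
    also have "\<dots> \<le> (v / 8)\<^sup>2" by (rule f)
    finally show ?thesis using \<open>0 < v\<close> by (simp flip: abs_le_square_iff)
  qed
  have "sqnorm (\<lambda>k. ?e k - ?l k) \<le> (v / 8)\<^sup>2"
    using convex_lse_properties(2)[OF n p, of xs] close by simp
  then have "\<bar>?l k - p k\<bar> \<le> v / 4" for k
    using bound[OF convex_lse_properties(1)[OF n], of xs k] bound[OF p close(1), of k] by linarith
  from this[of "x + 1"] this[of x] this[of "x - 1"] show ?thesis
    using x unfolding delta2_def by linarith
qed

subsection \<open>The limiting Gaussian law\<close>

text \<open>The quadratic form is the variance of \<open>c\<close> under \<open>e\<close>; this
  shows that it is nonnegative for a pmf \<open>e\<close> and matches it with the variance in the
  central limit theorem.\<close>

lemma quadratic_form_multinomial: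
  fixes e c :: "nat \<Rightarrow> real"
  assumes "(\<Sum>k\<le>m. e k) = 1"
  shows "(\<Sum>i\<le>m. \<Sum>j\<le>m. c i * c j * ((if i = j then e i else 0) - e i * e j)) =
     (\<Sum>k\<le>m. e k * (c k - (\<Sum>j\<le>m. c j * e j))\<^sup>2)"
proof -
  let ?\<mu> = "\<Sum>j\<le>m. c j * e j"
  have "(\<Sum>i\<le>m. \<Sum>j\<le>m. c i * c j * ((if i = j then e i else 0) - e i * e j)) =
      (\<Sum>i\<le>m. \<Sum>j\<le>m. (if i = j then c i * c j * e i else 0)) - (\<Sum>i\<le>m. \<Sum>j\<le>m. (c i * e i) * (c j * e j))"
    unfolding sum_subtractf[symmetric] by (intro sum.cong refl) (auto simp: algebra_simps)
  also have "(\<Sum>i\<le>m. \<Sum>j\<le>m. (if i = j then c i * c j * e i else 0)) = (\<Sum>k\<le>m. e k * (c k)\<^sup>2)"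
    by (simp add: power2_eq_square mult.commute mult.left_commute)
  also have "(\<Sum>i\<le>m. \<Sum>j\<le>m. (c i * e i) * (c j * e j)) = ?\<mu>\<^sup>2"
    by (simp only: power2_eq_square sum_product)
  finally have l: "(\<Sum>i\<le>m. \<Sum>j\<le>m. c i * c j * ((if i = j then e i else 0) - e i * e j)) =
      (\<Sum>k\<le>m. e k * (c k)\<^sup>2) - ?\<mu>\<^sup>2" .
  have "(\<Sum>k\<le>m. e k * (c k - ?\<mu>)\<^sup>2) = (\<Sum>k\<le>m. e k * (c k)\<^sup>2 - 2 * ?\<mu> * (c k * e k) + ?\<mu>\<^sup>2 * e k)"
    by (intro sum.cong) (auto simp: power2_eq_square algebra_simps)
  also have "\<dots> = (\<Sum>k\<le>m. e k * (c k)\<^sup>2) - 2 * ?\<mu> * ?\<mu> + ?\<mu>\<^sup>2 * (\<Sum>k\<le>m. e k)"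
    by (simp only: sum.distrib sum_subtractf sum_distrib_left[symmetric])
  also have "\<dots> = (\<Sum>k\<le>m. e k * (c k)\<^sup>2) - ?\<mu>\<^sup>2"
    using assms by (simp add: power2_eq_square)
  finally show ?thesis using l by simp
qed

lemma gaussian_vec_properties:
  assumes M: "prob_space M" and g: "gaussian_vec M g m C"
    and nn: "\<And>c. 0 \<le> (\<Sum>i\<le>m. \<Sum>j\<le>m. c i * c j * C i j)"
  shows "k \<le> m \<Longrightarrow> (\<lambda>\<omega>. g \<omega> k) \<in> borel_measurable M"
    and "k \<le> m \<Longrightarrow> integrable M (\<lambda>\<omega>. (g \<omega> k)\<^sup>2)"
    and "k \<le> m \<Longrightarrow> (\<integral>\<omega>. (g \<omega> k)\<^sup>2 \<partial>M) = C k k"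
    and "(\<integral>\<omega>. cos ((\<Sum>i\<le>m. c i * g \<omega> i) + b) \<partial>M) = cos b * exp (- (\<Sum>i\<le>m. \<Sum>j\<le>m. c i * c j * C i j) / 2)"
proof -
  show meas: "(\<lambda>\<omega>. g \<omega> k) \<in> borel_measurable M" if "k \<le> m" for k
    using g that by (simp add: gaussian_vec_def)
  have lin: "(\<lambda>\<omega>. \<Sum>i\<le>m. c i * g \<omega> i) \<in> borel_measurable M" for c
    by (intro borel_measurable_sum borel_measurable_times meas) auto
  note normal = centered_normal_cos_and_square[OF M, of "\<lambda>\<omega>. \<Sum>i\<le>m. c i * g \<omega> i"
      "\<Sum>i\<le>m. \<Sum>j\<le>m. c i * c j * C i j" for c]
  have ass: "(\<Sum>i\<le>m. \<Sum>j\<le>m. c i * c j * C i j) = 0 \<Longrightarrow> AE \<omega> in M. (\<Sum>i\<le>m. c i * g \<omega> i) = 0"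
    "(\<Sum>i\<le>m. \<Sum>j\<le>m. c i * c j * C i j) \<noteq> 0 \<Longrightarrow> distributed M lborel (\<lambda>\<omega>. \<Sum>i\<le>m. c i * g \<omega> i)
       (\<lambda>x. ennreal (normal_density 0 (sqrt (\<Sum>i\<le>m. \<Sum>j\<le>m. c i * c j * C i j)) x))" for c
    using g by (simp_all add: gaussian_vec_def Let_def atLeast0AtMost)
  show "(\<integral>\<omega>. cos ((\<Sum>i\<le>m. c i * g \<omega> i) + b) \<partial>M) = cos b * exp (- (\<Sum>i\<le>m. \<Sum>j\<le>m. c i * c j * C i j) / 2)"
    by (rule normal(1)[OF lin nn ass])
  fix k assume k: "k \<le> m"
  let ?c = "\<lambda>i. if i = k then 1 else (0::real)"
  have dl: "(\<Sum>i\<le>m. ?c i * f i) = f k" for f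
    using k by (simp add: if_distrib[of "\<lambda>t. t * _"] cong: if_cong)
  note s = dl[of "g _"]
  have V: "(\<Sum>i\<le>m. \<Sum>j\<le>m. ?c i * ?c j * C i j) = C k k"
  proof -
    have "(\<Sum>i\<le>m. \<Sum>j\<le>m. ?c i * ?c j * C i j) = (\<Sum>i\<le>m. ?c i * (\<Sum>j\<le>m. ?c j * C i j))"
      by (simp only: sum_distrib_left mult.assoc)
    then show ?thesis by (simp only: dl)
  qed
  have "integrable M (\<lambda>\<omega>. (\<Sum>i\<le>m. ?c i * g \<omega> i)\<^sup>2)"
    by (rule normal(2)[of ?c, OF lin nn ass])
  then show "integrable M (\<lambda>\<omega>. (g \<omega> k)\<^sup>2)" by (simp only: s)
  have "(\<integral>\<omega>. (\<Sum>i\<le>m. ?c i * g \<omega> i)\<^sup>2 \<partial>M) = (\<Sum>i\<le>m. \<Sum>j\<le>m. ?c i * ?c j * C i j)"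
    by (rule normal(3)[of ?c, OF lin nn ass])
  then show "(\<integral>\<omega>. (g \<omega> k)\<^sup>2 \<partial>M) = C k k" by (simp only: s V)
qed

text \<open>The multinomial Gaussian law with one direction \<open>u\<close> of its support split off as an independent
  component: \<open>a j\<close> is the \<open>j\<close>-th column of the square root \<open>\<delta>\<^sub>j\<^sub>k \<surd>p\<^sub>j - p\<^sub>k \<surd>p\<^sub>j\<close> of the covariance
  after removing its regression on the functional \<open>g \<mapsto> \<Sum>\<^sub>k u\<^sub>k g\<^sub>k / p\<^sub>k\<close>.\<close>
lemma multinomial_gaussian_exists:
  fixes p u :: "nat \<Rightarrow> real"
  assumes p: "\<And>k. k \<le> s \<Longrightarrow> 0 < p k" "p (s + 1) = 0"
    and u: "u (s + 1) = 0" "(\<Sum>k\<le>s. u k) = 0" "\<exists>k\<le>s. u k \<noteq> 0"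
  shows "\<exists>(N0 :: (nat \<Rightarrow> real) measure) \<tau>. prob_space N0 \<and> sets N0 = sets borel \<and> 0 < \<tau> \<and>
    (\<forall>k. integrable (gauss_shift N0 (\<lambda>k. \<tau> * u k)) (\<lambda>x. (x k)\<^sup>2)) \<and>
    (\<forall>c b. (\<integral>x. cos ((\<Sum>k\<le>s+1. c k * x k) + b) \<partial>gauss_shift N0 (\<lambda>k. \<tau> * u k)) =
       cos b * exp (- (\<Sum>k\<le>s+1. p k * (c k - (\<Sum>j\<le>s+1. c j * p j))\<^sup>2) / 2))"
proof -
  \<comment> \<open>Because \<open>u\<close> sums to 0, \<open>V\<close> is the variance of the
    functional with coefficients u / p, whose covariance with the k-th coordinate is
    \<open>u k\<close>. The regression part of the vector is therefore u / V times the functional,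
    that is, u / sqrt V times a standard normal variable, which gives \<open>\<tau>\<close>.\<close>
  define V where "V = (\<Sum>j\<le>s. (u j)\<^sup>2 / p j)"
  have V: "V > 0"
  proof -
    obtain k where k: "k \<le> s" "u k \<noteq> 0" using u(3) by blast
    then show ?thesis unfolding V_def
      by (intro sum_pos2[of _ k]) (auto simp: p less_imp_le)
  qed
  define a where "a j k = sqrt (p j) * ((if k = j then 1 else 0) - p k) - u k * u j / (sqrt (p j) * V)" for j k
  define \<tau> where "\<tau> = 1 / sqrt V"
  have \<tau>: "\<tau> > 0" using V by (simp add: \<tau>_def)
  obtain N0 :: "(nat \<Rightarrow> real) measure" where N0: "prob_space N0" "sets N0 = sets borel"
    "\<And>k. integrable N0 (\<lambda>x. (x k)\<^sup>2)"
    "\<And>c b. (\<integral>x. cos ((\<Sum>k\<le>s+1. c k * x k) + b) \<partial>N0) =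
       cos b * exp (- (\<Sum>j<Suc s. (\<Sum>k\<le>s+1. c k * a j k)\<^sup>2) / 2)"
    using gaussian_measure_exists[where a=a and m="s + 1" and d="Suc s"] by blast
  have var: "(\<Sum>j<Suc s. (\<Sum>k\<le>s+1. c k * a j k)\<^sup>2) + (\<Sum>k\<le>s+1. c k * (\<tau> * u k))\<^sup>2 =
      (\<Sum>k\<le>s+1. p k * (c k - (\<Sum>j\<le>s+1. c j * p j))\<^sup>2)" for c
  proof -
    define \<mu> where "\<mu> = (\<Sum>j\<le>s+1. c j * p j)"
    define t where "t = (\<Sum>k\<le>s+1. c k * u k)"
    have t': "t = (\<Sum>k\<le>s. c k * u k)" using u(1) by (simp add: t_def)
    have lin: "(\<Sum>k\<le>s+1. c k * a j k) = sqrt (p j) * (c j - \<mu>) - t * u j / (sqrt (p j) * V)" if "j \<le> s" for j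
    proof -
      have "(\<Sum>k\<le>s+1. c k * a j k) = (\<Sum>k\<le>s+1. sqrt (p j) * (if k = j then c k else 0)
          - sqrt (p j) * (c k * p k) - u j / (sqrt (p j) * V) * (c k * u k))"
        by (intro sum.cong) (auto simp: a_def algebra_simps)
      also have "\<dots> = sqrt (p j) * (\<Sum>k\<le>s+1. if k = j then c k else 0) - sqrt (p j) * \<mu> - u j / (sqrt (p j) * V) * t"
        by (simp only: sum_subtractf sum_distrib_left[symmetric] \<mu>_def t_def)
      also have "(\<Sum>k\<le>s+1. if k = j then c k else 0) = c j" using that by (subst sum.delta) auto
      finally show ?thesis by (simp add: algebra_simps)
    qed
    have sq: "(\<Sum>k\<le>s+1. c k * a j k)\<^sup>2 = p j * (c j - \<mu>)\<^sup>2 - 2 * t / V * (c j * u j) + 2 * t / V * \<mu> * u j + t\<^sup>2 / V\<^sup>2 * ((u j)\<^sup>2 / p j)"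
      if "j \<le> s" for j
    proof -
      have r: "sqrt (p j) * sqrt (p j) = p j" "sqrt (p j) \<noteq> 0" using p(1)[OF that] by auto
      have "(q * y - t * w / (q * V))\<^sup>2 = (q * q) * y\<^sup>2 - 2 * t / V * (y * w) + t\<^sup>2 / V\<^sup>2 * (w\<^sup>2 / (q * q))" if "q \<noteq> 0" for q y w :: real
        using that V by (simp add: power2_eq_square field_simps)
      from this[OF r(2), of "c j - \<mu>" "u j"] show ?thesis
        unfolding lin[OF that] r(1) by (simp add: algebra_simps)
    qed
    have "(\<Sum>j<Suc s. (\<Sum>k\<le>s+1. c k * a j k)\<^sup>2) =
       (\<Sum>j\<le>s. p j * (c j - \<mu>)\<^sup>2 - 2 * t / V * (c j * u j) + 2 * t / V * \<mu> * u j + t\<^sup>2 / V\<^sup>2 * ((u j)\<^sup>2 / p j))"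
      unfolding lessThan_Suc_atMost by (intro sum.cong sq) auto
    also have "\<dots> = (\<Sum>j\<le>s. p j * (c j - \<mu>)\<^sup>2) - 2 * t / V * t + 2 * t / V * \<mu> * 0 + t\<^sup>2 / V\<^sup>2 * V"
      by (simp only: sum.distrib sum_subtractf sum_distrib_left[symmetric] t'[symmetric] V_def[symmetric] u(2))
    also have "\<dots> = (\<Sum>j\<le>s. p j * (c j - \<mu>)\<^sup>2) - t\<^sup>2 / V"
      using V by (simp add: power2_eq_square field_simps)
    finally have 1: "(\<Sum>j<Suc s. (\<Sum>k\<le>s+1. c k * a j k)\<^sup>2) = (\<Sum>j\<le>s. p j * (c j - \<mu>)\<^sup>2) - t\<^sup>2 / V" .
    have "(\<Sum>k\<le>s+1. c k * (\<tau> * u k)) = \<tau> * t"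
      unfolding t_def sum_distrib_left by (intro sum.cong) auto
    then have "(\<Sum>k\<le>s+1. c k * (\<tau> * u k))\<^sup>2 = t\<^sup>2 / V"
      using V by (simp only: power_mult_distrib) (simp add: \<tau>_def power_divide)
    with 1 show ?thesis using p(2) by (simp add: \<mu>_def)
  qed
  have "(\<integral>x. cos ((\<Sum>k\<le>s+1. c k * x k) + b) \<partial>gauss_shift N0 (\<lambda>k. \<tau> * u k)) =
       cos b * exp (- (\<Sum>k\<le>s+1. p k * (c k - (\<Sum>j\<le>s+1. c j * p j))\<^sup>2) / 2)" for c b
    unfolding gauss_shift_cos[OF N0(1,2,4)] exp_add[symmetric] var[symmetric] by (simp add: field_simps)
  moreover have "integrable (gauss_shift N0 (\<lambda>k. \<tau> * u k)) (\<lambda>x. (x k)\<^sup>2)" for k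
    by (rule gauss_shift_square_integrable) (use N0 in auto)
  ultimately show ?thesis using N0(1,2) \<tau> by blast
qed

text \<open>In terms of \<open>j = s + 1 - k\<close> this is the convex function \<open>j\<^sup>2 + \<beta> j\<close>, with \<open>\<beta>\<close> chosen to make it
  sum to 0.\<close>
lemma strictly_convex_direction_exists:
  "\<exists>u :: nat \<Rightarrow> real. u (s + 1) = 0 \<and> (\<Sum>k\<le>s. u k) = 0 \<and> (\<forall>x\<in>{1..s}. delta2 u x = 2)"
proof -
  define j where "j k = real s + 1 - real k" for k
  define \<beta> where "\<beta> = - (\<Sum>k\<le>s. (j k)\<^sup>2) / (\<Sum>k\<le>s. j k)"
  have pos: "(\<Sum>k\<le>s. j k) > 0" by (intro sum_pos) (auto simp: j_def)
  have "(\<Sum>k\<le>s. (j k)\<^sup>2 + \<beta> * j k) = 0"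
  proof -
    have "(\<Sum>k\<le>s. (j k)\<^sup>2 + \<beta> * j k) = (\<Sum>k\<le>s. (j k)\<^sup>2) + \<beta> * (\<Sum>k\<le>s. j k)"
      by (simp only: sum.distrib sum_distrib_left)
    then show ?thesis using pos by (simp add: \<beta>_def)
  qed
  moreover have "delta2 (\<lambda>k. (j k)\<^sup>2 + \<beta> * j k) x = 2" if "x \<in> {1..s}" for x
    using that by (simp add: delta2_def j_def power2_eq_square of_nat_diff algebra_simps)
  ultimately show ?thesis
    by (intro exI[of _ "\<lambda>k. (j k)\<^sup>2 + \<beta> * j k"]) (simp add: j_def)
qed

text \<open>A level below 1 makes the set in the definition nonempty, as the distribution function
  tends to 1; the infimum of an empty set would carry no information.\<close>

lemma quantile_ge:
  assumes M: "prob_space M" and [measurable]: "Y \<in> borel_measurable M" and \<beta>: "\<beta> < 1"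
    and less: "\<And>t'. t' < t \<Longrightarrow> measure M {\<omega> \<in> space M. Y \<omega> \<le> t'} < \<beta>"
  shows "t \<le> quantile M Y \<beta>"
proof -
  interpret prob_space M by fact
  interpret D: real_distribution "distr M borel Y" by (rule real_distribution_distr) simp
  have cdf: "cdf (distr M borel Y) t = prob {\<omega> \<in> space M. Y \<omega> \<le> t}" for t
    by (simp add: cdf_def measure_distr vimage_def Int_def conj_commute)
  have "eventually (\<lambda>t. \<beta> < cdf (distr M borel Y) t) at_top"
    using D.cdf_lim_at_top_prob \<beta> by (rule order_tendstoD)
  then obtain t0 where "\<beta> < cdf (distr M borel Y) t0"
    by (auto simp: eventually_at_top_linorder)
  then have ne: "{t. \<beta> \<le> prob {\<omega> \<in> space M. Y \<omega> \<le> t}} \<noteq> {}"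
    using less_imp_le by (auto simp: cdf)
  show ?thesis
    unfolding quantile_def
  proof (rule cInf_greatest[OF ne])
    fix x assume "x \<in> {t. \<beta> \<le> prob {\<omega> \<in> space M. Y \<omega> \<le> t}}"
    then show "t \<le> x" using less[of x] by (cases "x < t") auto
  qed
qed

subsection \<open>Asymptotic level of the test\<close>

text \<open>The hypotheses on \<open>p0\<close> in quantitative form: \<open>s\<close> is the exact
  maximum of the support, \<open>Z\<close> the set of active constraints, and one constant
  \<open>\<kappa>\<close> bounds from below the masses on \<open>{..s}\<close> and all positive
  second differences in \<open>{1..s}\<close>. Small perturbations then endanger only the
  constraints in \<open>Z\<close>.\<close>

locale convex_truth =
  fixes p0 :: "nat pmf" and s :: nat and Z :: "nat set" and \<kappa> :: real
  assumes supp: "set_pmf p0 \<subseteq> {..s}" and \<kappa>: "0 < \<kappa>"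
    and p0_ge: "k \<le> s \<Longrightarrow> \<kappa> \<le> pmf p0 k"
    and Z_sub: "Z \<subseteq> {1..s}" and Z_eq: "x \<in> Z \<Longrightarrow> delta2 (pmf p0) x = 0"
    and Z_gt: "x \<in> {1..s} - Z \<Longrightarrow> \<kappa> \<le> delta2 (pmf p0) x"
begin

abbreviation "sample n \<equiv> Pi_pmf {..<n} (0::nat) (\<lambda>_::nat. p0)"

definition dev :: "nat \<Rightarrow> (nat \<Rightarrow> nat) \<Rightarrow> real" where
  "dev n xs = L2_set (\<lambda>k. emp_pmf n xs k - pmf p0 k) {..s+1}"

definition scaled_dev :: "nat \<Rightarrow> (nat \<Rightarrow> nat) \<Rightarrow> nat \<Rightarrow> real" where
  "scaled_dev n xs k = sqrt (real n) * (emp_pmf n xs k - pmf p0 k)"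

lemma p0_beyond: "k > s \<Longrightarrow> pmf p0 k = 0"
  using supp by (auto simp: pmf_eq_0_set_pmf)

lemma fin_p0: "finite (set_pmf p0)"
  using supp finite_subset by blast

lemma sum_p0: "(\<Sum>k\<le>s. pmf p0 k) = 1"
  using supp by (intro sum_pmf_eq_1) auto

lemma p0_sums: "pmf p0 sums 1"
proof -
  have "pmf p0 sums (\<Sum>k\<le>s. pmf p0 k)"
    by (rule sums_finite) (auto simp: p0_beyond)
  then show ?thesis by (simp only: sum_p0)
qed

lemma convex_p0: "convex_pmf_fun (pmf p0)"
  unfolding convex_pmf_fun_def
proof (intro conjI allI impI p0_sums)
  fix k :: nat assume k: "1 \<le> k"
  show "0 \<le> delta2 (pmf p0) k"
  proof (cases "k \<le> s")
    case True
    then show ?thesis using Z_eq[of k] Z_gt[of k] \<kappa> k by (cases "k \<in> Z") auto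
  next
    case False
    then show ?thesis by (simp add: delta2_def p0_beyond)
  qed
qed simp

lemma dev_coord: "k \<le> s + 1 \<Longrightarrow> \<bar>emp_pmf n xs k - pmf p0 k\<bar> \<le> dev n xs"
  using member_le_L2_set[of "{..s+1}" k "\<lambda>k. \<bar>emp_pmf n xs k - pmf p0 k\<bar>"]
  unfolding dev_def L2_set_def by (simp del: sum.atMost_Suc)

lemma dev_square: "(dev n xs)\<^sup>2 = (\<Sum>k\<le>s+1. (emp_pmf n xs k - pmf p0 k)\<^sup>2)"
  unfolding dev_def L2_set_def by (simp add: sum_nonneg del: sum.atMost_Suc)

lemma dev_nonneg: "0 \<le> dev n xs"
  by (simp add: dev_def)

lemma emp_pmf_beyond:
  assumes "\<And>i. i < n \<Longrightarrow> xs i \<le> s" "k > s"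
  shows "emp_pmf n xs k = 0"
proof -
  have "{i. i < n \<and> xs i = k} = {}" using assms by (auto simp: not_le[symmetric])
  then show ?thesis by (simp only: emp_pmf_def card.empty)
qed

text \<open>A deviation below \<kappa> leaves the point \<open>s\<close> with positive empirical
  mass, so it is observed. The bootstrap vector then has the fixed dimension s + 2.\<close>

lemma sample_max_eq:
  assumes "n > 0" "\<And>i. i < n \<Longrightarrow> xs i \<le> s" "dev n xs < \<kappa>"
  shows "sample_max n xs = s"
proof -
  have "emp_pmf n xs s \<noteq> 0"
    using dev_coord[of s n xs] p0_ge[of s] assms(3) by auto
  then have "{i. i < n \<and> xs i = s} \<noteq> {}" unfolding emp_pmf_def by (metis card.empty div_0 of_nat_0)
  then obtain i where "i < n" "xs i = s" by auto
  then show ?thesis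
    unfolding sample_max_def by (intro Max_eqI) (use assms(2) in auto)
qed

lemma sqnorm_emp_pmf_diff:
  assumes "\<And>i. i < n \<Longrightarrow> xs i \<le> s"
  shows "sqnorm (\<lambda>k. emp_pmf n xs k - pmf p0 k) = (dev n xs)\<^sup>2"
proof -
  have "(\<lambda>k. (emp_pmf n xs k - pmf p0 k)\<^sup>2) sums (\<Sum>k\<le>s+1. (emp_pmf n xs k - pmf p0 k)\<^sup>2)"
    by (rule sums_finite) (auto simp: p0_beyond emp_pmf_beyond[OF assms])
  then show ?thesis by (simp only: sqnorm_def sums_iff dev_square)
qed

lemma statistic_le:
  assumes n: "n > 0" and xs: "\<And>i. i < n \<Longrightarrow> xs i \<le> s" and close: "dev n xs \<le> \<kappa> / 8"
  shows "real n * sqnorm (\<lambda>j. emp_pmf n xs j - convex_lse n xs j) \<le> (cone_dist Z (s + 1) (scaled_dev n xs))\<^sup>2"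
proof -
  let ?d = "\<lambda>k. emp_pmf n xs k - pmf p0 k"
  have "\<exists>q. convex_pmf_fun q \<and> sqnorm (\<lambda>k. pmf p0 k + ?d k - q k) = (cone_dist Z (s + 1) ?d)\<^sup>2"
  proof (rule convex_competitor[OF \<kappa>])
    show "(\<Sum>k\<le>s. ?d k) = 0"
      using sum_emp_pmf_eq_1[OF n xs] sum_p0 by (simp add: sum_subtractf)
    show "L2_set ?d {..s + 1} \<le> \<kappa> / 8" using close by (simp only: dev_def)
  qed (use p0_ge p0_beyond p0_sums Z_sub Z_eq Z_gt emp_pmf_beyond[OF xs] in auto)
  then obtain q where q: "convex_pmf_fun q" "sqnorm (\<lambda>k. emp_pmf n xs k - q k) = (cone_dist Z (s + 1) ?d)\<^sup>2"
    by auto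
  have "real n * sqnorm (\<lambda>j. emp_pmf n xs j - convex_lse n xs j) \<le> real n * (cone_dist Z (s + 1) ?d)\<^sup>2"
    using convex_lse_properties(2)[OF n q(1), of xs] q(2) by (intro mult_left_mono) auto
  also have "\<dots> = (sqrt (real n) * cone_dist Z (s + 1) ?d)\<^sup>2"
    by (simp add: power_mult_distrib)
  also have "sqrt (real n) * cone_dist Z (s + 1) ?d = cone_dist Z (s + 1) (scaled_dev n xs)"
    using n by (subst cone_dist_scale[symmetric]) (auto simp: scaled_dev_def[abs_def])
  finally show ?thesis .
qed

text \<open>Near \<open>p0\<close> the fitted second differences on \<open>Z\<close> stay below the
  threshold, so every active constraint is selected and the data-dependent cone is contained in the
  limiting one.\<close>

lemma T_hat_ge:
  assumes n: "n > 0" and xs: "\<And>i. i < n \<Longrightarrow> xs i \<le> s" and close: "dev n xs < \<kappa>" "dev n xs \<le> v n / 8"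
    and v: "0 < v n"
  shows "(cone_dist Z (s + 1) w)\<^sup>2 \<le> T_hat v n xs w"
proof -
  have "delta2 (convex_lse n xs) x \<le> v n" if "x \<in> Z" for x
  proof (rule delta2_le_of_close[OF convex_p0 n Z_eq[OF that] _ v])
    show "sqnorm (\<lambda>k. emp_pmf n xs k - pmf p0 k) \<le> (v n / 8)\<^sup>2"
    proof -
      have "sqnorm (\<lambda>k. emp_pmf n xs k - pmf p0 k) = (dev n xs)\<^sup>2"
        by (rule sqnorm_emp_pmf_diff) (rule xs)
      then show ?thesis using power_mono[OF close(2) dev_nonneg, of 2] by simp
    qed
  qed
  moreover have sm: "sample_max n xs = s"
    by (rule sample_max_eq[OF n _ close(1)]) (rule xs)
  ultimately have "Z \<subseteq> {x \<in> {1..s}. delta2 (convex_lse n xs) x \<le> v n}"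
    using Z_sub by auto
  from cone_dist_antimono_cone[OF this] show ?thesis
    unfolding T_hat_eq_cone_dist sm by (intro power_mono cone_dist_nonneg)
qed

text \<open>The radii serve, in turn, the Gaussian approximation of the bootstrap law, the convex
  competitor, and the selection of constraints. The support condition is listed because
  \<open>xs\<close> ranges over all functions, while the sample obeys it only almost surely.\<close>

definition good :: "real \<Rightarrow> (nat \<Rightarrow> real) \<Rightarrow> nat \<Rightarrow> (nat \<Rightarrow> nat) set" where
  "good \<delta> v n = {xs. (\<forall>i<n. xs i \<le> s) \<and> dev n xs < \<delta> \<and> dev n xs < \<kappa> / 8 \<and> dev n xs < v n / 8}"

lemma prob_dev_ge:
  assumes "n > 0" "0 < e"
  shows "measure_pmf.prob (sample n) {xs. e \<le> dev n xs} \<le> real (s + 2) / (real n * e\<^sup>2)"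
proof -
  have "{xs. e \<le> dev n xs} = {xs. e\<^sup>2 \<le> (\<Sum>k\<le>s+1. (emp_pmf n xs k - pmf p0 k)\<^sup>2)}"
    unfolding dev_square[symmetric] using assms(2) dev_nonneg[of n] by (simp add: power_mono_iff)
  then show ?thesis
    using prob_emp_pmf_deviation[OF fin_p0 assms(1), of "e\<^sup>2" "s + 1"] assms(2) by simp
qed

text \<open>Chebyshev at radius \<open>v n / 8\<close> gives a bound of order 1 / (n (v n)^2), which
  vanishes by the rate of \<open>v\<close>.\<close>

lemma tendsto_prob_not_good:
  assumes "0 < \<delta>" and v: "\<And>n. 0 < v n" "filterlim (\<lambda>n. sqrt (real n) * v n) at_top sequentially"
  shows "(\<lambda>n. measure_pmf.prob (sample n) (- good \<delta> v n)) \<longlonglongrightarrow> 0"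
proof (rule tendsto_sandwich[OF _ _ tendsto_const])
  let ?B = "\<lambda>n. real (s + 2) / (real n * \<delta>\<^sup>2) + real (s + 2) / (real n * (\<kappa> / 8)\<^sup>2) + real (s + 2) / (real n * (v n / 8)\<^sup>2)"
  show "eventually (\<lambda>n. measure_pmf.prob (sample n) (- good \<delta> v n) \<le> ?B n) sequentially"
    using eventually_gt_at_top[of 0]
  proof eventually_elim
    case (elim n)
    let ?E = "\<lambda>e. {xs. e \<le> dev n xs}"
    have "measure_pmf.prob (sample n) (- good \<delta> v n) = measure_pmf.prob (sample n) (- good \<delta> v n \<inter> set_pmf (sample n))"
      by (rule measure_Int_set_pmf[symmetric])
    also have "\<dots> \<le> measure_pmf.prob (sample n) (?E \<delta> \<union> ?E (\<kappa> / 8) \<union> ?E (v n / 8))"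
    proof (rule measure_pmf.finite_measure_mono)
      have "xs i \<le> s" if "xs \<in> set_pmf (sample n)" "i < n" for xs i
        using that supp by (auto simp: set_Pi_pmf PiE_dflt_def)
      then show "- good \<delta> v n \<inter> set_pmf (sample n) \<subseteq> ?E \<delta> \<union> ?E (\<kappa> / 8) \<union> ?E (v n / 8)"
        unfolding good_def by (auto simp: not_less)
    qed simp
    also have "\<dots> \<le> measure_pmf.prob (sample n) (?E \<delta>) + measure_pmf.prob (sample n) (?E (\<kappa> / 8)) + measure_pmf.prob (sample n) (?E (v n / 8))"
      by (intro order_trans[OF measure_Un_le] add_mono order_refl) auto
    also have "\<dots> \<le> ?B n"
      by (intro add_mono prob_dev_ge elim) (use assms \<kappa> in auto)
    finally show ?case .
  qed
  have "(\<lambda>n. real (s + 2) / (real n * \<delta>\<^sup>2)) \<longlonglongrightarrow> 0" "(\<lambda>n. real (s + 2) / (real n * (\<kappa> / 8)\<^sup>2)) \<longlonglongrightarrow> 0"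
    using \<open>0 < \<delta>\<close> \<kappa> by real_asymp+
  moreover have "(\<lambda>n. real (s + 2) / (real n * (v n / 8)\<^sup>2)) \<longlonglongrightarrow> 0"
  proof -
    have "(\<lambda>n. 64 * real (s + 2) / (sqrt (real n) * v n)\<^sup>2) \<longlonglongrightarrow> 0"
      by (intro tendsto_divide_0[OF tendsto_const] filterlim_at_top_imp_at_infinity filterlim_pow_at_top v) auto
    then show ?thesis by (simp add: power_mult_distrib power_divide field_simps)
  qed
  ultimately show "?B \<longlonglongrightarrow> 0" by (intro tendsto_add_zero)
qed simp

section \<open>Comparison of the statistic with the bootstrap quantile\<close>

context
  fixes M :: "'a measure" and G :: "nat \<Rightarrow> (nat \<Rightarrow> nat) \<Rightarrow> 'a \<Rightarrow> nat \<Rightarrow> real" and v :: "nat \<Rightarrow> real" and \<alpha> :: real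
  assumes M: "prob_space M" and G: "\<And>n xs. gaussian_vec M (G n xs) (sample_max n xs + 1) (cov_n n xs)"
    and v: "\<And>n. 0 < v n" "filterlim (\<lambda>n. sqrt (real n) * v n) at_top sequentially"
    and \<alpha>: "0 < \<alpha>" "\<alpha> < 1"
begin

interpretation M: prob_space M by (rule M)

abbreviation "statistic n xs \<equiv> real n * sqnorm (\<lambda>j. emp_pmf n xs j - convex_lse n xs j)"

abbreviation "critical_value n xs \<equiv> quantile M (\<lambda>\<omega>. T_hat v n xs (G n xs \<omega>)) (1 - \<alpha>)"

lemma T_hat_measurable [measurable]: "(\<lambda>\<omega>. T_hat v n xs (G n xs \<omega>)) \<in> borel_measurable M"
  unfolding T_hat_eq_cone_dist
  by (intro borel_measurable_power coord_lipschitz_measurable[OF cone_dist_lipschitz])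
    (use G[of n xs] in \<open>auto simp: gaussian_vec_def\<close>)

lemma critical_value_nonneg: "0 \<le> critical_value n xs"
proof (rule quantile_ge[OF M T_hat_measurable])
  fix t :: real assume "t < 0"
  moreover have "0 \<le> T_hat v n xs w" for w by (simp add: T_hat_eq_cone_dist)
  ultimately have "{\<omega> \<in> space M. T_hat v n xs (G n xs \<omega>) \<le> t} = {}"
    by (auto simp: not_le intro: less_le_trans)
  then show "M.prob {\<omega> \<in> space M. T_hat v n xs (G n xs \<omega>) \<le> t} < 1 - \<alpha>"
    using \<alpha> by (simp only: measure_empty)
qed (use \<alpha> in simp)

text \<open>Samples outside \<open>good\<close> cost at most \<eta> / 2 for large n; it remains to
  find events \<open>E n\<close> that contain all rejections by good samples and have probability
  asymptotically at most \<alpha>.\<close>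

lemma eventually_rejection_le:
  assumes "0 < \<delta>" "0 < \<eta>"
    and rej: "\<And>n xs. n > 0 \<Longrightarrow> xs \<in> good \<delta> v n \<Longrightarrow> critical_value n xs < statistic n xs \<Longrightarrow> xs \<in> E n"
    and E: "eventually (\<lambda>n. measure_pmf.prob (sample n) (E n) \<le> \<alpha> + \<eta> / 2) sequentially"
  shows "eventually (\<lambda>n. measure_pmf.prob (sample n) {xs. critical_value n xs < statistic n xs} \<le> \<alpha> + \<eta>) sequentially"
proof -
  have "eventually (\<lambda>n. measure_pmf.prob (sample n) (- good \<delta> v n) < \<eta> / 2) sequentially"
    using tendsto_prob_not_good[OF assms(1) v] assms(2) by (intro order_tendstoD) auto
  then show ?thesis using E eventually_gt_at_top[of 0]
  proof eventually_elim
    case (elim n)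
    have "measure_pmf.prob (sample n) {xs. critical_value n xs < statistic n xs} \<le>
        measure_pmf.prob (sample n) (- good \<delta> v n \<union> E n)"
      by (intro measure_pmf.finite_measure_mono) (use rej[OF elim(3)] in auto)
    also have "\<dots> \<le> measure_pmf.prob (sample n) (- good \<delta> v n) + measure_pmf.prob (sample n) (E n)"
      by (rule measure_Un_le) auto
    finally show ?case using elim(1,2) by simp
  qed
qed

context
  fixes N :: "(nat \<Rightarrow> real) measure"
  assumes N: "prob_space N" "sets N = sets borel" "\<And>k. integrable N (\<lambda>x. (x k)\<^sup>2)"
    and N_cos: "\<And>c b. (\<integral>x. cos ((\<Sum>k\<le>s+1. c k * x k) + b) \<partial>N) =
       cos b * exp (- (\<Sum>k\<le>s+1. pmf p0 k * (c k - (\<Sum>j\<le>s+1. c j * pmf p0 j))\<^sup>2) / 2)"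
begin

lemma eventually_prob_scaled_dev_le:
  assumes \<psi>: "coord_lipschitz (s + 1) L \<psi>" and "0 < \<eta>"
  shows "eventually (\<lambda>n. measure_pmf.prob (sample n) {xs. a \<le> \<psi> (scaled_dev n xs)} \<le>
     measure N {x \<in> space N. a \<le> \<psi> x} + \<eta>) sequentially"
proof -
  have "eventually (\<lambda>n. measure_pmf.prob (sample n) {xs \<in> space (measure_pmf (sample n)). a \<le> \<psi> (scaled_dev n xs)} \<le>
     measure N {x \<in> space N. a \<le> \<psi> x} + \<eta>) sequentially"
  proof (rule eventually_prob_superlevel_le[where m="s+1" and C=1, OF _ N(1) _ N(3) _ \<psi> \<open>0 < \<eta>\<close>])
    show "(\<lambda>x. x k) \<in> borel_measurable N" for k
      by (rule coord_measurable_borel_fun[OF N(1,2)])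
    show "eventually (\<lambda>n. prob_space (measure_pmf (sample n)) \<and>
      (\<forall>k\<le>s+1. (\<lambda>xs. scaled_dev n xs k) \<in> borel_measurable (measure_pmf (sample n)) \<and>
        integrable (measure_pmf (sample n)) (\<lambda>xs. (scaled_dev n xs k)\<^sup>2) \<and>
        (\<integral>xs. (scaled_dev n xs k)\<^sup>2 \<partial>measure_pmf (sample n)) \<le> 1)) sequentially"
      using eventually_gt_at_top[of 0]
    proof eventually_elim
      case (elim n)
      have "integrable (measure_pmf (sample n)) f" for f :: "_ \<Rightarrow> real"
        by (rule integrable_measure_pmf_finite) (use fin_p0 in \<open>simp add: set_Pi_pmf finite_PiE_dflt\<close>)
      then show ?case
        using expectation_scaled_emp_pmf_square[OF fin_p0 elim]
        by (auto simp: scaled_dev_def measure_pmf.prob_space_axioms)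
    qed
    fix c b
    have "set_pmf p0 \<subseteq> {..s+1}" using supp by auto
    from tendsto_expectation_cos_emp_pmf[OF this, of c b]
    show "(\<lambda>n. \<integral>xs. cos ((\<Sum>k\<le>s+1. c k * scaled_dev n xs k) + b) \<partial>measure_pmf (sample n)) \<longlonglongrightarrow>
       (\<integral>x. cos ((\<Sum>k\<le>s+1. c k * x k) + b) \<partial>N)"
      unfolding N_cos scaled_dev_def .
  qed
  then show ?thesis by simp
qed

lemma prob_gaussian_le_of_close:
  assumes \<psi>: "coord_lipschitz (s + 1) L \<psi>" and "0 < \<eta>"
  shows "\<exists>\<delta>>0. \<forall>n xs. n > 0 \<longrightarrow> (\<forall>i<n. xs i \<le> s) \<longrightarrow> dev n xs < \<kappa> \<longrightarrow> dev n xs < \<delta> \<longrightarrow>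
     M.prob {\<omega> \<in> space M. a \<le> \<psi> (G n xs \<omega>)} \<le> measure N {x \<in> space N. a \<le> \<psi> x} + \<eta>"
proof -
  define A where "A = {(n, xs). n > 0 \<and> (\<forall>i<n. xs i \<le> s) \<and> dev n xs < \<kappa>}"
  \<comment> \<open>The filter of \<open>dev\<close> tending to 0 on admissible pairs. Nothing
    forces n to infinity, and unfolding the neighbourhoods of 0 at the end yields a \<delta> that is
    uniform in n and \<open>xs\<close>.\<close>
  define F where "F = inf (filtercomap (\<lambda>(n, xs). dev n xs) (nhds 0)) (principal A)"
  have sum1: "(\<Sum>k\<le>s+1. emp_pmf n xs k) = 1" if "(n, xs) \<in> A" for n xs
    using that by (intro sum_emp_pmf_eq_1) (auto simp: A_def le_SucI)
  have gv: "gaussian_vec M (G n xs) (s + 1) (cov_n n xs)" if "(n, xs) \<in> A" for n xs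
    using G[of n xs] sample_max_eq[of n xs] that by (auto simp: A_def)
  have quad: "(\<Sum>i\<le>s+1. \<Sum>j\<le>s+1. c i * c j * cov_n n xs i j) =
      (\<Sum>k\<le>s+1. emp_pmf n xs k * (c k - (\<Sum>j\<le>s+1. c j * emp_pmf n xs j))\<^sup>2)" if "(n, xs) \<in> A" for n xs c
    unfolding cov_n_def by (rule quadratic_form_multinomial[OF sum1[OF that]])
  have quad0: "0 \<le> (\<Sum>i\<le>s+1. \<Sum>j\<le>s+1. c i * c j * cov_n n xs i j)" if "(n, xs) \<in> A" for n xs c
    unfolding quad[OF that] by (intro sum_nonneg mult_nonneg_nonneg emp_pmf_nonneg) auto
  note gauss = gaussian_vec_properties[OF M gv quad0]
  have evA: "eventually (\<lambda>i. i \<in> A) F"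
    unfolding F_def eventually_inf_principal by simp
  have "((\<lambda>(n, xs). dev n xs) \<longlongrightarrow> 0) F"
    unfolding F_def by (rule tendsto_mono[OF inf_le1 filterlim_filtercomap])
  then have dev0: "((\<lambda>i. dev (fst i) (snd i)) \<longlongrightarrow> 0) F" by (simp add: case_prod_beta')
  have emp: "((\<lambda>i. emp_pmf (fst i) (snd i) k) \<longlongrightarrow> pmf p0 k) F" if "k \<le> s + 1" for k
  proof -
    have "((\<lambda>i. emp_pmf (fst i) (snd i) k - pmf p0 k) \<longlongrightarrow> 0) F"
      by (rule Lim_null_comparison[OF _ dev0]) (use dev_coord[OF that] in \<open>auto intro!: always_eventually\<close>)
    then show ?thesis by (rule LIM_zero_cancel)
  qed
  have "eventually (\<lambda>i. M.prob {\<omega> \<in> space M. a \<le> \<psi> (G (fst i) (snd i) \<omega>)} \<le>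
     measure N {x \<in> space N. a \<le> \<psi> x} + \<eta>) F"
  proof (rule eventually_prob_superlevel_le[where m="s+1" and C=1, OF _ N(1) _ N(3) _ \<psi> \<open>0 < \<eta>\<close>])
    show "(\<lambda>x. x k) \<in> borel_measurable N" for k
      by (rule coord_measurable_borel_fun[OF N(1,2)])
    show "eventually (\<lambda>i. prob_space M \<and> (\<forall>k\<le>s+1. (\<lambda>\<omega>. G (fst i) (snd i) \<omega> k) \<in> borel_measurable M \<and>
       integrable M (\<lambda>\<omega>. (G (fst i) (snd i) \<omega> k)\<^sup>2) \<and> (\<integral>\<omega>. (G (fst i) (snd i) \<omega> k)\<^sup>2 \<partial>M) \<le> 1)) F"
      using evA
    proof eventually_elim
      case (elim i)
      obtain n xs where i: "i = (n, xs)" by (cases i)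
      have A: "(n, xs) \<in> A" using elim i by simp
      have "cov_n n xs k k \<le> 1" if "k \<le> s + 1" for k
      proof -
        have "emp_pmf n xs k \<le> (\<Sum>k\<le>s+1. emp_pmf n xs k)"
          using that by (intro member_le_sum) (auto simp: emp_pmf_nonneg)
        then have "emp_pmf n xs k \<le> 1" by (simp only: sum1[OF A])
        moreover have "0 \<le> emp_pmf n xs k * emp_pmf n xs k" by simp
        moreover have "cov_n n xs k k = emp_pmf n xs k - emp_pmf n xs k * emp_pmf n xs k"
          by (simp add: cov_n_def)
        ultimately show ?thesis by linarith
      qed
      then show ?case using gauss(1-3)[OF A A] M by (simp add: i)
    qed
    fix c b
    have "((\<lambda>i. cos b * exp (- (\<Sum>k\<le>s+1. emp_pmf (fst i) (snd i) k * (c k - (\<Sum>j\<le>s+1. c j * emp_pmf (fst i) (snd i) j))\<^sup>2) / 2)) \<longlongrightarrow>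
       cos b * exp (- (\<Sum>k\<le>s+1. pmf p0 k * (c k - (\<Sum>j\<le>s+1. c j * pmf p0 j))\<^sup>2) / 2)) F"
      by (intro tendsto_intros emp) auto
    then show "((\<lambda>i. \<integral>\<omega>. cos ((\<Sum>k\<le>s+1. c k * G (fst i) (snd i) \<omega> k) + b) \<partial>M) \<longlongrightarrow>
       (\<integral>x. cos ((\<Sum>k\<le>s+1. c k * x k) + b) \<partial>N)) F"
      unfolding N_cos
    proof (rule Lim_transform_eventually)
      show "eventually (\<lambda>i. cos b * exp (- (\<Sum>k\<le>s+1. emp_pmf (fst i) (snd i) k * (c k - (\<Sum>j\<le>s+1. c j * emp_pmf (fst i) (snd i) j))\<^sup>2) / 2) =
         (\<integral>\<omega>. cos ((\<Sum>k\<le>s+1. c k * G (fst i) (snd i) \<omega> k) + b) \<partial>M)) F"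
        using evA
      proof eventually_elim
        case (elim i)
        then have A: "(fst i, snd i) \<in> A" by simp
        show ?case unfolding gauss(4)[OF A A] quad[OF A] ..
      qed
    qed
  qed
  then obtain \<delta> where "\<delta> > 0" and \<delta>: "\<And>n xs. dist (dev n xs) 0 < \<delta> \<Longrightarrow> (n, xs) \<in> A \<Longrightarrow>
      M.prob {\<omega> \<in> space M. a \<le> \<psi> (G n xs \<omega>)} \<le> measure N {x \<in> space N. a \<le> \<psi> x} + \<eta>"
    unfolding F_def eventually_inf_principal eventually_filtercomap eventually_nhds_metric by force
  show ?thesis
    by (intro exI[of _ \<delta>]) (use \<delta> \<open>\<delta> > 0\<close> dev_nonneg in \<open>auto simp: A_def\<close>)
qed

end

lemma eventually_rejection_prob_le:
  assumes "0 < \<eta>"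
  shows "eventually (\<lambda>n. measure_pmf.prob (sample n) {xs. critical_value n xs < statistic n xs} \<le> \<alpha> + \<eta>) sequentially"
proof (cases "Z = {}")
  \<comment> \<open>Without active constraints the cone is the whole space: the statistic vanishes
    on good samples, and no rejection occurs there.\<close>
  case True
  show ?thesis
  proof (rule eventually_rejection_le[where \<delta>=1 and E="\<lambda>_. {}"])
    fix n xs assume "n > 0" "xs \<in> good 1 v n" "critical_value n xs < statistic n xs"
    moreover have "cone_dist Z (s + 1) w = 0" for w
      using True by (subst cone_dist_eq_0_iff) auto
    ultimately show "xs \<in> {}"
      using statistic_le[of n xs] critical_value_nonneg[of n xs] by (simp add: good_def)
  qed (use assms \<alpha> in auto)
next
  case False
  have Z1: "Z \<subseteq> {1..<s+1}" using Z_sub by auto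
  have finZ: "finite Z" using Z_sub finite_subset by blast
  \<comment> \<open>A direction interior to the cone. Its total 0 and \<open>u (s + 1) = 0\<close>
    put it in the support of the limiting Gaussian vector, so that it can be split off as an
    independent component.\<close>
  obtain u :: "nat \<Rightarrow> real" where u: "u (s + 1) = 0" "(\<Sum>k\<le>s. u k) = 0" "\<And>x. x \<in> {1..s} \<Longrightarrow> delta2 u x = 2"
    using strictly_convex_direction_exists[of s] by blast
  have u_ne: "\<exists>k\<le>s. u k \<noteq> 0"
  proof (rule ccontr)
    assume "\<not> (\<exists>k\<le>s. u k \<noteq> 0)"
    then have u0: "u k = 0" if "k \<le> s + 1" for k using that u(1) by (cases "k = s + 1") auto
    obtain x where "x \<in> Z" using False by blast
    then have x: "x \<in> {1..s}" using Z_sub by blast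
    then have "x + 1 \<le> s + 1" "x \<le> s + 1" "x - 1 \<le> s + 1" by auto
    then have "delta2 u x = 0" using u0 by (simp add: delta2_def)
    then show False using u(3)[OF x] by simp
  qed
  obtain N0 :: "(nat \<Rightarrow> real) measure" and \<tau> where N0: "prob_space N0" "sets N0 = sets borel" "0 < \<tau>"
    "\<And>k. integrable (gauss_shift N0 (\<lambda>k. \<tau> * u k)) (\<lambda>x. (x k)\<^sup>2)"
    "\<And>c b. (\<integral>x. cos ((\<Sum>k\<le>s+1. c k * x k) + b) \<partial>gauss_shift N0 (\<lambda>k. \<tau> * u k)) =
       cos b * exp (- (\<Sum>k\<le>s+1. pmf p0 k * (c k - (\<Sum>j\<le>s+1. c j * pmf p0 j))\<^sup>2) / 2)"
    using multinomial_gaussian_exists[of s "pmf p0" u, OF _ _ u(1,2) u_ne]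
      less_le_trans[OF \<kappa> p0_ge] p0_beyond by force
  define N where "N = gauss_shift N0 (\<lambda>k. \<tau> * u k)"
  have N: "prob_space N" "sets N = sets borel" "\<And>k. integrable N (\<lambda>x. (x k)\<^sup>2)"
    "\<And>c b. (\<integral>x. cos ((\<Sum>k\<le>s+1. c k * x k) + b) \<partial>N) =
       cos b * exp (- (\<Sum>k\<le>s+1. pmf p0 k * (c k - (\<Sum>j\<le>s+1. c j * pmf p0 j))\<^sup>2) / 2)"
    unfolding N_def by (rule prob_space_gauss_shift[OF N0(1,2)] sets_gauss_shift[OF N0(1,2)] N0)+
  interpret N: prob_space N by (rule N)
  have space_N: "space N = UNIV" using sets_eq_imp_space_eq[OF N(2)] by simp
  have du: "delta2 (\<lambda>k. \<tau> * u k) x = 2 * \<tau>" if "x \<in> Z" for x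
    using u(3)[of x] that Z_sub by (auto simp: delta2_scale)
  note close = prob_gaussian_le_of_close[OF N] and clt = eventually_prob_scaled_dev_le[OF N]
  let ?D = "cone_dist Z (s + 1)"
  have D_meas: "?D \<in> borel_measurable borel"
    using coord_lipschitz_continuous[OF cone_dist_lipschitz] by (rule borel_measurable_continuous_onI)
  then have D_N [measurable]: "?D \<in> borel_measurable N" using N(2) by (simp cong: measurable_cong_sets)
  have atom: "N.prob {x. ?D x = t} = 0" if "0 < t" for t
    unfolding N_def
  proof (rule gauss_shift_null[OF N0(1,2)])
    show "{x. ?D x = t} \<in> sets borel"
      using measurable_sets[OF D_meas, of "{t}"] by (simp add: vimage_def)
    show "finite {\<xi>. (\<lambda>k. x k + \<xi> * (\<tau> * u k)) \<in> {x. ?D x = t}}" for x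
      using finite_cone_dist_level[OF Z1 _ that, of "\<lambda>k. \<tau> * u k" x] du N0(3) by simp
  qed
  show ?thesis
  proof (cases "N.prob {x. 0 < ?D x} \<le> \<alpha>")
    case True
    \<comment> \<open>The largest violation of a constraint. It is Lipschitz, and {0 \<le> \<psi>}
      is a closed event containing {0 < ?D}.\<close>
    define \<psi> where "\<psi> w = Max ((\<lambda>x. - delta2 w x) ` Z)" for w :: "nat \<Rightarrow> real"
    have \<psi>_ge: "- delta2 w x \<le> \<psi> w" if "x \<in> Z" for w x
      unfolding \<psi>_def using finZ that by (intro Max_ge) auto
    have \<psi>_in: "\<exists>x\<in>Z. \<psi> w = - delta2 w x" for w
    proof -
      have "\<psi> w \<in> (\<lambda>x. - delta2 w x) ` Z"
        unfolding \<psi>_def by (rule Max_in) (use finZ False in auto)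
      then show ?thesis by blast
    qed
    have \<psi>_le: "\<psi> w \<le> \<psi> w' + 4 * (\<Sum>i\<le>s+1. \<bar>w i - w' i\<bar>)" for w w'
    proof -
      obtain x where x: "x \<in> Z" "\<psi> w = - delta2 w x" using \<psi>_in by blast
      define d where "d = (\<Sum>i\<le>s+1. \<bar>w i - w' i\<bar>)"
      have wd: "\<bar>w k - w' k\<bar> \<le> d" if "k \<le> s + 1" for k
        unfolding d_def using that by (intro member_le_sum[of k _ "\<lambda>i. \<bar>w i - w' i\<bar>"]) auto
      have "x + 1 \<le> s + 1" using x(1) Z1 by auto
      then have "\<bar>w (x + 1) - w' (x + 1)\<bar> \<le> d" "\<bar>w x - w' x\<bar> \<le> d" "\<bar>w (x - 1) - w' (x - 1)\<bar> \<le> d"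
        by (intro wd; linarith)+
      then have "- delta2 w x \<le> - delta2 w' x + 4 * d"
        unfolding delta2_def by linarith
      then show ?thesis using \<psi>_ge[OF x(1), of w'] x(2) unfolding d_def by linarith
    qed
    have \<psi>: "coord_lipschitz (s + 1) 4 \<psi>"
      unfolding coord_lipschitz_def
    proof (intro conjI allI)
      fix w w' :: "nat \<Rightarrow> real"
      have "(\<Sum>i\<le>s+1. \<bar>w' i - w i\<bar>) = (\<Sum>i\<le>s+1. \<bar>w i - w' i\<bar>)"
        by (intro sum.cong refl abs_minus_commute)
      then show "\<bar>\<psi> w - \<psi> w'\<bar> \<le> 4 * (\<Sum>i\<le>s+1. \<bar>w i - w' i\<bar>)"
        using \<psi>_le[of w w'] \<psi>_le[of w' w] by linarith
    qed simp
    have delta2_borel: "{w. delta2 w x = 0} \<in> sets (borel :: (nat \<Rightarrow> real) measure)" for x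
    proof -
      have "continuous_on UNIV (\<lambda>w :: nat \<Rightarrow> real. delta2 w x)"
        unfolding delta2_def by (intro continuous_intros continuous_on_product_coordinates)
      then have "(\<lambda>w. delta2 w x) \<in> borel_measurable borel" by (rule borel_measurable_continuous_onI)
      from measurable_sets[OF this, of "{0}"] show ?thesis by (simp add: vimage_def)
    qed
    have null: "N.prob {w. delta2 w x = 0} = 0" if "x \<in> Z" for x
      unfolding N_def
    proof (rule gauss_shift_null[OF N0(1,2) delta2_borel])
      fix w
      have "{\<xi>. (\<lambda>k. w k + \<xi> * (\<tau> * u k)) \<in> {w. delta2 w x = 0}} \<subseteq> {- delta2 w x / (2 * \<tau>)}"
        using N0(3) by (auto simp: delta2_add delta2_scale[of _ "\<lambda>k. \<tau> * u k"] du[OF that] field_simps)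
      then show "finite {\<xi>. (\<lambda>k. w k + \<xi> * (\<tau> * u k)) \<in> {w. delta2 w x = 0}}"
        by (rule finite_subset) simp
    qed
    have setsN: "{w. delta2 w x = 0} \<in> N.events" for x
      unfolding N(2) by (rule delta2_borel)
    have Dpos: "{x. 0 < ?D x} \<in> N.events"
      using measurable_sets[OF D_meas, of "{0<..}"] by (simp add: vimage_def N(2))
    have "N.prob {w \<in> space N. 0 \<le> \<psi> w} \<le> N.prob ({x. 0 < ?D x} \<union> (\<Union>x\<in>Z. {w. delta2 w x = 0}))"
    proof (rule N.finite_measure_mono)
      show "{w \<in> space N. 0 \<le> \<psi> w} \<subseteq> {x. 0 < ?D x} \<union> (\<Union>x\<in>Z. {w. delta2 w x = 0})"
      proof
        fix w assume "w \<in> {w \<in> space N. 0 \<le> \<psi> w}"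
        then obtain x where x: "x \<in> Z" "delta2 w x \<le> 0" using \<psi>_in[of w] by force
        show "w \<in> {x. 0 < ?D x} \<union> (\<Union>x\<in>Z. {w. delta2 w x = 0})"
        proof (cases "delta2 w x = 0")
          case False
          then have "?D w \<noteq> 0" using x by (subst cone_dist_eq_0_iff[OF Z1]) force
          then show ?thesis using cone_dist_nonneg[of Z "s + 1" w] by simp
        qed (use x in auto)
      qed
    qed (use Dpos setsN finZ in auto)
    also have "\<dots> \<le> N.prob {x. 0 < ?D x} + N.prob (\<Union>x\<in>Z. {w. delta2 w x = 0})"
      by (rule measure_Un_le) (use Dpos setsN finZ in auto)
    also have "N.prob (\<Union>x\<in>Z. {w. delta2 w x = 0}) \<le> (\<Sum>x\<in>Z. N.prob {w. delta2 w x = 0})"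
      by (rule measure_UNION_le) (use setsN finZ in auto)
    also have "\<dots> = 0" by (simp add: null)
    finally have \<psi>\<alpha>: "N.prob {w \<in> space N. 0 \<le> \<psi> w} \<le> \<alpha>" using True by simp
    show ?thesis
    proof (rule eventually_rejection_le[where \<delta>=1 and E="\<lambda>n. {xs. 0 \<le> \<psi> (scaled_dev n xs)}"])
      fix n xs assume n: "n > 0" and xs: "xs \<in> good 1 v n" and rej: "critical_value n xs < statistic n xs"
      have "statistic n xs \<le> (?D (scaled_dev n xs))\<^sup>2"
        by (rule statistic_le[OF n]) (use xs in \<open>auto simp: good_def\<close>)
      then have "?D (scaled_dev n xs) \<noteq> 0"
        using rej critical_value_nonneg[of n xs] by auto
      then obtain x where "x \<in> Z" "delta2 (scaled_dev n xs) x < 0"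
        by (subst (asm) cone_dist_eq_0_iff[OF Z1]) (auto simp: not_le)
      then show "xs \<in> {xs. 0 \<le> \<psi> (scaled_dev n xs)}"
        using \<psi>_ge[of x "scaled_dev n xs"] by simp
    next
      show "eventually (\<lambda>n. measure_pmf.prob (sample n) {xs. 0 \<le> \<psi> (scaled_dev n xs)} \<le> \<alpha> + \<eta> / 2) sequentially"
        using clt[OF \<psi>, of "\<eta> / 2" 0] assms by (auto elim!: eventually_mono intro: order_trans[OF _ add_right_mono[OF \<psi>\<alpha>]])
    qed (use assms in auto)
  next
    case False
    interpret F: real_distribution "distr N borel ?D" by (rule N.real_distribution_distr[OF D_N])
    let ?F = "cdf (distr N borel ?D)"
    have F: "?F t = N.prob {x. ?D x \<le> t}" for t
      unfolding cdf_def by (subst measure_distr[OF D_N]) (auto simp: vimage_def space_N)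
    have F_point: "measure (distr N borel ?D) {t} = 0" if "0 < t" for t
      using atom[OF that] by (subst measure_distr[OF D_N]) (auto simp: vimage_def space_N)
    have compl: "N.prob {x. t < ?D x} = 1 - ?F t" for t
    proof -
      have "N.prob (space N - {x. ?D x \<le> t}) = 1 - N.prob {x. ?D x \<le> t}"
        using measurable_sets[OF D_N, of "{..t}"] by (intro N.prob_compl) (simp add: vimage_def space_N)
      also have "space N - {x. ?D x \<le> t} = {x. t < ?D x}" by (auto simp: space_N)
      finally show ?thesis by (simp only: F)
    qed
    have F0: "?F 0 < 1 - \<alpha>" using False compl[of 0] by simp
    \<comment> \<open>A level strictly between the atom \<open>?F 0\<close> and 1 - \<alpha>, yet
      within \<eta> / 4 of the latter; it will be attained exactly, by continuity of the
      distribution function on the positive half-line.\<close>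
    define y where "y = max ((?F 0 + (1 - \<alpha>)) / 2) (1 - \<alpha> - \<eta> / 4)"
    have y: "?F 0 < y" "y < 1 - \<alpha>" "1 - \<alpha> - \<eta> / 4 \<le> y" using F0 assms by (auto simp: y_def max_def)
    have "eventually (\<lambda>t. y < ?F t) at_top"
      by (rule order_tendstoD(1)[OF F.cdf_lim_at_top_prob]) (use y(2) \<alpha> in simp)
    then obtain b where b: "0 < b" "y < ?F b"
      using eventually_happens'[OF _ eventually_conj[OF eventually_gt_at_top[of 0]]] trivial_limit_at_top_linorder by blast
    \<comment> \<open>Right continuity at 0 gives a positive \<open>c\<close> still below the level,
      so the intermediate value theorem is applied away from the atom.\<close>
    have "eventually (\<lambda>t. ?F t < y) (at_right 0)"
      using F.cdf_is_right_cont[of 0] y(1) unfolding continuous_within by (rule order_tendstoD(2))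
    then obtain c where c: "0 < c" "?F c < y"
      unfolding eventually_at_right_field by (metis dense)
    have "c \<le> b" using b c F.cdf_nondecreasing[of b c] by (cases "c \<le> b") auto
    moreover have "continuous_on {c..b} ?F"
      by (intro continuous_at_imp_continuous_on ballI F.isCont_cdf[THEN iffD2] F_point) (use c(1) in auto)
    ultimately obtain a where a: "c \<le> a" "?F a = y"
      using IVT'[of ?F c y b] b c by auto
    have a0: "0 < a" using a c by simp
    have ge_a: "N.prob {x \<in> space N. a \<le> ?D x} \<le> \<alpha> + \<eta> / 4"
    proof -
      have ev: "{x. a < ?D x} \<in> N.events" "{x. ?D x = a} \<in> N.events"
        using measurable_sets[OF D_N, of "{a<..}"] measurable_sets[OF D_N, of "{a}"]
        by (simp_all add: vimage_def space_N)
      have "N.prob {x \<in> space N. a \<le> ?D x} \<le> N.prob ({x. a < ?D x} \<union> {x. ?D x = a})"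
        by (rule N.finite_measure_mono) (use ev in auto)
      also have "\<dots> \<le> N.prob {x. a < ?D x} + N.prob {x. ?D x = a}"
        by (rule measure_Un_le) (use ev in auto)
      finally show ?thesis using y(3) compl[of a] a(2) atom[OF a0] by linarith
    qed
    \<comment> \<open>Half the gap between \<open>y\<close> and 1 - \<alpha>: with an error of this
      size the bootstrap probability of a distance at most \<open>a\<close> stays below 1 -
      \<alpha>.\<close>
    define \<eta>' where "\<eta>' = (1 - \<alpha> - y) / 2"
    have \<eta>': "0 < \<eta>'" "y + \<eta>' < 1 - \<alpha>" using y(2) by (auto simp: \<eta>'_def field_simps)
    \<comment> \<open>The inequality for closed sets is applied to the negative distance, because
      bounding the quantile from below needs an upper bound for a lower tail.\<close>
    obtain \<delta> where \<delta>: "0 < \<delta>" "\<And>n xs. n > 0 \<Longrightarrow> (\<forall>i<n. xs i \<le> s) \<Longrightarrow> dev n xs < \<kappa> \<Longrightarrow> dev n xs < \<delta> \<Longrightarrow>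
       M.prob {\<omega> \<in> space M. - a \<le> - ?D (G n xs \<omega>)} \<le> N.prob {x \<in> space N. - a \<le> - ?D x} + \<eta>'"
      using close[OF coord_lipschitz_uminus[OF cone_dist_lipschitz] \<eta>'(1), of "- a"] by blast
    show ?thesis
    proof (rule eventually_rejection_le[where \<delta>=\<delta> and E="\<lambda>n. {xs. a \<le> ?D (scaled_dev n xs)}"])
      fix n xs assume n: "n > 0" and xs: "xs \<in> good \<delta> v n" and rej: "critical_value n xs < statistic n xs"
      have g: "\<And>i. i < n \<Longrightarrow> xs i \<le> s" "dev n xs < \<delta>" "dev n xs < \<kappa> / 8" "dev n xs \<le> v n / 8" "dev n xs < \<kappa>"
        using xs \<kappa> by (auto simp: good_def)
      have sm: "sample_max n xs = s" by (rule sample_max_eq[OF n _ g(5)]) (rule g)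
      have [measurable]: "(\<lambda>\<omega>. ?D (G n xs \<omega>)) \<in> borel_measurable M"
        by (rule coord_lipschitz_measurable[OF cone_dist_lipschitz])
          (use G[of n xs] sm in \<open>auto simp: gaussian_vec_def\<close>)
      have T: "(?D w)\<^sup>2 \<le> T_hat v n xs w" for w
        by (rule T_hat_ge[OF n]) (use g v(1) in auto)
      have "a\<^sup>2 \<le> critical_value n xs"
      proof (rule quantile_ge[OF M T_hat_measurable])
        fix t assume t: "t < a\<^sup>2"
        have "M.prob {\<omega> \<in> space M. T_hat v n xs (G n xs \<omega>) \<le> t} \<le> M.prob {\<omega> \<in> space M. - a \<le> - ?D (G n xs \<omega>)}"
        proof (rule M.finite_measure_mono)
          have "?D w \<le> a" if "T_hat v n xs w \<le> t" for w
          proof -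
            have "(?D w)\<^sup>2 \<le> a\<^sup>2" using T[of w] that t by linarith
            then show ?thesis by (rule power2_le_imp_le) (use a0 in simp)
          qed
          then show "{\<omega> \<in> space M. T_hat v n xs (G n xs \<omega>) \<le> t} \<subseteq> {\<omega> \<in> space M. - a \<le> - ?D (G n xs \<omega>)}"
            by auto
        qed measurable
        also have "\<dots> \<le> N.prob {x \<in> space N. - a \<le> - ?D x} + \<eta>'"
          by (rule \<delta>(2)) (use n g in auto)
        also have "{x \<in> space N. - a \<le> - ?D x} = {x. ?D x \<le> a}" by (auto simp: space_N)
        also have "N.prob \<dots> = y" using a(2) by (simp only: F)
        finally show "M.prob {\<omega> \<in> space M. T_hat v n xs (G n xs \<omega>) \<le> t} < 1 - \<alpha>" using \<eta>'(2) by simp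
      qed (use \<alpha> in simp)
      also have "\<dots> < statistic n xs" by (rule rej)
      also have "\<dots> \<le> (?D (scaled_dev n xs))\<^sup>2"
        by (rule statistic_le[OF n]) (use g in auto)
      finally have "a < ?D (scaled_dev n xs)"
        by (rule power2_less_imp_less) (rule cone_dist_nonneg)
      then show "xs \<in> {xs. a \<le> ?D (scaled_dev n xs)}" by simp
    next
      show "eventually (\<lambda>n. measure_pmf.prob (sample n) {xs. a \<le> ?D (scaled_dev n xs)} \<le> \<alpha> + \<eta> / 2) sequentially"
      proof (rule eventually_mono[OF clt[OF cone_dist_lipschitz]])
        show "0 < \<eta> / 4" using assms by simp
        fix n assume "measure_pmf.prob (sample n) {xs. a \<le> ?D (scaled_dev n xs)} \<le> N.prob {x \<in> space N. a \<le> ?D x} + \<eta> / 4"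
        then show "measure_pmf.prob (sample n) {xs. a \<le> ?D (scaled_dev n xs)} \<le> \<alpha> + \<eta> / 2"
          using ge_a by simp
      qed
    qed (use \<delta> assms in auto)
  qed
qed

end

end

text \<open>Convexity together with vanishing mass beyond \<open>s\<close> makes the pmf
  nonincreasing, so the masses on \<open>{..s}\<close> are at least the positive one at
  \<open>s\<close>. The constant \<open>\<kappa>\<close> is then a minimum of finitely many positive
  numbers.\<close>

lemma convex_truth_exists:
  assumes convex: "\<And>k. 1 \<le> k \<Longrightarrow> 0 \<le> delta2 (pmf p0) k" and fin: "finite (set_pmf p0)"
  shows "\<exists>s Z \<kappa>. convex_truth p0 s Z \<kappa>"
proof -
  define s where "s = Max (set_pmf p0)"
  have s: "s \<in> set_pmf p0" unfolding s_def using fin set_pmf_not_empty by (rule Max_in)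
  have beyond: "pmf p0 k = 0" if "k > s" for k
    using that Max_ge[OF fin, of k] by (auto simp: s_def pmf_eq_0_set_pmf)
  \<comment> \<open>The induction runs downward from \<open>s\<close>; once \<open>i\<close> reaches
    \<open>s\<close>, truncated subtraction makes both sides equal.\<close>
  have step: "pmf p0 (s - i) \<le> pmf p0 (s - Suc i)" for i
  proof (induction i)
    case 0
    show ?case
    proof (cases "s = 0")
      case False
      then have "0 \<le> delta2 (pmf p0) s" using convex[of s] by simp
      then have "2 * pmf p0 s \<le> pmf p0 (s - Suc 0)" using beyond[of "s + 1"] by (simp add: delta2_def)
      then show ?thesis using pmf_nonneg[of p0 s] unfolding diff_zero by linarith
    qed simp
  next
    case (Suc i)
    show ?case
    proof (cases "Suc i < s")
      case True
      then have "0 \<le> delta2 (pmf p0) (s - Suc i)" by (intro convex) simp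
      moreover have "s - Suc i + 1 = s - i" "s - Suc i - 1 = s - Suc (Suc i)" using True by auto
      ultimately show ?thesis using Suc unfolding delta2_def by simp
    qed simp
  qed
  have ge: "pmf p0 s \<le> pmf p0 k" if "k \<le> s" for k
  proof -
    have "pmf p0 (s - 0) \<le> pmf p0 (s - (s - k))"
      by (rule lift_Suc_mono_le[of "\<lambda>i. pmf p0 (s - i)", OF step]) simp
    then show ?thesis using that by simp
  qed
  define Z where "Z = {x \<in> {1..s}. delta2 (pmf p0) x = 0}"
  define \<kappa> where "\<kappa> = Min (insert (pmf p0 s) (delta2 (pmf p0) ` ({1..s} - Z)))"
  have "0 < \<kappa>"
    unfolding \<kappa>_def
  proof (subst Min_gr_iff)
    show "\<forall>y\<in>insert (pmf p0 s) (delta2 (pmf p0) ` ({1..s} - Z)). 0 < y"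
      using s convex by (force simp: Z_def set_pmf_iff pmf_pos order_less_le)
  qed auto
  moreover have "\<kappa> \<le> pmf p0 s" "\<And>x. x \<in> {1..s} - Z \<Longrightarrow> \<kappa> \<le> delta2 (pmf p0) x"
    unfolding \<kappa>_def by (intro Min_le; auto)+
  ultimately have "convex_truth p0 s Z \<kappa>"
    unfolding convex_truth_def using ge Max_ge[OF fin]
    by (auto simp: Z_def s_def intro: order_trans)
  then show ?thesis by blast
qed

theorem theorem3:
  fixes p0 :: "nat pmf" and S :: nat and v :: "nat \<Rightarrow> real" and \<alpha> :: real
    and M :: "'a measure" and G :: "nat \<Rightarrow> (nat \<Rightarrow> nat) \<Rightarrow> 'a \<Rightarrow> nat \<Rightarrow> real"
  assumes convex: "\<forall>k\<ge>1. 0 \<le> delta2 (pmf p0) k"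
    and supp: "set_pmf p0 \<subseteq> {0..S}" and S_pos: "S > 0"
    and v_pos: "\<forall>n. v n > 0" and v_lim: "v \<longlonglongrightarrow> 0"
    and v_rate: "filterlim (\<lambda>n. sqrt (real n) * v n) at_top sequentially"
    and alpha: "0 < \<alpha>" "\<alpha> < 1"
    and M: "prob_space M"
    and G: "\<forall>n xs. gaussian_vec M (G n xs) (sample_max n xs + 1) (cov_n n xs)"
  shows "limsup (\<lambda>n. ereal (measure_pmf.prob (Pi_pmf {..<n} 0 (\<lambda>_. p0))
            {xs. real n * sqnorm (\<lambda>j. emp_pmf n xs j - convex_lse n xs j)
                 > quantile M (\<lambda>\<omega>. T_hat v n xs (G n xs \<omega>)) (1 - \<alpha>)}))
         \<le> ereal \<alpha>"
proof -
  have "finite (set_pmf p0)" using supp finite_subset by blast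
  then obtain s Z \<kappa> where "convex_truth p0 s Z \<kappa>"
    using convex_truth_exists[of p0] convex by blast
  then interpret convex_truth p0 s Z \<kappa> .
  show ?thesis
  proof (rule ereal_le_epsilon2)
    fix \<eta> :: real assume "0 < \<eta>"
    have "eventually (\<lambda>n. measure_pmf.prob (Pi_pmf {..<n} 0 (\<lambda>_. p0))
            {xs. real n * sqnorm (\<lambda>j. emp_pmf n xs j - convex_lse n xs j)
                 > quantile M (\<lambda>\<omega>. T_hat v n xs (G n xs \<omega>)) (1 - \<alpha>)} \<le> \<alpha> + \<eta>) sequentially"
      by (rule eventually_rejection_prob_le[OF M _ _ v_rate alpha \<open>0 < \<eta>\<close>]) (use G v_pos in auto)
    then show "limsup (\<lambda>n. ereal (measure_pmf.prob (Pi_pmf {..<n} 0 (\<lambda>_. p0))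
            {xs. real n * sqnorm (\<lambda>j. emp_pmf n xs j - convex_lse n xs j)
                 > quantile M (\<lambda>\<omega>. T_hat v n xs (G n xs \<omega>)) (1 - \<alpha>)})) \<le> ereal \<alpha> + ereal \<eta>"
      by (intro Limsup_bounded) (auto elim!: eventually_mono)
  qed
qed

end
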